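(* Let $q$ be a prime power, $p=\mathrm{char}(\mathbf{F}_q)$ and $a = |\mathrm{Aut}(\mathbf{F}_q)| = \log_p(q)$. For $q$ fixed and $n \rightarrow \infty$, the numbers $N_{n,q}^{\mathfrak{S}}$, $N_{n,q}^{\mathfrak{M}}$, $N_{n,q}^{\Gamma}$ of linear $q$-ary codes of length $n$ up to permutation, monomial, and semi-linear monomial equivalence, respectively, satisfy $$N_{2n+1,q}^{\mathfrak{S}} \sim \frac{\vartheta_2(0,q^{-1})}{\phi(q^{-1})} \cdot \frac{q^{\frac{(2n+1)^2}{4}}}{(2n+1)!}, \qquad N_{2n,q}^{\mathfrak{S}} \sim \frac{\vartheta_3(0,q^{-1})}{\phi(q^{-1})} \cdot \frac{q^{n^2}}{(2n)!},$$ $$N_{2n+1,q}^{\mathfrak{M}} \sim \frac{\vartheta_2(0,q^{-1})}{\phi(q^{-1})} \cdot \frac{q^{\frac{(2n+1)^2}{4}}}{(2n+1)!(q-1)^{2n}}, \qquad N_{2n,q}^{\mathfrak{M}} \sim \frac{\vartheta_3(0,q^{-1})}{\phi(q^{-1})} \cdot \frac{q^{n^2}}{(2n)!(q-1)^{2n-1}},$$ $$N_{2n+1,q}^{\Gamma} \sim \frac{\vartheta_2(0,q^{-1})}{\phi(q^{-1})} \cdot \frac{q^{\frac{(2n+1)^2}{4}}}{(2n+1)!(q-1)^{2n}a}, \qquad N_{2n,q}^{\Gamma} \sim \frac{\vartheta_3(0,q^{-1})}{\phi(q^{-1})} \cdot \frac{q^{n^2}}{(2n)!(q-1)^{2n-1}a}.$$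 Furthermore, for each fixed $n$, as $q\to\infty$ (through prime powers), $$\frac{\vartheta_2(0,q^{-1})}{\phi(q^{-1})} \cdot q^{\frac{(2n+1)^2}{4}} \sim 2q^{n(n+1)}, \qquad \frac{\vartheta_3(0,q^{-1})}{\phi(q^{-1})} \cdot q^{n^2} \sim q^{n^2} .$$
   Context: $f\sim g$ means that the quotient $f/g$ tends to $1$. $\phi(x) = \prod_{m=1}^\infty (1-x^{m})$, and $\vartheta_2(0,x) = \sum_{k\in\mathbf{Z}} x^{(k+ 1/2)^2}$, $\vartheta_3(0,x) = \sum_{k\in\mathbf{Z}} x^{k^2}$ are the Jacobi theta functions at $z=0$ (with positive real fractional powers for $0<x<1$). A linear $q$-ary code of length $n$ is an $\mathbf{F}_q$-linear subspace of $\mathbf{F}_q^n$ (of any dimension). The numbers $N_{n,q}^{\mathfrak{S}}$, $N_{n,q}^{\mathfrak{M}}$, $N_{n,q}^{\Gamma}$ are the numbers of orbits on the set of all subspaces of $\mathbf{F}_q^n$ of, respectively: the symmetric group $\mathfrak{S}_n$ permuting coordinates (permutation equivalence); the group of monomial $n\times n$ matrices over $\mathbf{F}_q$, i.e. products of a permutation matrix and an invertible diagonal matrix (monomial equivalence); and the group generated by the monomial matrices and the field automorphisms $\mathrm{Aut}(\mathbf{F}_q)$ acting coordinatewise (semi-linear monomial equivalence). *)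

theory Defs
  imports
    "HOL-Analysis.Infinite_Sum"
    "HOL-Analysis.Infinite_Products"
    "HOL-Library.Landau_Symbols"
    "HOL-Number_Theory.Prime_Powers"
    "HOL-Algebra.Group_Action"
    "HOL-Algebra.Generated_Groups"
    "Jordan_Normal_Form.VS_Connect"
begin

text \<open>A finite field is a type of class \<open>{field, finite}\<close>; its order is \<open>CARD('a)\<close>.
  The space $F_q^n$ is \<open>carrier_vec n\<close>.\<close>

definition linear_codes :: "'a::{field,finite} itself \<Rightarrow> nat \<Rightarrow> 'a Matrix.vec set set" where
  "linear_codes T n =
     {C. VectorSpace.subspace (class_ring :: 'a ring) C (module_vec TYPE('a) n)}"

definition field_auts :: "('a::field \<Rightarrow> 'a) set" where
  "field_auts = {\<sigma>. field_hom \<sigma> \<and> bij \<sigma>}"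

definition perm_mat :: "nat \<Rightarrow> (nat \<Rightarrow> nat) \<Rightarrow> 'a::field Matrix.mat" where
  "perm_mat n \<pi> = Matrix.mat n n (\<lambda>(i, j). if i = \<pi> j then 1 else 0)"

definition monomial_mats :: "nat \<Rightarrow> 'a::field Matrix.mat set" where
  "monomial_mats n =
     {perm_mat n \<pi> * D | \<pi> D. \<pi> permutes {..<n} \<and>
        D \<in> carrier_mat n n \<and> diagonal_mat D \<and> invertible_mat D}"

text \<open>The groups act on \<open>carrier_vec n\<close>, so they are given by sets of elements of
  \<open>BijGroup (carrier_vec n)\<close>, whose elements are extensional functions; this is why the
  maps are restricted.\<close>

definition coord_perm_maps :: "nat \<Rightarrow> ('a::field Matrix.vec \<Rightarrow> 'a Matrix.vec) set" where
  "coord_perm_maps n =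
     {restrict (\<lambda>v. Matrix.vec n (\<lambda>i. vec_index v (\<pi> i))) (carrier_vec n) | \<pi>. \<pi> permutes {..<n}}"

definition monomial_maps :: "nat \<Rightarrow> ('a::field Matrix.vec \<Rightarrow> 'a Matrix.vec) set" where
  "monomial_maps n = {restrict (\<lambda>v. mult_mat_vec M v) (carrier_vec n) | M. M \<in> monomial_mats n}"

definition field_aut_maps :: "nat \<Rightarrow> ('a::field Matrix.vec \<Rightarrow> 'a Matrix.vec) set" where
  "field_aut_maps n = {restrict (map_vec \<sigma>) (carrier_vec n) | \<sigma>. \<sigma> \<in> field_auts}"

text \<open>The number of orbits of a group \<open>H\<close> of bijections of $F_q^n$ on the set of all codes
  of length \<open>n\<close>.\<close>

definition num_code_orbits ::
  "nat \<Rightarrow> ('a::{field,finite} Matrix.vec \<Rightarrow> 'a Matrix.vec) set \<Rightarrow> nat" where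
  "num_code_orbits n H =
     card (orbits (BijGroup (carrier_vec n)\<lparr>carrier := H\<rparr>) (linear_codes TYPE('a) n) (\<lambda>g C. g ` C))"

definition N_perm :: "'a::{field,finite} itself \<Rightarrow> nat \<Rightarrow> nat" where
  "N_perm T n = num_code_orbits n (coord_perm_maps n :: ('a Matrix.vec \<Rightarrow> _) set)"

definition N_mon :: "'a::{field,finite} itself \<Rightarrow> nat \<Rightarrow> nat" where
  "N_mon T n = num_code_orbits n (monomial_maps n :: ('a Matrix.vec \<Rightarrow> _) set)"

definition N_semilin :: "'a::{field,finite} itself \<Rightarrow> nat \<Rightarrow> nat" where
  "N_semilin T n = num_code_orbits n
     (generate (BijGroup (carrier_vec n))
        (monomial_maps n \<union> field_aut_maps n :: ('a Matrix.vec \<Rightarrow> _) set))"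

definition phi :: "real \<Rightarrow> real" where
  "phi x = (\<Prod>m. 1 - x ^ Suc m)"

text \<open>The theta constants $\vartheta_2(0,x)$ and $\vartheta_3(0,x)$, for $0 < x < 1$.\<close>

definition theta2 :: "real \<Rightarrow> real" where
  "theta2 x = (\<Sum>\<^sub>\<infinity>k::int. x powr ((of_int k + 1/2)\<^sup>2))"

definition theta3 :: "real \<Rightarrow> real" where
  "theta3 x = (\<Sum>\<^sub>\<infinity>k::int. x powr ((of_int k)\<^sup>2))"

end

theory Submission
  imports
    Defs
    "HOL-Library.Function_Algebras"
    "HOL-Real_Asymp.Real_Asymp"
    "HOL-Analysis.Infinite_Set_Sum"
    "Jordan_Normal_Form.Char_Poly"
    "HOL-Algebra.Multiplicative_Group"
    "HOL-Number_Theory.Cong"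
begin

text \<open>By Burnside's lemma, the number of orbits times the group order is the number of pairs of a
  group element and an invariant code. The \<open>z\<close> scalars in the group fix every code, which
  contributes \<open>z\<close> times the total number of subspaces of $F_q^n$; normalised by
  $q^{n^2/4}$ this number tends to $\vartheta/\phi$ by dominated convergence. All other elements together
  contribute $o(q^{n^2/4})$. Indeed, if a monomial map differs from every scalar in at least \<open>k\<close>
  coordinates, then its eigenspaces have codimension at least $k/2$, and the number of its invariant
  subspaces is at most a polynomial in \<open>n\<close> times $q^{n^2/4 - nk/512}$, whereas there are at most
  $q (nq)^k$ such maps with given \<open>k\<close>. A semilinear map that is not linear has at most about
  $q^{n^2/4 - n^2/512}$ invariant subspaces, which beats the group order.\<close>

subsection \<open>Counting subspaces over a finite field\<close>

text \<open>Counting invariant subspaces is cheap when a vector v brings a new direction g v with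
  it. The obstacle is a subspace lying almost inside one eigenspace, where g v adds nothing; such
  subspaces are counted apart, through an eigenspace that is itself small in the whole space.
  Distinct scalars cannot both have eigenspaces of more than half the dimension, so only one scalar
  has to be watched. The exponents have much slack: a coordinate deviating from a scalar multiplies
  the number of maps by about n q but saves q^(n/512), and any positive constant in place of 1/512
  would serve. The theta constants arise because the number of subspaces of dimension d is q^(n^2/4
  - (d - n/2)^2) times a quotient of partial Euler products that tends to 1/phi. The central
  counting bound asks only for an additive map, so it serves the linear and the semilinear
  case.\<close>

locale finite_field_space = vector_space scale
  for scale :: "'a::{field,finite} \<Rightarrow> 'b::ab_group_add \<Rightarrow> 'b" (infixr \<open>*\<^sub>F\<close> 75) +
  fixes q :: nat
  assumes q_eq: "q = CARD('a)"
begin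

lemma q_ge_2: "q \<ge> 2"
proof -
  have "card {0, 1 :: 'a} \<le> q" unfolding q_eq by (rule card_mono) auto
  then show ?thesis by simp
qed

lemma real_q_ge_2: "real q \<ge> 2"
  using q_ge_2 by linarith

lemma span_insert_subspace:
  assumes "subspace T"
  shows "span (insert v T) = (\<lambda>(c, t). c *\<^sub>F v + t) ` (UNIV \<times> T)"
proof -
  have "x \<in> span (insert v T) \<longleftrightarrow> (\<exists>c t. t \<in> T \<and> x = c *\<^sub>F v + t)" for x
    unfolding span_breakdown_eq span_eq_iff[THEN iffD2, OF assms]
    by (metis add.commute diff_add_cancel add_diff_cancel_left')
  then show ?thesis unfolding set_eq_iff image_iff by force
qed

lemma card_span_insert:
  assumes T: "subspace T" "finite T" and v: "v \<notin> T"
  shows "finite (span (insert v T))" "card (span (insert v T)) = q * card T"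
proof -
  have "inj_on (\<lambda>(c, t). c *\<^sub>F v + t) (UNIV \<times> T)"
  proof (rule inj_onI, clarify)
    fix c t c' t'
    assume t: "t \<in> T" "t' \<in> T" and eq: "c *\<^sub>F v + t = c' *\<^sub>F v + t'"
    have "(c - c') *\<^sub>F v = t' - t"
      using eq by (simp add: scale_left_diff_distrib algebra_simps)
    then have mem: "(c - c') *\<^sub>F v \<in> T" using t T(1) by (simp add: subspace_diff)
    have "c = c'"
    proof (rule ccontr)
      assume "c \<noteq> c'"
      then have "v = inverse (c - c') *\<^sub>F ((c - c') *\<^sub>F v)" by simp
      then show False using mem T(1) v subspace_scale by metis
    qed
    then show "c = c' \<and> t = t'" using eq by simp
  qed
  then show "card (span (insert v T)) = q * card T"
    unfolding span_insert_subspace[OF T(1)] by (simp add: card_image card_cartesian_product q_eq)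
  show "finite (span (insert v T))"
    unfolding span_insert_subspace[OF T(1)] using T(2) by simp
qed

lemma span_insert_le:
  assumes "subspace U" "T \<subseteq> U" "v \<in> U"
  shows "span (insert v T) \<subseteq> U"
  using assms span_minimal[of "insert v T" U] by simp

text \<open>This stands in for the dimension of S/T. Dimensions appear in the counting only as
  exponents of cardinalities, so no bases are chosen.\<close>

lemma card_subspace_dvd:
  assumes "subspace T" "subspace S" "finite S" "T \<subseteq> S"
  shows "\<exists>k. card S = q ^ k * card T"
  using assms
proof (induction "card S - card T" arbitrary: T rule: less_induct)
  case less
  show ?case
  proof (cases "T = S")
    case True then show ?thesis by (intro exI[of _ 0]) simp
  next
    case False
    then obtain v where v: "v \<in> S" "v \<notin> T" using less.prems by blast
    let ?T = "span (insert v T)"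
    have fin: "finite T" using less.prems finite_subset by blast
    note c = card_span_insert[OF less.prems(1) fin v(2)]
    have sub: "?T \<subseteq> S" using span_insert_le less.prems v by blast
    have "0 < card T" using fin less.prems(1) subspace_0 card_gt_0_iff by blast
    then have "card T < card ?T" using c q_ge_2 by simp
    moreover have "card ?T \<le> card S" using sub less.prems card_mono by blast
    ultimately have "card S - card ?T < card S - card T" by linarith
    from less.hyps[OF this _ less.prems(2,3) sub] obtain k where "card S = q ^ k * card ?T" by auto
    then have "card S = q ^ Suc k * card T" using c by simp
    then show ?thesis by blast
  qed
qed

lemma card_subspace:
  assumes "subspace S" "finite S"
  shows "\<exists>d. card S = q ^ d"
  using card_subspace_dvd[of "{0}" S] assms subspace_0 by auto

lemma q_power_le_iff: "q ^ i \<le> q ^ j \<longleftrightarrow> i \<le> j"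
  using q_ge_2 by (intro power_increasing_iff) auto

lemma q_power_eq_iff: "q ^ i = q ^ j \<longleftrightarrow> i = j"
  using q_ge_2 by (intro power_inject_exp) auto

text \<open>For subspaces T of V with q^i and q^n elements, the cardinality is the Gaussian binomial
  coefficient [n - i choose d - i] to base q. The variable lower end T allows induction.\<close>

definition between :: "'b set \<Rightarrow> 'b set \<Rightarrow> nat \<Rightarrow> 'b set set" where
  "between T V d = {U. subspace U \<and> T \<subseteq> U \<and> U \<subseteq> V \<and> card U = q ^ d}"

lemma finite_between: "finite V \<Longrightarrow> finite (between T V d)"
  by (rule finite_subset[of _ "Pow V"]) (auto simp: between_def)

lemma between_insert:
  "between (span (insert v T)) V d = {U \<in> between T V d. v \<in> U}"
  using span_insert_le span_superset unfolding between_def by blast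

lemma sum_card_between_insert:
  assumes "finite V" "finite A"
  shows "(\<Sum>v\<in>A. card (between (span (insert v T)) V d)) = (\<Sum>U\<in>between T V d. card (A \<inter> U))"
proof -
  have "(\<Sum>v\<in>A. card (between (span (insert v T)) V d)) =
      (\<Sum>v\<in>A. \<Sum>U\<in>{U \<in> between T V d. v \<in> U}. 1)"
    by (simp add: between_insert)
  also have "\<dots> = (\<Sum>U\<in>between T V d. \<Sum>v\<in>{v \<in> A. v \<in> U}. 1)"
    by (rule sum.swap_restrict) (use assms finite_between in auto)
  finally show ?thesis by (simp add: Int_def)
qed

text \<open>Pairs (v, U) with v in U but not in T are counted twice: a fixed v leaves the subspaces
  above the span of T and v, known by induction on d - i, and a fixed U has q^d - q^i such
  vectors.\<close>

lemma card_between: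
  assumes "finite V" "subspace V" "subspace T" "T \<subseteq> V"
    and "card T = q ^ i" "card V = q ^ n" "i \<le> d" "d \<le> n"
  shows "real (card (between T V d)) = (\<Prod>j\<in>{i..<d}. (real q ^ n - real q ^ j) / (real q ^ d - real q ^ j))"
  using assms
proof (induction "d - i" arbitrary: i T)
  case 0
  then have d: "d = i" by simp
  have "U = T" if "U \<in> between T V d" for U
    using that card_subset_eq[of U T] finite_subset[of U V] 0 d by (auto simp: between_def)
  moreover have "T \<in> between T V d" using 0 d by (auto simp: between_def)
  ultimately have "between T V d = {T}" by blast
  then show ?case using 0 by simp
next
  case (Suc k)
  have fT: "finite T" using Suc.prems finite_subset by blast
  have id: "i < d" using Suc by simp
  let ?P = "\<Prod>j\<in>{Suc i..<d}. (real q ^ n - real q ^ j) / (real q ^ d - real q ^ j)"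
  have IH: "real (card (between (span (insert v T)) V d)) = ?P" if v: "v \<in> V - T" for v
  proof (rule Suc.hyps(1))
    show "card (span (insert v T)) = q ^ Suc i"
      using card_span_insert(2)[OF Suc.prems(3) fT] v Suc.prems by simp
    show "span (insert v T) \<subseteq> V" using span_insert_le[of V T v] v Suc.prems by blast
  qed (use Suc id in auto)
  have "real (\<Sum>v\<in>V-T. card (between (span (insert v T)) V d)) = (\<Sum>v\<in>V-T. ?P)"
    unfolding of_nat_sum using IH by (intro sum.cong) auto
  also have "\<dots> = (real q ^ n - real q ^ i) * ?P"
    using Suc.prems fT by (simp add: card_Diff_subset of_nat_diff q_power_le_iff)
  finally have 1: "real (\<Sum>U\<in>between T V d. card ((V - T) \<inter> U)) = (real q ^ n - real q ^ i) * ?P"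
    using sum_card_between_insert[of V "V - T" T d] Suc.prems by simp
  have "card ((V - T) \<inter> U) = q ^ d - q ^ i" if "U \<in> between T V d" for U
  proof -
    have "(V - T) \<inter> U = U - T" using that by (auto simp: between_def)
    then show ?thesis using that Suc.prems fT by (simp add: card_Diff_subset between_def)
  qed
  then have 2: "real (\<Sum>U\<in>between T V d. card ((V - T) \<inter> U)) =
      real (card (between T V d)) * (real q ^ d - real q ^ i)"
    using id by (simp add: of_nat_diff q_power_le_iff)
  have "real q ^ i < real q ^ d" using id q_ge_2 by (intro power_strict_increasing) auto
  then have "real (card (between T V d)) = (real q ^ n - real q ^ i) / (real q ^ d - real q ^ i) * ?P"
    using 1 2 by (simp add: field_simps)
  then show ?case using id by (simp add: prod.atLeast_Suc_lessThan)
qed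

end

subsection \<open>The Euler product\<close>

lemma phi_LIMSEQ:
  fixes x :: real
  assumes "0 < x" "x < 1"
  shows "(\<lambda>k. \<Prod>m<k. 1 - x ^ Suc m) \<longlonglongrightarrow> phi x" and "0 < phi x"
proof -
  have "summable (\<lambda>m. norm (- (x ^ Suc m)))"
    using summable_geometric[of x] assms by (simp add: summable_mult)
  then have "abs_convergent_prod (\<lambda>m. 1 - x ^ Suc m)"
    using abs_convergent_prod_conv_summable[of "\<lambda>m. 1 - x ^ Suc m"] by simp
  then have c: "convergent_prod (\<lambda>m. 1 - x ^ Suc m)"
    by (rule abs_convergent_prod_imp_convergent_prod)
  have pos: "1 - x ^ Suc m > 0" for m
    using assms power_strict_decreasing[of 0 "Suc m" x] by simp
  have "(\<lambda>k. \<Prod>m\<le>k. 1 - x ^ Suc m) \<longlonglongrightarrow> phi x"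
    unfolding phi_def by (rule convergent_prod_LIMSEQ[OF c])
  then have "(\<lambda>k. \<Prod>m<Suc k. 1 - x ^ Suc m) \<longlonglongrightarrow> phi x"
    by (simp only: lessThan_Suc_atMost)
  then show "(\<lambda>k. \<Prod>m<k. 1 - x ^ Suc m) \<longlonglongrightarrow> phi x"
    by (rule LIMSEQ_imp_Suc)
  have "phi x \<noteq> 0" unfolding phi_def
    using prodinf_nonzero[OF c] pos by (metis less_irrefl)
  moreover have "phi x \<ge> 0"
    using pos by (intro LIMSEQ_le_const[OF \<open>(\<lambda>k. \<Prod>m<k. 1 - x ^ Suc m) \<longlonglongrightarrow> phi x\<close>] exI allI impI
        prod_nonneg less_imp_le)
  ultimately show "0 < phi x" by simp
qed

lemma phi_le_prod:
  fixes x :: real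
  assumes "0 < x" "x < 1"
  shows "phi x \<le> (\<Prod>m<k. 1 - x ^ Suc m)"
proof (rule LIMSEQ_le_const2[OF phi_LIMSEQ(1)[OF assms]], intro exI allI impI)
  fix n assume "n \<ge> k"
  have b: "0 \<le> 1 - x ^ Suc m" "1 - x ^ Suc m \<le> 1" for m
    using assms power_decreasing[of 0 "Suc m" x] by (auto simp del: power_Suc)
  have "decseq (\<lambda>k. \<Prod>m<k. 1 - x ^ Suc m)"
    unfolding decseq_Suc_iff using b by (auto intro!: mult_left_le prod_nonneg simp del: power_Suc)
  then show "(\<Prod>m<n. 1 - x ^ Suc m) \<le> (\<Prod>m<k. 1 - x ^ Suc m)"
    using \<open>n \<ge> k\<close> by (rule decseqD)
qed

text \<open>The Weierstrass product inequality.\<close>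

lemma one_minus_sum_le_prod:
  fixes f :: "nat \<Rightarrow> real"
  assumes "\<And>m. 0 \<le> f m" "\<And>m. f m \<le> 1"
  shows "1 - (\<Sum>m<n. f m) \<le> (\<Prod>m<n. 1 - f m)"
proof (induction n)
  case (Suc n)
  have "(\<Prod>m<n. 1 - f m) \<le> 1" by (rule prod_le_1) (use assms in auto)
  then have "(\<Prod>m<n. 1 - f m) * f n \<le> f n"
    using assms mult_right_mono[of _ 1 "f n"] by simp
  then show ?case using Suc by (simp add: algebra_simps)
qed simp

text \<open>Informative only for x < 1/2; the purpose is the limit x -> 0, where the left side tends
  to 1.\<close>

lemma phi_ge:
  fixes x :: real
  assumes "0 < x" "x < 1"
  shows "1 - x / (1 - x) \<le> phi x"
proof (rule LIMSEQ_le_const[OF phi_LIMSEQ(1)[OF assms]], intro exI allI impI)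
  fix n :: nat
  have b: "0 \<le> x ^ Suc m" "x ^ Suc m \<le> 1" for m
    using assms power_decreasing[of 0 "Suc m" x] by (auto simp del: power_Suc)
  have "1 - (\<Sum>m<n. x ^ Suc m) \<le> (\<Prod>m<n. 1 - x ^ Suc m)"
    by (rule one_minus_sum_le_prod) (use b in auto)
  moreover have "(\<Sum>m<n. x ^ Suc m) \<le> (\<Sum>m. x ^ Suc m)"
    by (rule sum_le_suminf) (use b assms in \<open>auto simp: summable_mult summable_geometric\<close>)
  moreover have "(\<Sum>m. x ^ Suc m) = x / (1 - x)"
    using assms by (simp add: suminf_mult summable_geometric suminf_geometric)
  ultimately show "1 - x / (1 - x) \<le> (\<Prod>m<n. 1 - x ^ Suc m)" by linarith
qed

section \<open>Uniform bounds for Gaussian binomial coefficients\<close>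

context finite_field_space begin

text \<open>Bounds, uniformly in n and d, the quotient of a Gaussian binomial coefficient by its
  leading power q^(d (n - d)).\<close>

definition subsp_const :: real where "subsp_const = 1 / phi (1 / real q)"

lemma phi_q_pos: "phi (1 / real q) > 0"
  using phi_LIMSEQ(2)[of "1 / real q"] q_ge_2 by simp

lemma phi_q_le_1: "phi (1 / real q) \<le> 1"
  using phi_le_prod[of "1 / real q" 0] q_ge_2 by simp

lemma subsp_const_ge_1: "subsp_const \<ge> 1"
  using phi_q_pos phi_q_le_1 by (simp add: subsp_const_def)

text \<open>Dropping q^j from the numerator of each factor in \<open>card_between\<close> leaves
  q^(n - d) / (1 - q^(j - d)). The denominators multiply to a partial Euler product, which is at
  least phi(1/q).\<close>

lemma card_between_le:
  assumes "finite V" "subspace V" "subspace T" "T \<subseteq> V"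
    and "card T = q ^ i" "card V = q ^ n"
  shows "real (card (between T V d)) \<le> subsp_const * real q ^ ((d - i) * (n - d))"
proof (cases "i \<le> d \<and> d \<le> n")
  case False
  have "between T V d = {}"
  proof (rule ccontr)
    assume "between T V d \<noteq> {}"
    then obtain U where U: "U \<in> between T V d" by blast
    then have "card T \<le> card U" "card U \<le> card V"
      using card_mono[of U T] card_mono[of V U] finite_subset[of U V] assms(1)
      by (auto simp: between_def)
    with U assms False show False by (auto simp: between_def q_power_le_iff)
  qed
  then show ?thesis using subsp_const_ge_1 by simp
next
  case True
  let ?x = "1 / real q"
  have x: "0 < ?x" "?x < 1" using q_ge_2 by auto
  have b: "0 < 1 - ?x ^ Suc m" for m
    using x power_strict_decreasing[of 0 "Suc m" ?x] by (auto simp del: power_Suc)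
  have le: "(real q ^ n - real q ^ j) / (real q ^ d - real q ^ j)
      \<le> real q ^ (n - d) * (1 / (1 - ?x ^ (d - j)))"
    and nn: "0 \<le> (real q ^ n - real q ^ j) / (real q ^ d - real q ^ j)"
    if j: "j \<in> {i..<d}" for j
  proof -
    have lt: "real q ^ j < real q ^ d" using j q_ge_2 by (intro power_strict_increasing) auto
    have A: "real q ^ d - real q ^ j = real q ^ d * (1 - ?x ^ (d - j))"
      using j q_ge_2 by (simp add: power_diff field_simps power_divide)
    have "real q ^ n - real q ^ j \<le> real q ^ (n - d) * real q ^ d"
      using True by (simp flip: power_add)
    then have "(real q ^ n - real q ^ j) / (real q ^ d - real q ^ j)
      \<le> (real q ^ (n - d) * real q ^ d) / (real q ^ d - real q ^ j)"
      by (rule divide_right_mono) (use lt in simp)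
    also have "\<dots> = (real q ^ (n - d) * real q ^ d) / (real q ^ d * (1 - ?x ^ (d - j)))"
      by (simp only: A)
    finally have "(real q ^ n - real q ^ j) / (real q ^ d - real q ^ j)
      \<le> (real q ^ (n - d) * real q ^ d) / (real q ^ d * (1 - ?x ^ (d - j)))" .
    then show "(real q ^ n - real q ^ j) / (real q ^ d - real q ^ j)
      \<le> real q ^ (n - d) * (1 / (1 - ?x ^ (d - j)))"
      using q_ge_2 by simp
    have "real q ^ j \<le> real q ^ n" using j True q_ge_2 by (intro power_increasing) auto
    then show "0 \<le> (real q ^ n - real q ^ j) / (real q ^ d - real q ^ j)" using lt by simp
  qed
  have "real (card (between T V d)) \<le> (\<Prod>j\<in>{i..<d}. real q ^ (n - d) * (1 / (1 - ?x ^ (d - j))))"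
    using card_between[OF assms] True le nn by (auto intro!: prod_mono)
  also have "\<dots> = real q ^ ((d - i) * (n - d)) * (1 / (\<Prod>j\<in>{i..<d}. 1 - ?x ^ (d - j)))"
    by (simp add: prod.distrib prod_dividef power_mult mult.commute flip: power_mult)
  also have "(\<Prod>j\<in>{i..<d}. 1 - ?x ^ (d - j)) = (\<Prod>m<d - i. 1 - ?x ^ Suc m)"
    by (rule prod.reindex_bij_witness[of _ "\<lambda>m. d - Suc m" "\<lambda>j. d - Suc j"]) 
       (auto simp: Suc_diff_Suc simp del: power_Suc)
  finally have 1: "real (card (between T V d)) \<le>
      real q ^ ((d - i) * (n - d)) * (1 / (\<Prod>m<d - i. 1 - ?x ^ Suc m))" .
  have "1 / (\<Prod>m<d - i. 1 - ?x ^ Suc m) \<le> subsp_const"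
    unfolding subsp_const_def using phi_le_prod[OF x, of "d - i"] phi_q_pos
    by (intro divide_left_mono) (auto simp del: power_Suc intro!: mult_pos_pos prod_pos b)
  then have "real q ^ ((d - i) * (n - d)) * (1 / (\<Prod>m<d - i. 1 - ?x ^ Suc m))
      \<le> real q ^ ((d - i) * (n - d)) * subsp_const"
    by (rule mult_left_mono) simp
  with 1 show ?thesis by (simp only: mult.commute[of subsp_const])
qed

end

subsection \<open>Invariant subspaces of an additive map\<close>

text \<open>Addition is injective on A x B. Of A and B only closure under subtraction is asked,
  because eigenspaces of a semilinear map need not be closed under scalars.\<close>

lemma card_mult_le_direct_sum:
  fixes A B U :: "'b::ab_group_add set"
  assumes "finite U" "A \<subseteq> U" "B \<subseteq> U"
    and U: "\<And>x y. x \<in> U \<Longrightarrow> y \<in> U \<Longrightarrow> x + y \<in> U"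
    and A: "\<And>x y. x \<in> A \<Longrightarrow> y \<in> A \<Longrightarrow> x - y \<in> A"
    and B: "\<And>x y. x \<in> B \<Longrightarrow> y \<in> B \<Longrightarrow> x - y \<in> B"
    and AB: "A \<inter> B \<subseteq> {0}"
  shows "card A * card B \<le> card U"
proof -
  have "inj_on (\<lambda>(x, y). x + y) (A \<times> B)"
  proof (rule inj_onI, clarify)
    fix x y x' y' assume h: "x \<in> A" "y \<in> B" "x' \<in> A" "y' \<in> B" and eq: "x + y = x' + y'"
    have "x - x' = y' - y" using eq by (simp add: algebra_simps)
    then have "x - x' \<in> A \<inter> B" using A[OF h(1,3)] B[OF h(4,2)] by simp
    then have "x = x'" using AB by auto
    then show "x = x' \<and> y = y'" using eq by simp
  qed
  then have "card (A \<times> B) \<le> card U"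
    by (rule card_inj_on_le) (use assms in auto)
  then show ?thesis by (simp add: card_cartesian_product)
qed

context finite_field_space begin

definition eigen :: "('b \<Rightarrow> 'b) \<Rightarrow> 'a \<Rightarrow> 'b set \<Rightarrow> 'b set" where
  "eigen g c U = {v \<in> U. g v = c *\<^sub>F v}"

text \<open>Subtracting one solution w of g w - c w = t maps all solutions injectively into the
  eigenspace, so no fibre is larger than the eigenspace.\<close>

lemma card_shifted_preimage_le:
  assumes g: "\<And>x y. g (x - y) = g x - g y" and U: "subspace U" "finite U"
    and T: "finite T"
  shows "card {v \<in> U. g v - c *\<^sub>F v \<in> T} \<le> card T * card (eigen g c U)"
proof -
  have "{v \<in> U. g v - c *\<^sub>F v \<in> T} = (\<Union>t\<in>T. {v \<in> U. g v - c *\<^sub>F v = t})" by auto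
  also have "card \<dots> \<le> (\<Sum>t\<in>T. card {v \<in> U. g v - c *\<^sub>F v = t})"
    by (rule card_UN_le[OF T])
  also have "\<dots> \<le> (\<Sum>t\<in>T. card (eigen g c U))"
  proof (rule sum_mono)
    fix t
    show "card {v \<in> U. g v - c *\<^sub>F v = t} \<le> card (eigen g c U)"
    proof (cases "\<exists>w\<in>U. g w - c *\<^sub>F w = t")
      case True
      then obtain w where w: "w \<in> U" "g w - c *\<^sub>F w = t" by blast
      show ?thesis
      proof (rule card_inj_on_le[of "\<lambda>v. v - w"])
        have "g (v - w) = c *\<^sub>F (v - w)" if "g v - c *\<^sub>F v = t" for v
        proof -
          have "g v = t + c *\<^sub>F v" "g w = t + c *\<^sub>F w" using that w by (auto simp: algebra_simps)
          then show ?thesis unfolding g scale_right_diff_distrib by simp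
        qed
        then show "(\<lambda>v. v - w) ` {v \<in> U. g v - c *\<^sub>F v = t} \<subseteq> eigen g c U"
          using w U(1) by (auto simp: eigen_def subspace_diff)
      qed (use U in \<open>auto simp: eigen_def inj_on_def\<close>)
    next
      case False
      then have "{v \<in> U. g v - c *\<^sub>F v = t} = {}" by auto
      then show ?thesis by (metis card.empty zero_le)
    qed
  qed
  finally show ?thesis by simp
qed

lemma card_eigen_mult_le:
  assumes g: "\<And>x y. g (x - y) = g x - g y" and U: "subspace U" "finite U" and "c \<noteq> c'"
  shows "card (eigen g c U) * card (eigen g c' U) \<le> card U"
proof (rule card_mult_le_direct_sum)
  show "eigen g c U \<inter> eigen g c' U \<subseteq> {0}"
    using assms(4) by (auto simp: eigen_def)
qed (use U in \<open>auto simp: eigen_def subspace_add subspace_diff g scale_right_diff_distrib\<close>)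

text \<open>The eigenspace E and its multiple mu E have the same size and meet only in 0: if v and
  mu v both lie in E, then s(mu) c v = c mu v, so v = 0 or c = 0, and for c = 0 injectivity again
  gives v = 0.\<close>

lemma card_eigen_semilinear:
  assumes g: "\<And>x y. g (x - y) = g x - g y" and U: "subspace U" "finite U"
    and s: "\<And>a v. g (a *\<^sub>F v) = s a *\<^sub>F g v" and "s \<mu> \<noteq> \<mu>" "\<mu> \<noteq> 0"
    and inj: "\<And>v. g v = 0 \<Longrightarrow> v = 0"
  shows "(card (eigen g c U))\<^sup>2 \<le> card U"
proof -
  let ?E = "eigen g c U"
  have "card ?E * card ((*\<^sub>F) \<mu> ` ?E) \<le> card U"
  proof (rule card_mult_le_direct_sum)
    show "(*\<^sub>F) \<mu> ` ?E \<subseteq> U" using U(1) by (auto simp: eigen_def subspace_scale)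
    show "?E \<inter> (*\<^sub>F) \<mu> ` ?E \<subseteq> {0}"
    proof
      fix w assume "w \<in> ?E \<inter> (*\<^sub>F) \<mu> ` ?E"
      then obtain v where v: "\<mu> *\<^sub>F v \<in> ?E" "v \<in> ?E" and w: "w = \<mu> *\<^sub>F v" by auto
      have eq: "(s \<mu> * c) *\<^sub>F v = (c * \<mu>) *\<^sub>F v" using v by (simp add: eigen_def s)
      have "v = 0"
      proof (rule ccontr)
        assume "v \<noteq> 0"
        then have "s \<mu> * c = c * \<mu>" using eq by simp
        then have "c = 0" using assms(5) by (auto simp: mult.commute)
        then have "g v = 0" using v by (simp add: eigen_def)
        then show False using inj \<open>v \<noteq> 0\<close> by blast
      qed
      then show "w \<in> {0}" using w by simp
    qed
    have E: "x - y \<in> ?E" if "x \<in> ?E" "y \<in> ?E" for x y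
      using that U(1) by (auto simp: eigen_def subspace_diff g scale_right_diff_distrib)
    show "x - y \<in> ?E" if "x \<in> ?E" "y \<in> ?E" for x y using E that .
    fix x y assume "x \<in> (*\<^sub>F) \<mu> ` ?E" "y \<in> (*\<^sub>F) \<mu> ` ?E"
    then obtain x' y' where "x' \<in> ?E" "y' \<in> ?E" and xy: "x = \<mu> *\<^sub>F x'" "y = \<mu> *\<^sub>F y'" by auto
    then have "x' - y' \<in> ?E" using E by blast
    then show "x - y \<in> (*\<^sub>F) \<mu> ` ?E" using xy
      by (intro image_eqI[of _ _ "x' - y'"]) (simp_all add: scale_right_diff_distrib)
  qed (use U in \<open>auto simp: eigen_def subspace_add\<close>)
  moreover have "card ((*\<^sub>F) \<mu> ` ?E) = card ?E"
    using assms(6) by (intro card_image inj_onI) simp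
  ultimately show ?thesis by (simp add: power2_eq_square)
qed


text \<open>A bad vector lies in T or has g v - c v in T for some scalar c. At most one scalar c0
  has an eigenspace larger than q^(d/2 + 1), since two eigenspaces form a direct sum in U. The
  contribution of c0 is at most q^d / 2, those of T and of all other scalars at most q^d / 8 each,
  together 3/4 of U.\<close>

lemma card_bad_vectors_le:
  assumes g: "\<And>x y. g (x - y) = g x - g y" and U: "subspace U" "finite U" "card U = q ^ d"
    and T: "subspace T" "finite T" "card T = q ^ (2 * i)"
    and e: "\<And>c. card (eigen g c U) * q ^ (2 * m) \<le> q ^ (d + 1)"
    and i: "i < m" "4 * m + 6 \<le> d"
  shows "4 * card {v \<in> U. v \<in> T \<or> g v \<in> span (insert v T)} \<le> 3 * q ^ d"
proof -
  let ?e = "\<lambda>c. card (eigen g c U)"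
  let ?S = "\<lambda>c. {v \<in> U. g v - c *\<^sub>F v \<in> T}"
  have q0: "0 < q" using q_ge_2 by simp
  have "Max (range ?e) \<in> range ?e" by (rule Max_in) auto
  then obtain c0 where "Max (range ?e) = ?e c0" by (rule rangeE)
  then have c0: "?e c \<le> ?e c0" for c by (metis Max_ge finite finite_imageI rangeI)
  have small: "?e c \<le> q ^ (d div 2 + 1)" if "c \<noteq> c0" for c
  proof (rule ccontr)
    assume "\<not> ?thesis"
    then have lt: "q ^ (d div 2 + 1) < ?e c" by simp
    have "q ^ (d + 1) \<le> q ^ (d div 2 + 1) * q ^ (d div 2 + 1)"
      unfolding power_add[symmetric] q_power_le_iff by linarith
    also have "\<dots> < ?e c * ?e c" using lt by (intro mult_strict_mono) auto
    also have "\<dots> \<le> ?e c * ?e c0" using c0 by simp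
    also have "\<dots> \<le> q ^ d" using card_eigen_mult_le[OF g U(1,2) that] U by simp
    finally show False using q_power_le_iff[of "d + 1" d] by linarith
  qed
  have "(\<Sum>c\<in>UNIV. ?e c) = ?e c0 + (\<Sum>c\<in>UNIV - {c0}. ?e c)" by (simp add: sum.remove)
  also have "(\<Sum>c\<in>UNIV - {c0}. ?e c) \<le> (\<Sum>c\<in>UNIV - {c0}. q ^ (d div 2 + 1))"
    by (rule sum_mono) (use small in auto)
  also have "\<dots> \<le> q ^ (d div 2 + 2)" by (simp add: q_eq)
  finally have sum: "(\<Sum>c\<in>UNIV. ?e c) \<le> ?e c0 + q ^ (d div 2 + 2)" by simp
  have "{v \<in> U. v \<in> T \<or> g v \<in> span (insert v T)} \<subseteq> T \<union> (\<Union>c. ?S c)"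
    unfolding span_breakdown_eq span_eq_iff[THEN iffD2, OF T(1)] by auto
  then have "card {v \<in> U. v \<in> T \<or> g v \<in> span (insert v T)} \<le> card (T \<union> (\<Union>c. ?S c))"
    by (rule card_mono[rotated]) (use U T in auto)
  also have "\<dots> \<le> card T + card (\<Union>c. ?S c)" by (rule card_Un_le)
  also have "card (\<Union>c. ?S c) \<le> (\<Sum>c\<in>UNIV. card (?S c))" by (rule card_UN_le) simp
  also have "\<dots> \<le> (\<Sum>c\<in>UNIV. card T * ?e c)"
    by (rule sum_mono) (rule card_shifted_preimage_le[OF g U(1,2) T(2)])
  also have "\<dots> \<le> q ^ (2 * i) * (?e c0 + q ^ (d div 2 + 2))"
    unfolding sum_distrib_left[symmetric] T(3) using sum by (rule mult_left_mono) simp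
  finally have bad: "card {v \<in> U. v \<in> T \<or> g v \<in> span (insert v T)}
      \<le> q ^ (2 * i) + q ^ (2 * i) * ?e c0 + q ^ (2 * i + d div 2 + 2)"
    using T by (simp add: algebra_simps power_add)
  \<comment> \<open>By \<open>i < m\<close> the size of T is at most q^(2 m - 2), and
    \<open>e\<close> bounds the eigenspace by q^(d + 1 - 2 m); the product is at most q^(d -
    1).\<close>
  have "q ^ (2 * i) * ?e c0 * 2 \<le> q ^ (2 * i) * ?e c0 * q" using q_ge_2 by simp
  also have "q ^ (2 * i) * ?e c0 * q * q \<le> q ^ d * q"
  proof -
    have "q ^ (2 * i) * ?e c0 * q * q = ?e c0 * q ^ (2 * i + 2)" by (simp add: power_add power2_eq_square)
    also have "q ^ (2 * i + 2) \<le> q ^ (2 * m)" unfolding q_power_le_iff using i by simp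
    then have "?e c0 * q ^ (2 * i + 2) \<le> ?e c0 * q ^ (2 * m)" by simp
    also have "\<dots> \<le> q ^ d * q" using e[of c0] by (simp add: mult.commute)
    finally show ?thesis .
  qed
  then have "q ^ (2 * i) * ?e c0 * q \<le> q ^ d" using q0 by simp
  finally have 1: "2 * (q ^ (2 * i) * ?e c0) \<le> q ^ d" by (simp add: mult.commute)
  have 8: "8 * q ^ k \<le> q ^ d" if "k + 3 \<le> d" for k
  proof -
    have "8 * q ^ k \<le> q ^ 3 * q ^ k" using power_mono[OF q_ge_2, of 3] by simp
    also have "\<dots> \<le> q ^ d" unfolding power_add[symmetric] q_power_le_iff using that by simp
    finally show ?thesis .
  qed
  \<comment> \<open>The hypothesis \<open>4 * m + 6 \<le> d\<close> is tailored to the second of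
    these bounds: 2 i + 5 <= 2 m + 3 <= d/2.\<close>
  have 2: "8 * q ^ (2 * i) \<le> q ^ d" and 3: "8 * q ^ (2 * i + d div 2 + 2) \<le> q ^ d"
    by (rule 8; use i in linarith)+
  show ?thesis using bad 1 2 3 by linarith
qed

text \<open>An invariant subspace containing \<open>T\<close> and a vector \<open>v\<close> also contains \<open>g v\<close>. If a fixed
  proportion of the vectors of each subspace of the family enlarges \<open>T\<close> by two dimensions in this
  way, each of the \<open>m\<close> free choices of a vector \<open>v\<close> costs \<open>q\<^sup>n\<close> and is
  repaid by a factor of order \<open>q\<^sup>d\<close>, while the dimension left to fill drops by two.\<close>

lemma card_invariant_containing_le:
  assumes g: "\<And>x y. g (x - y) = g x - g y"
    and V: "subspace V" "finite V" "card V = q ^ n"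
    and F: "F \<subseteq> between {0} V d" "\<And>U. U \<in> F \<Longrightarrow> g ` U \<subseteq> U"
    and e: "\<And>U c. U \<in> F \<Longrightarrow> card (eigen g c U) * q ^ (2 * m) \<le> q ^ (d + 1)"
    and m: "4 * m + 6 \<le> d" "d \<le> n"
    and T: "subspace T" "T \<subseteq> V" "card T = q ^ (2 * i)" "i \<le> m"
  shows "real (card {U \<in> F. T \<subseteq> U}) \<le>
    (4 * real q ^ (n - d)) ^ (m - i) * (subsp_const * real q ^ ((d - 2 * m) * (n - d)))"
  using T
proof (induction "m - i" arbitrary: i T)
  case 0
  have "{U \<in> F. T \<subseteq> U} \<subseteq> between T V d" using F(1) by (auto simp: between_def)
  then have "real (card {U \<in> F. T \<subseteq> U}) \<le> real (card (between T V d))"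
    using finite_between[OF V(2)] card_mono of_nat_mono by blast
  also have "real (card (between T V d)) \<le> subsp_const * real q ^ ((d - 2 * i) * (n - d))"
    by (rule card_between_le) (use V 0 in auto)
  finally show ?case using 0 by simp
next
  case (Suc k)
  have im: "i < m" and k: "k = m - Suc i" using Suc by auto
  have fT: "finite T" using Suc.prems V finite_subset by blast
  define B where "B = (4 * real q ^ (n - d)) ^ k * (subsp_const * real q ^ ((d - 2 * m) * (n - d)))"
  have B0: "0 \<le> B" unfolding B_def using subsp_const_ge_1 by simp
  let ?F = "{U \<in> F. T \<subseteq> U}"
  have fF: "finite ?F" using finite_subset[OF F(1) finite_between[OF V(2)]] by simp
  let ?good = "\<lambda>v U. v \<in> U \<and> v \<notin> T \<and> g v \<notin> span (insert v T)"
  \<comment> \<open>The complement of the bad vectors is at least a quarter of U; this is the source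
    of the factor 4 in the bound.\<close>
  have good: "q ^ d \<le> 4 * card {v \<in> V. ?good v U}" if U: "U \<in> ?F" for U
  proof -
    have U': "subspace U" "U \<subseteq> V" "card U = q ^ d" "finite U"
      using U F(1) finite_subset[of U V] V(2) by (auto simp: between_def)
    have 1: "4 * card {v \<in> U. v \<in> T \<or> g v \<in> span (insert v T)} \<le> 3 * q ^ d"
      by (rule card_bad_vectors_le[OF g U'(1,4,3) Suc.prems(1) fT Suc.prems(3) e im m(1)]) (use U in auto)
    have 2: "{v \<in> V. ?good v U} = U - {v \<in> U. v \<in> T \<or> g v \<in> span (insert v T)}"
      using U' by auto
    have 3: "card (U - {v \<in> U. v \<in> T \<or> g v \<in> span (insert v T)}) =
        q ^ d - card {v \<in> U. v \<in> T \<or> g v \<in> span (insert v T)}"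
      using U' by (subst card_Diff_subset) auto
    show ?thesis unfolding 2 3 using 1 by linarith
  qed
  have ext: "real (card {U \<in> ?F. ?good v U}) \<le> B" if v: "v \<in> V" for v
  proof (cases "{U \<in> ?F. ?good v U} = {}")
    case True
    then show ?thesis using B0 by (metis card.empty of_nat_0)
  next
    case False
    then obtain U where U: "U \<in> F" "T \<subseteq> U" "v \<in> U" "v \<notin> T" "g v \<notin> span (insert v T)" by blast
    let ?T1 = "span (insert v T)" and ?T2 = "span (insert (g v) (span (insert v T)))"
    note c1 = card_span_insert[OF Suc.prems(1) fT U(4)]
    note c2 = card_span_insert[OF subspace_span c1(1) U(5)]
    have T2: "?T2 \<subseteq> U'" if "U' \<in> F" "T \<subseteq> U'" "v \<in> U'" for U'
    proof -
      have "subspace U'" using that F(1) by (auto simp: between_def)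
      moreover have "g v \<in> U'" using F(2) that by blast
      ultimately show ?thesis using span_insert_le that by metis
    qed
    \<comment> \<open>The witness U of this case places the enlarged space inside V, as the
      induction hypothesis demands.\<close>
    have "?T2 \<subseteq> V" using T2[OF U(1,2,3)] U(1) F(1) by (auto simp: between_def)
    moreover have "card ?T2 = q ^ (2 * Suc i)" using c1 c2 Suc.prems by simp
    ultimately have "real (card {U \<in> F. ?T2 \<subseteq> U}) \<le> B"
      unfolding B_def k using Suc.hyps(1)[OF k subspace_span] im k by simp
    moreover have "card {U \<in> ?F. ?good v U} \<le> card {U \<in> F. ?T2 \<subseteq> U}"
      by (rule card_mono) (use T2 finite_subset[OF F(1) finite_between[OF V(2)]] in auto)
    ultimately show ?thesis by linarith
  qed
  have "real (card ?F) * real (q ^ d) \<le> (\<Sum>U\<in>?F. 4 * real (card {v \<in> V. ?good v U}))"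
  proof -
    have "real (q ^ d) \<le> 4 * real (card {v \<in> V. ?good v U})" if "U \<in> ?F" for U
      using of_nat_mono[OF good[OF that], where 'a = real] by simp
    then show ?thesis using sum_mono[of ?F "\<lambda>_. real (q ^ d)"] by simp
  qed
  also have "\<dots> = 4 * real (\<Sum>U\<in>?F. \<Sum>v\<in>{v \<in> V. ?good v U}. 1)" by (simp add: sum_distrib_left)
  also have "(\<Sum>U\<in>?F. \<Sum>v\<in>{v \<in> V. ?good v U}. 1) = (\<Sum>v\<in>V. \<Sum>U\<in>{U \<in> ?F. ?good v U}. 1)"
    by (rule sum.swap_restrict) (use fF V in auto)
  also have "real \<dots> = (\<Sum>v\<in>V. real (card {U \<in> ?F. ?good v U}))" by simp
  also have "\<dots> \<le> (\<Sum>v\<in>V. B)" by (rule sum_mono) (rule ext)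
  also have "\<dots> = real q ^ n * B" using V by simp
  \<comment> \<open>Cancelling q^d against the size of U leaves the factor 4 q^(n - d) per chosen
    vector.\<close>
  also have "real q ^ n = real q ^ d * real q ^ (n - d)" using m by (simp flip: power_add)
  finally have "real (card ?F) * real q ^ d \<le> (4 * real q ^ (n - d) * B) * real q ^ d"
    by (simp add: algebra_simps)
  then have "real (card ?F) \<le> 4 * real q ^ (n - d) * B" using q_ge_2 by simp
  also have "\<dots> = (4 * real q ^ (n - d)) ^ (m - i) * (subsp_const * real q ^ ((d - 2 * m) * (n - d)))"
    unfolding B_def using im k by (simp add: Suc_diff_Suc[symmetric] mult.assoc)
  finally show ?case .
qed

text \<open>The case T = 0. Against the bound for all subspaces of dimension d, a factor q^(m (n -
  d)) is saved at the price of 4^m.\<close>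

lemma card_invariant_le:
  assumes g: "\<And>x y. g (x - y) = g x - g y"
    and V: "subspace V" "finite V" "card V = q ^ n"
    and F: "F \<subseteq> between {0} V d" "\<And>U. U \<in> F \<Longrightarrow> g ` U \<subseteq> U"
    and e: "\<And>U c. U \<in> F \<Longrightarrow> card (eigen g c U) * q ^ (2 * m) \<le> q ^ (d + 1)"
    and m: "4 * m + 6 \<le> d" "d \<le> n"
  shows "real (card F) \<le> subsp_const * 4 ^ m * real q ^ ((d - m) * (n - d))"
proof -
  have "(n - d) * m + (d - 2 * m) * (n - d) = (m + (d - 2 * m)) * (n - d)"
    by (simp add: algebra_simps)
  moreover have "m + (d - 2 * m) = d - m" using m by simp
  ultimately have "(n - d) * m + (d - 2 * m) * (n - d) = (d - m) * (n - d)" by simp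
  moreover have "{U \<in> F. {0} \<subseteq> U} = F" using F by (auto simp: between_def subspace_0)
  ultimately show ?thesis
    using card_invariant_containing_le[OF g V F e m, of "{0}" 0] subspace_0[OF V(1)]
    by (simp add: power_mult_distrib algebra_simps flip: power_mult power_add)
qed

section \<open>Invariant subspaces of all dimensions\<close>

lemma subspace_eigen:
  assumes "\<And>x y. g (x + y) = g x + g y" "\<And>a v. g (a *\<^sub>F v) = a *\<^sub>F g v" "subspace U"
  shows "subspace (eigen g c U)"
  using assms assms(2)[of 0 0]
  by (auto simp: eigen_def subspace_def scale_right_distrib scale_left_commute)

text \<open>Treats the subspaces that violate hypothesis \<open>e\<close> of
  \<open>card_invariant_le\<close>. Such a U is found by choosing the scalar c and the dimension e
  of its eigenspace E in U, then E inside the eigenspace of V, which has dimension at most n - r,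
  and finally U above E. The exponents of the last two choices add up to the quantity bounded by
  b.\<close>

lemma card_large_eigen_le:
  assumes g: "\<And>x y. g (x + y) = g x + g y" "\<And>a v. g (a *\<^sub>F v) = a *\<^sub>F g v"
    and V: "subspace V" "finite V" "card V = q ^ n"
    and r: "\<And>c. card (eigen g c V) \<le> q ^ (n - r)"
    and b: "\<And>e. e \<le> d \<Longrightarrow> d + 2 \<le> e + 2 * m \<Longrightarrow> e \<le> n - r \<Longrightarrow> real (e * (n - r - e) + (d - e) * (n - d)) \<le> b"
  shows "real (card {U \<in> between {0} V d. \<exists>c. q ^ (d + 1) < card (eigen g c U) * q ^ (2 * m)})
    \<le> real q * (real d + 1) * subsp_const\<^sup>2 * real q powr b"
proof -
  let ?L = "{U \<in> between {0} V d. \<exists>c. q ^ (d + 1) < card (eigen g c U) * q ^ (2 * m)}"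
  let ?I = "{e. e \<le> d \<and> d + 2 \<le> e + 2 * m}"
  let ?G = "\<lambda>c e. \<Union>E\<in>between {0} (eigen g c V) e. between E V d"
  have fe: "finite (eigen g c U)" if "finite U" for c U using that by (simp add: eigen_def)
  have "?L \<subseteq> (\<Union>(c, e)\<in>UNIV \<times> ?I. ?G c e)"
  proof
    fix U assume "U \<in> ?L"
    then obtain c where U: "U \<in> between {0} V d" and c: "q ^ (d + 1) < card (eigen g c U) * q ^ (2 * m)"
      by blast
    have U': "subspace U" "U \<subseteq> V" "card U = q ^ d" "finite U"
      using U V(2) finite_subset by (auto simp: between_def)
    have sub: "subspace (eigen g c U)" using subspace_eigen[OF g U'(1)] .
    obtain e where e: "card (eigen g c U) = q ^ e" using card_subspace[OF sub fe[OF U'(4)]] by blast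
    have "card (eigen g c U) \<le> card U" using U' by (intro card_mono) (auto simp: eigen_def)
    then have "e \<le> d" using e U' by (simp add: q_power_le_iff)
    moreover have "\<not> q ^ (e + 2 * m) \<le> q ^ (d + 1)" using c e by (simp add: power_add)
    then have "d + 2 \<le> e + 2 * m" unfolding q_power_le_iff by simp
    moreover have "eigen g c U \<in> between {0} (eigen g c V) e"
      using sub e U' subspace_0[OF sub] by (auto simp: between_def eigen_def)
    moreover have "U \<in> between (eigen g c U) V d" using U by (auto simp: between_def eigen_def)
    ultimately show "U \<in> (\<Union>(c, e)\<in>UNIV \<times> ?I. ?G c e)" by blast
  qed
  moreover have fG: "finite (?G c e)" for c e using finite_between V(2) fe by auto
  have fI: "finite ?I" by (rule finite_subset[of _ "{..d}"]) auto
  ultimately have "card ?L \<le> card (\<Union>(c, e)\<in>UNIV \<times> ?I. ?G c e)"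
    using fG by (intro card_mono) auto
  also have "\<dots> \<le> (\<Sum>(c, e)\<in>UNIV \<times> ?I. card (?G c e))"
    using card_UN_le[of "UNIV \<times> ?I" "\<lambda>(c, e). ?G c e"] fI by (simp add: case_prod_unfold)
  finally have "real (card ?L) \<le> (\<Sum>(c, e)\<in>UNIV \<times> ?I. real (card (?G c e)))"
    by (simp add: case_prod_unfold flip: of_nat_sum)
  also have "\<dots> \<le> (\<Sum>(c, e)\<in>(UNIV :: 'a set) \<times> ?I. subsp_const\<^sup>2 * real q powr b)"
  proof (rule sum_mono, clarify)
    fix c e assume e: "e \<le> d" "d + 2 \<le> e + 2 * m"
    have sub: "subspace (eigen g c V)" using subspace_eigen[OF g V(1)] .
    obtain k where k: "card (eigen g c V) = q ^ k" using card_subspace[OF sub fe[OF V(2)]] by blast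
    have kn: "k \<le> n - r" using r[of c] k by (simp add: q_power_le_iff)
    show "real (card (?G c e)) \<le> subsp_const\<^sup>2 * real q powr b"
    proof (cases "between {0} (eigen g c V) e = {}")
      case True
      then show ?thesis by simp
    next
      case False
      then obtain E where E: "E \<in> between {0} (eigen g c V) e" by blast
      then have "card E \<le> card (eigen g c V)" using fe[OF V(2)] by (intro card_mono) (auto simp: between_def)
      then have ek: "e \<le> k" using E k by (simp add: between_def q_power_le_iff)
      have "real (card (?G c e)) \<le> (\<Sum>E\<in>between {0} (eigen g c V) e. real (card (between E V d)))"
        unfolding of_nat_sum[symmetric] of_nat_le_iff
        by (rule card_UN_le) (use finite_between fe V(2) in blast)
      also have "\<dots> \<le> (\<Sum>E\<in>between {0} (eigen g c V) e. subsp_const * real q ^ ((d - e) * (n - d)))"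
        by (intro sum_mono card_between_le) (use V in \<open>auto simp: between_def eigen_def\<close>)
      also have "\<dots> = real (card (between {0} (eigen g c V) e)) * (subsp_const * real q ^ ((d - e) * (n - d)))"
        by simp
      also have "\<dots> \<le> (subsp_const * real q ^ ((e - 0) * (k - e))) * (subsp_const * real q ^ ((d - e) * (n - d)))"
        by (intro mult_right_mono card_between_le)
           (use V k sub fe subsp_const_ge_1 subspace_0 in auto)
      also have "\<dots> = subsp_const\<^sup>2 * real q ^ (e * (k - e) + (d - e) * (n - d))"
        by (simp add: power_add power2_eq_square)
      also have "\<dots> = subsp_const\<^sup>2 * real q powr real (e * (k - e) + (d - e) * (n - d))"
        using q_ge_2 by (simp only: powr_realpow)
      also have "\<dots> \<le> subsp_const\<^sup>2 * real q powr b"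
      proof (intro mult_left_mono powr_mono)
        have "e * (k - e) \<le> e * (n - r - e)" using kn by (intro mult_left_mono) auto
        then show "real (e * (k - e) + (d - e) * (n - d)) \<le> b" using b[OF e] kn ek by linarith
      qed (use q_ge_2 in auto)
      finally show ?thesis .
    qed
  qed
  also have "\<dots> = real q * real (card ?I) * (subsp_const\<^sup>2 * real q powr b)"
    by (simp add: card_cartesian_product q_eq)
  also have "\<dots> \<le> real q * real (d + 1) * (subsp_const\<^sup>2 * real q powr b)"
  proof (intro mult_right_mono mult_left_mono of_nat_mono)
    show "card ?I \<le> d + 1" using card_mono[of "{..d}" ?I] by auto
  qed auto
  finally show ?thesis by (simp add: mult.assoc add.commute)
qed


lemma invariant_subset_between:
  assumes "subspace V" "finite V" "card V = q ^ n"
  shows "{U. subspace U \<and> U \<subseteq> V \<and> g ` U \<subseteq> U} \<subseteq> (\<Union>d\<in>{..n}. {U \<in> between {0} V d. g ` U \<subseteq> U})"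
proof
  fix U assume U: "U \<in> {U. subspace U \<and> U \<subseteq> V \<and> g ` U \<subseteq> U}"
  then obtain d where d: "card U = q ^ d" using card_subspace[of U] assms finite_subset by blast
  have "card U \<le> card V" using U assms by (intro card_mono) auto
  then have "d \<le> n" using d assms by (simp add: q_power_le_iff)
  then show "U \<in> (\<Union>d\<in>{..n}. {U \<in> between {0} V d. g ` U \<subseteq> U})"
    using U d subspace_0 by (auto simp: between_def)
qed

text \<open>Here \<open>r\<close> bounds the codimension of every eigenspace of \<open>g\<close> from below. The invariant
  subspaces meeting some eigenspace in codimension at most \<open>r / 16\<close> are counted through this
  intersection, the others by choosing vectors as above.\<close>

lemma card_invariant_linear_le:
  assumes g: "\<And>x y. g (x + y) = g x + g y" "\<And>a v. g (a *\<^sub>F v) = a *\<^sub>F g v"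
    and V: "subspace V" "finite V" "card V = q ^ n"
    and r: "\<And>c. card (eigen g c V) \<le> q ^ (n - r)" "r \<le> n" and n: "80 \<le> n"
  shows "real (card {U. subspace U \<and> U \<subseteq> V \<and> g ` U \<subseteq> U})
    \<le> 2 * real q * (real n + 1)\<^sup>2 * subsp_const\<^sup>2 * real q powr ((real n)\<^sup>2 / 4 - real n * real r / 256)"
proof -
  let ?b = "(real n)\<^sup>2 / 4 - real n * real r / 256"
  let ?F = "\<lambda>d. {U \<in> between {0} V d. g ` U \<subseteq> U}"
  \<comment> \<open>An eigenspace of U is large if its codimension in U is at most 2 m - 2, which
    this choice keeps below or equal to r/16. The added 1 makes m positive even for small r.\<close>
  define m where "m = r div 32 + 1"
  have "r div 32 * 32 \<le> r" "r < r div 32 * 32 + 32"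
    using div_mult_mod_eq[of r 32] mod_less_divisor[of 32 r] by linarith+
  then have "32 * m \<le> r + 32" "r \<le> 32 * m" "0 < m" by (simp_all add: m_def)
  then have m: "32 * real m \<le> real r + 32" "real r \<le> 32 * real m" "0 < m" by linarith+
  have gd: "g (x - y) = g x - g y" for x y using g(1)[of "x - y" y] by (simp add: algebra_simps)
  have q1: "1 < real q" using q_ge_2 by simp
  have C: "1 \<le> subsp_const" by (rule subsp_const_ge_1)
  have rn: "real r \<le> real n" using r(2) by simp
  have F: "real (card (?F d)) \<le> 2 * real q * (real n + 1) * subsp_const\<^sup>2 * real q powr ?b"
    if d: "d \<le> n" for d
  \<comment> \<open>Outside n/4 <= d <= 3n/4 all subspaces together are few enough: d (n - d) <=
    n^2/4 - n^2/16, while n r <= n^2.\<close>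
  proof (cases "n \<le> 4 * d \<and> n \<le> 4 * (n - d)")
    case False
    have "real (card (?F d)) \<le> real (card (between {0} V d))"
      unfolding of_nat_le_iff by (rule card_mono) (use finite_between V in auto)
    also have "\<dots> \<le> subsp_const * real q ^ ((d - 0) * (n - d))"
      by (rule card_between_le) (use V subspace_0 in auto)
    also have "\<dots> = subsp_const * real q powr (real d * (real n - real d))"
      using d q1 by (simp add: powr_realpow flip: of_nat_diff of_nat_mult)
    also have "\<dots> \<le> (2 * real q * (real n + 1) * subsp_const\<^sup>2) * real q powr ?b"
    proof (intro mult_mono powr_mono)
      have "real n / 4 \<le> \<bar>real n / 2 - real d\<bar>" using False d by (auto simp: of_nat_diff)
      then have "(real n / 4)\<^sup>2 \<le> (real n / 2 - real d)\<^sup>2"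
        by (metis abs_le_square_iff abs_of_nonneg divide_nonneg_nonneg of_nat_0_le_iff zero_le_numeral)
      moreover have "real n * real r \<le> real n * real n" using rn by (intro mult_left_mono) auto
      moreover have "0 \<le> (real n)\<^sup>2" by simp
      moreover have "(real n / 4)\<^sup>2 = (real n)\<^sup>2 / 16" "real n * real n = (real n)\<^sup>2"
        "(real n / 2 - real d)\<^sup>2 = (real n)\<^sup>2 / 4 - real d * (real n - real d)"
        by (simp_all add: power2_eq_square algebra_simps)
      ultimately show "real d * (real n - real d) \<le> ?b" by linarith
      have "subsp_const * 1 \<le> subsp_const * subsp_const" using C by (intro mult_left_mono) auto
      moreover have "1 * subsp_const\<^sup>2 \<le> (2 * real q * (real n + 1)) * subsp_const\<^sup>2"
        using q1 mult_mono[of 1 "2 * real q" 1 "real n + 1"] by (intro mult_right_mono) auto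
      ultimately show "subsp_const \<le> 2 * real q * (real n + 1) * subsp_const\<^sup>2"
        by (simp add: power2_eq_square)
    qed (use q1 C in auto)
    finally show ?thesis .
  next
    case True
    have "n \<le> 4 * d" "4 * d \<le> 3 * n" using True d by auto
    then have nd: "real n \<le> 4 * real d" "real n \<le> 4 * (real n - real d)" "real d \<le> real n"
      using d by simp_all
    let ?L = "{U \<in> between {0} V d. \<exists>c. q ^ (d + 1) < card (eigen g c U) * q ^ (2 * m)}"
    let ?S = "{U \<in> ?F d. \<forall>c. card (eigen g c U) * q ^ (2 * m) \<le> q ^ (d + 1)}"
    have "?F d \<subseteq> ?S \<union> ?L" by (auto simp: not_le)
    then have "card (?F d) \<le> card (?S \<union> ?L)"
      by (rule card_mono[rotated]) (use finite_between V in auto)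
    also have "\<dots> \<le> card ?S + card ?L" by (rule card_Un_le)
    finally have split: "real (card (?F d)) \<le> real (card ?S) + real (card ?L)" by linarith
    \<comment> \<open>Origin of 80: the left side is at most n/8 + 10 and the right side at least
      n/4.\<close>
    have "4 * m + 6 \<le> d" using m rn nd n by linarith
    then have dm: "m \<le> d" "4 * m + 6 \<le> d" by simp_all
    have dn: "real d * (real n - real d) \<le> (real n)\<^sup>2 / 4"
      using zero_le_power2[of "real n / 2 - real d"] by (simp add: power2_eq_square algebra_simps)
    have "real (card ?S) \<le> subsp_const * 4 ^ m * real q ^ ((d - m) * (n - d))"
      by (rule card_invariant_le[OF gd V]) (use dm d in auto)
    also have "\<dots> \<le> subsp_const * real q ^ (2 * m) * real q ^ ((d - m) * (n - d))"
    proof (intro mult_right_mono mult_left_mono)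
      show "4 ^ m \<le> real q ^ (2 * m)"
        unfolding power_mult using power_mono[of 2 "real q" 2] real_q_ge_2 by (intro power_mono) auto
    qed (use C in auto)
    also have "\<dots> = subsp_const * real q powr (2 * real m + (real d - real m) * (real n - real d))"
      using dm d q1 by (simp add: powr_add flip: powr_realpow)
    also have "\<dots> \<le> subsp_const * real q powr ?b"
    proof (intro mult_left_mono powr_mono)
      \<comment> \<open>The exponent is d (n - d) - m (n - d - 2). With m >= r/32 and n - d - 2 >=
        n/4 - 2 >= n/8 this gives the constant 256.\<close>
      have "real r / 32 * (real n / 8) \<le> real m * (real n - real d - 2)"
        using m nd n by (intro mult_mono) auto
      then show "2 * real m + (real d - real m) * (real n - real d) \<le> ?b"
        using dn by (simp add: algebra_simps)
    qed (use q1 C in auto)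
    finally have S: "real (card ?S) \<le> subsp_const * real q powr ?b" .
    have L: "real (card ?L) \<le> real q * (real d + 1) * subsp_const\<^sup>2 * real q powr ?b"
    proof (rule card_large_eigen_le[OF g V r(1)])
      fix e assume e: "e \<le> d" "d + 2 \<le> e + 2 * m" "e \<le> n - r"
      have s: "real d - real e \<le> real r / 16" using e m by linarith
      \<comment> \<open>Here e >= d - r/16 >= 3n/16. By the identity below, the exponent falls short
        of d (n - d) by e (r - (d - e)).\<close>
      have "3 * real n / 16 * (15 * real r / 16) \<le> real e * (real r - (real d - real e))"
        using s nd rn by (intro mult_mono) auto
      moreover have "real n * real r \<ge> 0" by simp
      moreover have "real (e * (n - r - e) + (d - e) * (n - d))
          = real d * (real n - real d) - real e * (real r - (real d - real e))"
      proof -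
        have "real (n - r - e) = real n - real r - real e" "real (d - e) = real d - real e"
          "real (n - d) = real n - real d"
          using e d r(2) by simp_all
        then show ?thesis by (simp only: of_nat_add of_nat_mult) (simp add: algebra_simps)
      qed
      moreover have "3 * real n / 16 * (15 * real r / 16) = 45 / 256 * (real n * real r)" by simp
      ultimately show "real (e * (n - r - e) + (d - e) * (n - d)) \<le> ?b"
        using dn by linarith
    qed
    have "subsp_const * 1 \<le> subsp_const * subsp_const" using C by (intro mult_left_mono) auto
    moreover have "1 * subsp_const\<^sup>2 \<le> (real q * (real n + 1)) * subsp_const\<^sup>2"
      using q1 mult_mono[of 1 "real q" 1 "real n + 1"] by (intro mult_right_mono) auto
    moreover have "real q * (real d + 1) * subsp_const\<^sup>2 \<le> real q * (real n + 1) * subsp_const\<^sup>2"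
      using d by (intro mult_right_mono mult_left_mono) auto
    ultimately have "subsp_const + real q * (real d + 1) * subsp_const\<^sup>2
        \<le> 2 * real q * (real n + 1) * subsp_const\<^sup>2"
      by (simp add: power2_eq_square)
    then have "(subsp_const + real q * (real d + 1) * subsp_const\<^sup>2) * real q powr ?b
        \<le> 2 * real q * (real n + 1) * subsp_const\<^sup>2 * real q powr ?b"
      by (rule mult_right_mono) simp
    then show ?thesis using split S L by (simp only: distrib_right)
  qed
  have "{U. subspace U \<and> U \<subseteq> V \<and> g ` U \<subseteq> U} \<subseteq> (\<Union>d\<in>{..n}. ?F d)"
    using invariant_subset_between[OF V] by blast
  then have "card {U. subspace U \<and> U \<subseteq> V \<and> g ` U \<subseteq> U} \<le> card (\<Union>d\<in>{..n}. ?F d)"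
    by (rule card_mono[rotated]) (use finite_between V in auto)
  also have "\<dots> \<le> (\<Sum>d\<le>n. card (?F d))" by (rule card_UN_le) simp
  finally have "real (card {U. subspace U \<and> U \<subseteq> V \<and> g ` U \<subseteq> U}) \<le> (\<Sum>d\<le>n. real (card (?F d)))"
    by (simp flip: of_nat_sum)
  also have "\<dots> \<le> (\<Sum>d\<le>n. 2 * real q * (real n + 1) * subsp_const\<^sup>2 * real q powr ?b)"
    by (rule sum_mono) (use F in auto)
  finally show ?thesis by (simp add: power2_eq_square algebra_simps)
qed

text \<open>By \<open>card_eigen_semilinear\<close> an eigenspace in U has at most the square root
  of the number of elements of U. No large eigenspaces have to be separated, and in the middle range
  of d \<open>card_invariant_le\<close> applies with m proportional to n.\<close>

lemma card_invariant_semilinear_le: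
  assumes g: "\<And>x y. g (x - y) = g x - g y"
    and s: "\<And>a v. g (a *\<^sub>F v) = s a *\<^sub>F g v" "s \<mu> \<noteq> \<mu>" "\<mu> \<noteq> 0"
    and inj: "\<And>v. g v = 0 \<Longrightarrow> v = 0"
    and V: "subspace V" "finite V" "card V = q ^ n" and n: "80 \<le> n"
  shows "real (card {U. subspace U \<and> U \<subseteq> V \<and> g ` U \<subseteq> U})
    \<le> (real n + 1) * subsp_const * real q powr ((real n)\<^sup>2 / 4 - (real n)\<^sup>2 / 512)"
proof -
  let ?b = "(real n)\<^sup>2 / 4 - (real n)\<^sup>2 / 512"
  let ?F = "\<lambda>d. {U \<in> between {0} V d. g ` U \<subseteq> U}"
  define m where "m = n div 32"
  have "32 * m \<le> n \<and> n \<le> 64 * m" 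
    using n div_mult_mod_eq[of n 32] mod_less_divisor[of 32 n] unfolding m_def by linarith
  then have m: "32 * real m \<le> real n" "real n \<le> 64 * real m" by linarith+
  have q1: "1 < real q" using q_ge_2 by simp
  have C: "1 \<le> subsp_const" by (rule subsp_const_ge_1)
  have F: "real (card (?F d)) \<le> subsp_const * real q powr ?b" if d: "d \<le> n" for d
  proof (cases "n \<le> 4 * d \<and> n \<le> 4 * (n - d)")
    case False
    have "real (card (?F d)) \<le> real (card (between {0} V d))"
      unfolding of_nat_le_iff by (rule card_mono) (use finite_between V in auto)
    also have "\<dots> \<le> subsp_const * real q ^ ((d - 0) * (n - d))"
      by (rule card_between_le) (use V subspace_0 in auto)
    also have "\<dots> = subsp_const * real q powr (real d * (real n - real d))"
      using d q1 by (simp add: powr_realpow flip: of_nat_diff of_nat_mult)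
    also have "\<dots> \<le> subsp_const * real q powr ?b"
    proof (intro mult_left_mono powr_mono)
      have "real n / 4 \<le> \<bar>real n / 2 - real d\<bar>" using False d by (auto simp: of_nat_diff)
      then have "(real n / 4)\<^sup>2 \<le> (real n / 2 - real d)\<^sup>2"
        by (metis abs_le_square_iff abs_of_nonneg divide_nonneg_nonneg of_nat_0_le_iff zero_le_numeral)
      moreover have "0 \<le> (real n)\<^sup>2" by simp
      moreover have "(real n / 4)\<^sup>2 = (real n)\<^sup>2 / 16"
        "(real n / 2 - real d)\<^sup>2 = (real n)\<^sup>2 / 4 - real d * (real n - real d)"
        by (simp_all add: power2_eq_square algebra_simps)
      ultimately show "real d * (real n - real d) \<le> ?b" by linarith
    qed (use q1 C in auto)
    finally show ?thesis .
  next
    case True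
    have "n \<le> 4 * d" "4 * d \<le> 3 * n" using True d by auto
    then have nd: "real n \<le> 4 * real d" "real n \<le> 4 * (real n - real d)" "real d \<le> real n"
      using d by simp_all
    have "4 * m + 6 \<le> d" using m nd n by linarith
    then have dm: "m \<le> d" "4 * m + 6 \<le> d" by simp_all
    have dn: "real d * (real n - real d) \<le> (real n)\<^sup>2 / 4"
      using zero_le_power2[of "real n / 2 - real d"] by (simp add: power2_eq_square algebra_simps)
    \<comment> \<open>Compared in squares: q^(d + 4 m) against q^(2 d + 2).\<close>
    have e: "card (eigen g c U) * q ^ (2 * m) \<le> q ^ (d + 1)" if U: "U \<in> ?F d" for U c
    proof -
      have U': "subspace U" "card U = q ^ d" "finite U"
        using U V(2) finite_subset[of U V] by (auto simp: between_def)
      have "(card (eigen g c U) * q ^ (2 * m))\<^sup>2 = (card (eigen g c U))\<^sup>2 * q ^ (4 * m)"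
        by (simp add: power_mult_distrib flip: power_mult)
      also have "\<dots> \<le> q ^ d * q ^ (4 * m)"
        using card_eigen_semilinear[OF g U'(1,3) s inj] U' by simp
      also have "\<dots> \<le> (q ^ (d + 1))\<^sup>2"
        unfolding power_mult[symmetric] power_add[symmetric] q_power_le_iff using dm by simp
      finally show ?thesis by (rule power2_le_imp_le) simp
    qed
    have "real (card (?F d)) \<le> subsp_const * 4 ^ m * real q ^ ((d - m) * (n - d))"
      by (rule card_invariant_le[OF g V _ _ e]) (use dm d in auto)
    also have "\<dots> \<le> subsp_const * real q ^ (2 * m) * real q ^ ((d - m) * (n - d))"
    proof (intro mult_right_mono mult_left_mono)
      show "4 ^ m \<le> real q ^ (2 * m)"
        unfolding power_mult using power_mono[of 2 "real q" 2] real_q_ge_2 by (intro power_mono) auto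
    qed (use C in auto)
    also have "\<dots> = subsp_const * real q powr (2 * real m + (real d - real m) * (real n - real d))"
      using dm d q1 by (simp add: powr_add flip: powr_realpow)
    also have "\<dots> \<le> subsp_const * real q powr ?b"
    proof (intro mult_left_mono powr_mono)
      \<comment> \<open>Origin of 512: m >= n/64 and n - d - 2 >= n/8.\<close>
      have "real n / 64 * (real n / 8) \<le> real m * (real n - real d - 2)"
        using m nd n by (intro mult_mono) auto
      then show "2 * real m + (real d - real m) * (real n - real d) \<le> ?b"
        using dn by (simp add: algebra_simps power2_eq_square)
    qed (use q1 C in auto)
    finally show ?thesis .
  qed
  have "{U. subspace U \<and> U \<subseteq> V \<and> g ` U \<subseteq> U} \<subseteq> (\<Union>d\<in>{..n}. ?F d)"
    using invariant_subset_between[OF V] by blast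
  then have "card {U. subspace U \<and> U \<subseteq> V \<and> g ` U \<subseteq> U} \<le> card (\<Union>d\<in>{..n}. ?F d)"
    by (rule card_mono[rotated]) (use finite_between V in auto)
  also have "\<dots> \<le> (\<Sum>d\<le>n. card (?F d))" by (rule card_UN_le) simp
  finally have "real (card {U. subspace U \<and> U \<subseteq> V \<and> g ` U \<subseteq> U}) \<le> (\<Sum>d\<le>n. real (card (?F d)))"
    by (simp flip: of_nat_sum)
  also have "\<dots> \<le> (\<Sum>d\<le>n. subsp_const * real q powr ?b)"
    by (rule sum_mono) (use F in auto)
  finally show ?thesis by (simp add: algebra_simps)
qed

end

subsection \<open>Monomial maps on coordinate space\<close>

text \<open>The space of row vectors of length \<open>n\<close> is modelled as the functions on \<open>nat\<close> that vanish
  from \<open>n\<close> on.\<close>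

definition fscale :: "'a::times \<Rightarrow> (nat \<Rightarrow> 'a) \<Rightarrow> nat \<Rightarrow> 'a" where
  "fscale c f = (\<lambda>i. c * f i)"

definition supported :: "nat set \<Rightarrow> (nat \<Rightarrow> 'a::zero) set" where
  "supported A = {f. \<forall>i. i \<notin> A \<longrightarrow> f i = 0}"

interpretation coord: finite_field_space "fscale :: 'a::{field,finite} \<Rightarrow> _" "CARD('a)"
  by unfold_locales (auto simp: fscale_def algebra_simps fun_eq_iff)

lemma supported_card:
  assumes "finite A"
  shows "finite (supported A :: (nat \<Rightarrow> 'a::{zero,finite}) set)"
    and "card (supported A :: (nat \<Rightarrow> 'a) set) = CARD('a) ^ card A"
proof -
  have bij: "bij_betw (\<lambda>f. restrict f A) (supported A :: (nat \<Rightarrow> 'a) set) (A \<rightarrow>\<^sub>E UNIV)"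
    by (rule bij_betw_byWitness[where f' = "\<lambda>f i. if i \<in> A then f i else 0"])
       (auto simp: supported_def fun_eq_iff PiE_def extensional_def)
  have "finite (A \<rightarrow>\<^sub>E (UNIV :: 'a set))" using assms by (intro finite_PiE) auto
  then show "finite (supported A :: (nat \<Rightarrow> 'a) set)" using bij_betw_finite[OF bij] by simp
  show "card (supported A :: (nat \<Rightarrow> 'a) set) = CARD('a) ^ card A"
    using bij_betw_same_card[OF bij] assms by (simp add: card_PiE)
qed

lemma supported_subspace: "coord.subspace (supported A :: (nat \<Rightarrow> 'a::{field,finite}) set)"
  by (auto simp: coord.subspace_def supported_def fscale_def)

text \<open>Deleting the coordinates in S is injective on K: a difference that vanishes outside S
  vanishes everywhere, by strong induction along the coordinates.\<close>

lemma card_determined_le: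
  fixes K :: "(nat \<Rightarrow> 'a::{field,finite}) set"
  assumes K: "coord.subspace K" "K \<subseteq> supported {..<n}" and S: "S \<subseteq> {..<n}"
    and det: "\<And>f i. f \<in> K \<Longrightarrow> i \<in> S \<Longrightarrow> (\<And>j. j < i \<Longrightarrow> f j = 0) \<Longrightarrow> f i = 0"
  shows "card K \<le> CARD('a) ^ (n - card S)"
proof -
  let ?h = "\<lambda>f i. if i \<in> S then 0 else f i"
  have "inj_on ?h K"
  proof (rule inj_onI)
    fix f f' assume f: "f \<in> K" "f' \<in> K" and eq: "?h f = ?h f'"
    have mem: "f - f' \<in> K" using K(1) f coord.subspace_diff by blast
    have "(f - f') i = 0" for i
    proof (induction i rule: less_induct)
      case (less i)
      show ?case
      proof (cases "i \<in> S")
        case True then show ?thesis using det[OF mem] less by blast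
      next
        case False then show ?thesis using fun_cong[OF eq, of i] by simp
      qed
    qed
    then show "f = f'" by (auto simp: fun_eq_iff)
  qed
  moreover have "?h ` K \<subseteq> supported ({..<n} - S)" using K(2) by (auto simp: supported_def)
  ultimately have "card K \<le> card (supported ({..<n} - S) :: (nat \<Rightarrow> 'a) set)"
    by (rule card_inj_on_le) (simp add: supported_card)
  then show ?thesis using S finite_subset[OF S] by (simp add: supported_card card_Diff_subset)
qed

definition mono_act :: "(nat \<Rightarrow> nat) \<Rightarrow> (nat \<Rightarrow> 'a) \<Rightarrow> ('a \<Rightarrow> 'a) \<Rightarrow> (nat \<Rightarrow> 'a) \<Rightarrow> nat \<Rightarrow> 'a::field" where
  "mono_act \<pi> d \<sigma> f = (\<lambda>i. d i * \<sigma> (f (\<pi> i)))"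

text \<open>Requiring \<open>d i = 1\<close> beyond \<open>n\<close> makes the parameters of a monomial map unique.\<close>

definition mono_params :: "nat \<Rightarrow> ((nat \<Rightarrow> nat) \<times> (nat \<Rightarrow> 'a::field)) set" where
  "mono_params n = {(\<pi>, d). \<pi> permutes {..<n} \<and> (\<forall>i. d i \<noteq> 0) \<and> (\<forall>i\<ge>n. d i = 1)}"

definition mismatch :: "nat \<Rightarrow> (nat \<Rightarrow> nat) \<Rightarrow> (nat \<Rightarrow> 'a) \<Rightarrow> 'a \<Rightarrow> nat" where
  "mismatch n \<pi> d c = card {i. i < n \<and> \<not> (\<pi> i = i \<and> d i = c)}"

text \<open>An eigenvector is determined by its coordinates outside the strict descents of \<open>\<pi>\<close>, and also
  by those outside the images of the strict ascents.\<close>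

lemma card_eigen_mono_act_le:
  fixes d :: "nat \<Rightarrow> 'a::{field,finite}"
  assumes "(\<pi>, d) \<in> mono_params n"
  shows "card (coord.eigen (mono_act \<pi> d id) c (supported {..<n})) \<le> CARD('a) ^ (n - (mismatch n \<pi> d c + 1) div 2)"
proof -
  have \<pi>: "\<pi> permutes {..<n}" and d0: "d i \<noteq> 0" for i using assms by (auto simp: mono_params_def)
  let ?K = "coord.eigen (mono_act \<pi> d id) c (supported {..<n})"
  have sub: "coord.subspace ?K"
    by (rule coord.subspace_eigen)
       (auto simp: mono_act_def fscale_def fun_eq_iff algebra_simps supported_subspace)
  have K: "?K \<subseteq> supported {..<n}" by (auto simp: coord.eigen_def)
  have ev: "d i * f (\<pi> i) = c * f i" if "f \<in> ?K" for f i
    using that by (auto simp: coord.eigen_def mono_act_def fscale_def fun_eq_iff)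
  show ?thesis
  proof (cases "c = 0")
    \<comment> \<open>For c = 0 the eigenspace is the kernel of an injective map.\<close>
    case True
    have "card ?K \<le> CARD('a) ^ (n - card {..<n})"
    proof (rule card_determined_le[OF sub K])
      fix f i assume f: "f \<in> ?K"
      have "d (Hilbert_Choice.inv \<pi> i) * f (\<pi> (Hilbert_Choice.inv \<pi> i)) = 0" using ev[OF f] True by simp
      then show "f i = 0" using d0 permutes_inverses(1)[OF \<pi>] by simp
    qed simp
    also have "\<dots> \<le> CARD('a) ^ (n - (mismatch n \<pi> d c + 1) div 2)" by (simp add: Suc_leI)
    finally show ?thesis .
  next
    case c: False
    \<comment> \<open>The deviating coordinates: strict descents, strict ascents, and fixed points
      carrying a scalar other than c. On \<open>?X\<close> every eigenvector vanishes
      outright.\<close>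
    let ?D = "{i. i < n \<and> \<pi> i < i}" and ?A = "{i. i < n \<and> i < \<pi> i}" and ?X = "{i. i < n \<and> \<pi> i = i \<and> d i \<noteq> c}"
    have X: "f i = 0" if "f \<in> ?K" "i \<in> ?X" for f i
      using ev[OF that(1), of i] that(2) by auto
    have 1: "card ?K \<le> CARD('a) ^ (n - card (?D \<union> ?X))"
    proof (rule card_determined_le[OF sub K])
      fix f i assume f: "f \<in> ?K" and i: "i \<in> ?D \<union> ?X" and z: "\<And>j. j < i \<Longrightarrow> f j = 0"
      show "f i = 0"
      proof (cases "i \<in> ?X")
        case False
        then have "f (\<pi> i) = 0" using i z by auto
        then show ?thesis using ev[OF f, of i] c by simp
      qed (use X f in blast)
    qed auto
    have 2: "card ?K \<le> CARD('a) ^ (n - card (\<pi> ` ?A \<union> ?X))"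
    proof (rule card_determined_le[OF sub K])
      show "\<pi> ` ?A \<union> ?X \<subseteq> {..<n}" using permutes_in_image[OF \<pi>] by auto
      fix f i assume f: "f \<in> ?K" and i: "i \<in> \<pi> ` ?A \<union> ?X" and z: "\<And>j. j < i \<Longrightarrow> f j = 0"
      show "f i = 0"
      proof (cases "i \<in> ?X")
        case False
        then obtain j where j: "i = \<pi> j" "j < \<pi> j" using i by auto
        then have "f j = 0" using z by auto
        then show ?thesis using ev[OF f, of j] d0 j by simp
      qed (use X f in blast)
    qed
    have "card (?D \<union> ?X) = card ?D + card ?X" by (rule card_Un_disjoint) auto
    moreover have "card (\<pi> ` ?A \<union> ?X) = card (\<pi> ` ?A) + card ?X"
      by (rule card_Un_disjoint) (auto simp: inj_eq[OF permutes_inj[OF \<pi>]])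
    moreover have "card (\<pi> ` ?A) = card ?A"
      by (rule card_image) (use permutes_inj[OF \<pi>] in \<open>auto intro: inj_on_subset\<close>)
    moreover have "mismatch n \<pi> d c \<le> card ?D + card ?A + card ?X"
    proof -
      have "{i. i < n \<and> \<not> (\<pi> i = i \<and> d i = c)} = ?D \<union> ?A \<union> ?X" by auto
      then show ?thesis unfolding mismatch_def
        using card_Un_le[of "?D \<union> ?A" ?X] card_Un_le[of ?D ?A] by simp
    qed
    \<comment> \<open>The sizes of the two determined sets add up to at least
      \<open>mismatch\<close>, so the larger set has at least half of it, rounded up.\<close>
    ultimately have "(mismatch n \<pi> d c + 1) div 2 \<le> card (?D \<union> ?X)
        \<or> (mismatch n \<pi> d c + 1) div 2 \<le> card (\<pi> ` ?A \<union> ?X)" by linarith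
    then show ?thesis
    proof
      assume "(mismatch n \<pi> d c + 1) div 2 \<le> card (?D \<union> ?X)"
      then have "CARD('a) ^ (n - card (?D \<union> ?X)) \<le> CARD('a) ^ (n - (mismatch n \<pi> d c + 1) div 2)"
        unfolding coord.q_power_le_iff by simp
      then show ?thesis using 1 by linarith
    next
      assume "(mismatch n \<pi> d c + 1) div 2 \<le> card (\<pi> ` ?A \<union> ?X)"
      then have "CARD('a) ^ (n - card (\<pi> ` ?A \<union> ?X)) \<le> CARD('a) ^ (n - (mismatch n \<pi> d c + 1) div 2)"
        unfolding coord.q_power_le_iff by simp
      then show ?thesis using 2 by linarith
    qed
  qed
qed

definition min_mismatch :: "nat \<Rightarrow> (nat \<Rightarrow> nat) \<Rightarrow> (nat \<Rightarrow> 'a::finite) \<Rightarrow> nat" where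
  "min_mismatch n \<pi> d = Min (range (mismatch n \<pi> d))"

lemma min_mismatch_le: "min_mismatch n \<pi> d \<le> mismatch n \<pi> d c"
  unfolding min_mismatch_def by (rule Min_le) auto

lemma ex_min_mismatch:
  fixes d :: "nat \<Rightarrow> 'a::finite"
  shows "\<exists>c. min_mismatch n \<pi> d = mismatch n \<pi> d c"
proof -
  have "min_mismatch n \<pi> d \<in> range (mismatch n \<pi> d)" unfolding min_mismatch_def by (rule Min_in) auto
  then show ?thesis by blast
qed

lemma mismatch_le: "mismatch n \<pi> d c \<le> n"
  using card_mono[of "{..<n}" "{i. i < n \<and> \<not> (\<pi> i = i \<and> d i = c)}"] by (auto simp: mismatch_def)

lemma min_mismatch_le_n:
  fixes d :: "nat \<Rightarrow> 'a::finite"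
  shows "min_mismatch n \<pi> d \<le> n"
  using ex_min_mismatch[of n \<pi> d] mismatch_le[of n \<pi> d] by auto

text \<open>Inclusion of the image in U is the form used by the counting bounds; for injective g and
  the finite U occurring here it amounts to equality.\<close>

definition num_fixed :: "nat \<Rightarrow> ((nat \<Rightarrow> 'a::{field,finite}) \<Rightarrow> nat \<Rightarrow> 'a) \<Rightarrow> nat" where
  "num_fixed n g = card {U. coord.subspace U \<and> U \<subseteq> supported {..<n} \<and> g ` U \<subseteq> U}"

text \<open>Eigenspaces have codimension at least half of \<open>min_mismatch n \<pi> d\<close>; the
  halving turns 256 into 512.\<close>

lemma num_fixed_mono_act_le:
  fixes d :: "nat \<Rightarrow> 'a::{field,finite}"
  assumes "(\<pi>, d) \<in> mono_params n" and n: "80 \<le> n"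
  shows "real (num_fixed n (mono_act \<pi> d id)) \<le>
    2 * real CARD('a) * (real n + 1)\<^sup>2 * (1 / phi (1 / real CARD('a)))\<^sup>2 *
    real CARD('a) powr ((real n)\<^sup>2 / 4 - real n * real (min_mismatch n \<pi> d) / 512)"
    (is "_ \<le> ?C * _ powr ?b")
proof -
  let ?k = "min_mismatch n \<pi> d" and ?q = "real CARD('a)"
  define r where "r = (?k + 1) div 2"
  have "card (coord.eigen (mono_act \<pi> d id) c (supported {..<n})) \<le> CARD('a) ^ (n - r)" for c
  proof -
    have "r \<le> (mismatch n \<pi> d c + 1) div 2"
      unfolding r_def using min_mismatch_le[of n \<pi> d c] by (intro div_le_mono) simp
    then have "CARD('a) ^ (n - (mismatch n \<pi> d c + 1) div 2) \<le> CARD('a) ^ (n - r)"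
      unfolding coord.q_power_le_iff by simp
    then show ?thesis using card_eigen_mono_act_le[OF assms(1), of c] by linarith
  qed
  moreover have "r \<le> n"
    using min_mismatch_le_n[of n \<pi> d] n unfolding r_def by linarith
  ultimately have "real (num_fixed n (mono_act \<pi> d id)) \<le>
      ?C * ?q powr ((real n)\<^sup>2 / 4 - real n * real r / 256)"
    unfolding num_fixed_def coord.subsp_const_def[symmetric] using n
    by (intro coord.card_invariant_linear_le)
       (auto simp: mono_act_def fscale_def fun_eq_iff algebra_simps supported_subspace supported_card)
  also have "\<dots> \<le> ?C * ?q powr ?b"
  proof (intro mult_left_mono powr_mono)
    have "?k \<le> 2 * r" unfolding r_def by linarith
    then have "real n * real ?k \<le> real n * (2 * real r)" by (intro mult_left_mono) auto
    then show "(real n)\<^sup>2 / 4 - real n * real r / 256 \<le> ?b" by simp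
  qed (use coord.real_q_ge_2[where 'a = 'a] in auto)
  finally show ?thesis .
qed

lemma num_fixed_semilinear_le:
  fixes d :: "nat \<Rightarrow> 'a::{field,finite}"
  assumes "(\<pi>, d) \<in> mono_params n" "\<sigma> \<in> field_auts" "\<sigma> \<noteq> id" and n: "80 \<le> n"
  shows "real (num_fixed n (mono_act \<pi> d \<sigma>)) \<le>
    (real n + 1) * (1 / phi (1 / real CARD('a))) *
    real CARD('a) powr ((real n)\<^sup>2 / 4 - (real n)\<^sup>2 / 512)"
proof -
  have \<pi>: "\<pi> permutes {..<n}" and d0: "d i \<noteq> 0" for i using assms by (auto simp: mono_params_def)
  interpret \<sigma>: field_hom \<sigma> using assms(2) by (simp add: field_auts_def)
  obtain \<mu> where \<mu>: "\<sigma> \<mu> \<noteq> \<mu>" using assms(3) by (auto simp: fun_eq_iff)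
  then have "\<mu> \<noteq> 0" using \<sigma>.hom_zero by auto
  have inj: "f = 0" if "mono_act \<pi> d \<sigma> f = 0" for f
  proof
    fix i
    have "d (Hilbert_Choice.inv \<pi> i) * \<sigma> (f (\<pi> (Hilbert_Choice.inv \<pi> i))) = 0" using fun_cong[OF that, of "Hilbert_Choice.inv \<pi> i"] by (simp add: mono_act_def)
    then show "f i = 0 i" using d0 permutes_inverses(1)[OF \<pi>] by simp
  qed
  have diff: "mono_act \<pi> d \<sigma> (x - y) = mono_act \<pi> d \<sigma> x - mono_act \<pi> d \<sigma> y" for x y
    by (simp add: mono_act_def fun_eq_iff algebra_simps \<sigma>.hom_minus)
  have mult: "mono_act \<pi> d \<sigma> (fscale a v) = fscale (\<sigma> a) (mono_act \<pi> d \<sigma> v)" for a v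
    by (simp add: mono_act_def fscale_def fun_eq_iff algebra_simps \<sigma>.hom_mult)
  have "finite (supported {..<n} :: (nat \<Rightarrow> 'a) set)"
    "card (supported {..<n} :: (nat \<Rightarrow> 'a) set) = CARD('a) ^ n"
    by (simp_all add: supported_card)
  from coord.card_invariant_semilinear_le[OF diff mult \<mu> \<open>\<mu> \<noteq> 0\<close> inj supported_subspace this n]
  show ?thesis unfolding num_fixed_def coord.subsp_const_def .
qed

section \<open>Numbers of monomial maps and the error terms\<close>

lemma card_mono_params:
  "finite (mono_params n :: ((nat \<Rightarrow> nat) \<times> (nat \<Rightarrow> 'a::{field,finite})) set)"
  "card (mono_params n :: ((nat \<Rightarrow> nat) \<times> (nat \<Rightarrow> 'a)) set) = fact n * (CARD('a) - 1) ^ n"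
proof -
  let ?D = "{d :: nat \<Rightarrow> 'a. (\<forall>i. d i \<noteq> 0) \<and> (\<forall>i\<ge>n. d i = 1)}"
  have eq: "(mono_params n :: ((nat \<Rightarrow> nat) \<times> (nat \<Rightarrow> 'a)) set) = {\<pi>. \<pi> permutes {..<n}} \<times> ?D"
    by (auto simp: mono_params_def)
  have bij: "bij_betw (\<lambda>f. restrict f {..<n}) ?D ({..<n} \<rightarrow>\<^sub>E (UNIV - {0}))"
    by (rule bij_betw_byWitness[where f' = "\<lambda>f i. if i < n then f i else 1"])
       (auto simp: fun_eq_iff PiE_def Pi_def extensional_def split: if_splits)
  have "finite ({..<n} \<rightarrow>\<^sub>E (UNIV - {0 :: 'a}))" by (intro finite_PiE) auto
  then have fin: "finite ?D" using bij_betw_finite[OF bij] by simp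
  have "card ?D = (CARD('a) - 1) ^ n"
    using bij_betw_same_card[OF bij] by (simp add: card_PiE card_Diff_subset)
  then show "card (mono_params n :: ((nat \<Rightarrow> nat) \<times> (nat \<Rightarrow> 'a)) set) = fact n * (CARD('a) - 1) ^ n"
    unfolding eq by (simp add: card_cartesian_product card_permutations)
  show "finite (mono_params n :: ((nat \<Rightarrow> nat) \<times> (nat \<Rightarrow> 'a)) set)"
    unfolding eq using fin finite_permutations[of "{..<n}"] by simp
qed

text \<open>Choose a nearest scalar c, the set E of the k deviating coordinates, a permutation of E,
  and the entries of d on E. There are binomial(n, k) k! choices of E with its permutation, at most
  n^k.\<close>

lemma card_min_mismatch_le:
  "card {(\<pi>, d :: nat \<Rightarrow> 'a::{field,finite}) \<in> mono_params n. min_mismatch n \<pi> d = k}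
    \<le> CARD('a) * (n * CARD('a)) ^ k"
proof -
  let ?E = "{E. E \<subseteq> {..<n} \<and> card E = k}"
  let ?D = "\<lambda>(c :: 'a) E. {d :: nat \<Rightarrow> 'a. \<forall>i. i \<notin> E \<longrightarrow> d i = (if i < n then c else 1)}"
  have D: "finite (?D c E)" "card (?D c E) = CARD('a) ^ k" if E: "E \<in> ?E" for c E
  proof -
    have fE: "finite E" using E finite_subset by auto
    have bij: "bij_betw (\<lambda>f. restrict f E) (?D c E) (E \<rightarrow>\<^sub>E (UNIV :: 'a set))"
      by (rule bij_betw_byWitness[where f' = "\<lambda>f i. if i \<in> E then f i else if i < n then c else 1"])
         (use E in \<open>auto simp: fun_eq_iff PiE_def extensional_def\<close>)
    have "finite (E \<rightarrow>\<^sub>E (UNIV :: 'a set))" using fE by (intro finite_PiE) auto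
    then show "finite (?D c E)" using bij_betw_finite[OF bij] by simp
    show "card (?D c E) = CARD('a) ^ k"
      using bij_betw_same_card[OF bij] E fE by (simp add: card_PiE)
  qed
  have fE: "finite ?E" by (rule finite_subset[of _ "Pow {..<n}"]) auto
  have fP: "finite {\<pi>. \<pi> permutes E}" if "E \<in> ?E" for E
    using that finite_subset[of E "{..<n}"] by (intro finite_permutations) auto
  have "{(\<pi>, d :: nat \<Rightarrow> 'a) \<in> mono_params n. min_mismatch n \<pi> d = k}
      \<subseteq> (\<Union>(c, E)\<in>UNIV \<times> ?E. {\<pi>. \<pi> permutes E} \<times> ?D c E)"
  proof clarify
    fix \<pi> and d :: "nat \<Rightarrow> 'a" assume P: "(\<pi>, d) \<in> mono_params n" and k: "k = min_mismatch n \<pi> d"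
    then obtain c where c: "k = mismatch n \<pi> d c" using ex_min_mismatch[of n \<pi> d] by auto
    let ?S = "{i. i < n \<and> \<not> (\<pi> i = i \<and> d i = c)}"
    have \<pi>: "\<pi> permutes {..<n}" and dn: "\<And>i. i \<ge> n \<Longrightarrow> d i = 1"
      using P by (auto simp: mono_params_def)
    have "\<pi> permutes ?S" by (rule permutes_superset[OF \<pi>]) simp
    moreover have "?S \<in> {E. E \<subseteq> {..<n} \<and> card E = min_mismatch n \<pi> d}"
      unfolding k[symmetric] c mismatch_def by blast
    moreover have "d \<in> ?D c ?S" using dn by auto
    ultimately show "(\<pi>, d) \<in> (\<Union>(c, E)\<in>UNIV \<times> {E. E \<subseteq> {..<n} \<and> card E = min_mismatch n \<pi> d}.
        {\<pi>. \<pi> permutes E} \<times> ?D c E)"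
      unfolding k by blast
  qed
  then have "card {(\<pi>, d :: nat \<Rightarrow> 'a) \<in> mono_params n. min_mismatch n \<pi> d = k}
      \<le> card (\<Union>(c, E)\<in>UNIV \<times> ?E. {\<pi>. \<pi> permutes E} \<times> ?D c E)"
    by (rule card_mono[rotated]) (use fE fP D in \<open>auto intro!: finite_cartesian_product\<close>)
  also have "\<dots> \<le> (\<Sum>(c, E)\<in>UNIV \<times> ?E. card ({\<pi>. \<pi> permutes E} \<times> ?D c E))"
    using card_UN_le[of "UNIV \<times> ?E" "\<lambda>(c, E). {\<pi>. \<pi> permutes E} \<times> ?D c E"] fE
    by (simp add: case_prod_unfold)
  also have "\<dots> = (\<Sum>(c :: 'a, E)\<in>UNIV \<times> ?E. fact k * CARD('a) ^ k)"
  proof (rule sum.cong[OF refl], clarify)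
    fix c :: 'a and E assume E: "E \<subseteq> {..<n}" "k = card E"
    have "card {\<pi>. \<pi> permutes E} = fact k"
      using E finite_subset[of E "{..<n}"] by (intro card_permutations) auto
    then show "card ({\<pi>. \<pi> permutes E} \<times> ?D c E) = fact (card E) * CARD('a) ^ card E"
      using D(2)[of E c] E by (simp add: card_cartesian_product)
  qed
  also have "\<dots> = CARD('a) * ((n choose k) * fact k) * CARD('a) ^ k"
    by (simp add: card_cartesian_product n_subsets)
  also have "\<dots> \<le> CARD('a) * n ^ k * CARD('a) ^ k"
    using binomial_fact_pow[of n k] by (intro mult_right_mono mult_left_mono) auto
  finally show ?thesis by (simp add: power_mult_distrib mult.assoc)
qed

text \<open>For each number k >= 1 of deviating coordinates, the bound of
  \<open>card_min_mismatch_le\<close> times that of \<open>num_fixed_mono_act_le\<close>, with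
  q^(n^2/4) divided out.\<close>

definition linear_error :: "real \<Rightarrow> nat \<Rightarrow> real" where
  "linear_error q n = (\<Sum>k\<in>{1..n}. (q * (real n * q) ^ k) *
     (2 * q * (real n + 1)\<^sup>2 * (1 / phi (1 / q))\<^sup>2 * q powr (- (real n * real k / 512))))"

lemma sum_num_fixed_linear_le:
  assumes P: "P \<subseteq> (mono_params n :: ((nat \<Rightarrow> nat) \<times> (nat \<Rightarrow> 'a::{field,finite})) set)" and n: "80 \<le> n"
  shows "(\<Sum>(\<pi>, d)\<in>{(\<pi>, d) \<in> P. min_mismatch n \<pi> d \<noteq> 0}. real (num_fixed n (mono_act \<pi> d id)))
    \<le> linear_error (real CARD('a)) n * real CARD('a) powr ((real n)\<^sup>2 / 4)"
proof -
  let ?q = "real CARD('a)"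
  let ?P = "{(\<pi>, d) \<in> P. min_mismatch n \<pi> d \<noteq> 0}"
  let ?m = "\<lambda>x. min_mismatch n (fst x) (snd x)"
  let ?C = "2 * ?q * (real n + 1)\<^sup>2 * (1 / phi (1 / ?q))\<^sup>2"
  let ?B = "\<lambda>k::nat. ?C * ?q powr ((real n)\<^sup>2 / 4 - real n * real k / 512)"
  have fin: "finite ?P" by (rule finite_subset[OF _ card_mono_params(1)[of n]]) (use P in auto)
  have "(\<Sum>(\<pi>, d)\<in>?P. real (num_fixed n (mono_act \<pi> d id))) \<le> (\<Sum>x\<in>?P. ?B (?m x))"
  proof (rule sum_mono)
    fix x assume "x \<in> ?P"
    then obtain \<pi> d where x: "x = (\<pi>, d)" and "(\<pi>, d) \<in> mono_params n" using P by auto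
    then show "(case x of (\<pi>, d) \<Rightarrow> real (num_fixed n (mono_act \<pi> d id))) \<le> ?B (?m x)"
      using num_fixed_mono_act_le[OF _ n, of \<pi> d] by simp
  qed
  also have "\<dots> = (\<Sum>k\<in>{1..n}. \<Sum>x\<in>{x \<in> ?P. ?m x = k}. ?B (?m x))"
    by (rule sum.group[symmetric]) (use fin min_mismatch_le_n in auto)
  also have "\<dots> \<le> (\<Sum>k\<in>{1..n}. (?q * (real n * ?q) ^ k) * ?B k)"
  proof (rule sum_mono)
    fix k assume "k \<in> {1..n}"
    have "card {x \<in> ?P. ?m x = k} \<le> card {(\<pi>, d :: nat \<Rightarrow> 'a) \<in> mono_params n. min_mismatch n \<pi> d = k}"
      by (rule card_mono) (use P card_mono_params(1)[of n] in \<open>auto intro: rev_finite_subset\<close>)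
    also have "\<dots> \<le> CARD('a) * (n * CARD('a)) ^ k" by (rule card_min_mismatch_le)
    finally have "real (card {x \<in> ?P. ?m x = k}) \<le> real (CARD('a) * (n * CARD('a)) ^ k)"
      by (simp only: of_nat_le_iff)
    then have "real (card {x \<in> ?P. ?m x = k}) * ?B k \<le> (?q * (real n * ?q) ^ k) * ?B k"
      by (intro mult_right_mono) auto
    then show "(\<Sum>x\<in>{x \<in> ?P. ?m x = k}. ?B (?m x)) \<le> (?q * (real n * ?q) ^ k) * ?B k" by simp
  qed
  also have "\<dots> = linear_error ?q n * ?q powr ((real n)\<^sup>2 / 4)"
    unfolding linear_error_def sum_distrib_right
    by (intro sum.cong refl) (simp only: diff_conv_add_uminus powr_add mult_ac)
  finally show ?thesis .
qed

text \<open>The k-th summand is a polynomial in n times x^k, where x = n q^(1 - n/512) tends to 0.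
  Once x < 1, each x^k is at most x, and n terms of that size remain. Replacing the decaying power
  of q by one of 2 leaves a concrete sequence.\<close>

lemma linear_error_tendsto_0:
  fixes q :: real
  assumes q: "2 \<le> q"
  shows "linear_error q \<longlonglongrightarrow> 0"
proof -
  let ?x = "\<lambda>n. real n * q * q powr (- (real n / 512))"
  let ?C = "2 * q\<^sup>2 * (1 / phi (1 / q))\<^sup>2"
  have p2: "q powr (- (real n / 512)) \<le> 2 powr (- (real n / 512))" for n
    using q by (intro powr_mono2') auto
  have x0: "?x \<longlonglongrightarrow> 0"
  proof (rule tendsto_sandwich[OF _ _ tendsto_const])
    show "\<forall>\<^sub>F n in sequentially. ?x n \<le> q * (real n * 2 powr (- (real n / 512)))"
      using p2 q by (intro always_eventually allI) (simp add: mult_left_mono mult.assoc mult.left_commute)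
    have "(\<lambda>n. real n * 2 powr (- (real n / 512))) \<longlonglongrightarrow> 0" by real_asymp
    then show "(\<lambda>n. q * (real n * 2 powr (- (real n / 512)))) \<longlonglongrightarrow> 0" by (rule tendsto_mult_right_zero)
  qed (use q in auto)
  have ev: "\<forall>\<^sub>F n in sequentially. ?x n < 1" by (rule order_tendstoD(2)[OF x0]) simp
  have pos: "0 \<le> linear_error q n" for n
    unfolding linear_error_def using q by (intro sum_nonneg) auto
  show ?thesis
  proof (rule tendsto_sandwich[OF _ _ tendsto_const])
    show "\<forall>\<^sub>F n in sequentially. linear_error q n \<le> ?C * q * (real n ^ 2 * (real n + 1)\<^sup>2 * 2 powr (- (real n / 512)))"
      using ev
    proof eventually_elim
      case (elim n)
      have "linear_error q n = (\<Sum>k\<in>{1..n}. ?C * (real n + 1)\<^sup>2 * ?x n ^ k)"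
        unfolding linear_error_def
        using q by (intro sum.cong refl) (simp add: power_mult_distrib power2_eq_square powr_realpow powr_powr flip: powr_realpow)
      also have "\<dots> \<le> (\<Sum>k\<in>{1..n}. ?C * (real n + 1)\<^sup>2 * ?x n)"
      proof (intro sum_mono mult_left_mono)
        fix k assume "k \<in> {1..n}"
        then show "?x n ^ k \<le> ?x n" using elim q power_decreasing[of 1 k "?x n"] by simp
      qed auto
      also have "\<dots> = ?C * q * (real n ^ 2 * (real n + 1)\<^sup>2 * q powr (- (real n / 512)))"
        unfolding sum_constant by (simp add: power2_eq_square mult_ac)
      also have "\<dots> \<le> ?C * q * (real n ^ 2 * (real n + 1)\<^sup>2 * 2 powr (- (real n / 512)))"
        using p2 q by (intro mult_left_mono) auto
      finally show ?case .
    qed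
    have "(\<lambda>n. real n ^ 2 * (real n + 1)\<^sup>2 * 2 powr (- (real n / 512))) \<longlonglongrightarrow> 0" by real_asymp
    then show "(\<lambda>n. ?C * q * (real n ^ 2 * (real n + 1)\<^sup>2 * 2 powr (- (real n / 512)))) \<longlonglongrightarrow> 0"
      by (rule tendsto_mult_right_zero)
  qed (use pos in auto)
qed

text \<open>The order of the full monomial group times the bound for a single semilinear map, with
  q^(n^2/4) divided out.\<close>

definition semilinear_error :: "real \<Rightarrow> nat \<Rightarrow> real" where
  "semilinear_error q n = fact n * (q - 1) ^ n * ((real n + 1) * (1 / phi (1 / q)) * q powr (- ((real n)\<^sup>2 / 512)))"

lemma sum_num_fixed_semilinear_le:
  assumes \<sigma>: "\<sigma> \<in> field_auts" "\<sigma> \<noteq> id" and n: "80 \<le> n"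
  shows "(\<Sum>(\<pi>, d)\<in>(mono_params n :: ((nat \<Rightarrow> nat) \<times> (nat \<Rightarrow> 'a::{field,finite})) set). real (num_fixed n (mono_act \<pi> d \<sigma>)))
    \<le> semilinear_error (real CARD('a)) n * real CARD('a) powr ((real n)\<^sup>2 / 4)"
proof -
  let ?q = "real CARD('a)"
  let ?B = "(real n + 1) * (1 / phi (1 / ?q)) * ?q powr ((real n)\<^sup>2 / 4 - (real n)\<^sup>2 / 512)"
  have "(\<Sum>(\<pi>, d)\<in>(mono_params n :: ((nat \<Rightarrow> nat) \<times> (nat \<Rightarrow> 'a)) set). real (num_fixed n (mono_act \<pi> d \<sigma>)))
      \<le> (\<Sum>x\<in>(mono_params n :: ((nat \<Rightarrow> nat) \<times> (nat \<Rightarrow> 'a)) set). ?B)"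
  proof (rule sum_mono)
    fix x assume "x \<in> (mono_params n :: ((nat \<Rightarrow> nat) \<times> (nat \<Rightarrow> 'a)) set)"
    then obtain \<pi> d where "x = (\<pi>, d)" "(\<pi>, d) \<in> mono_params n" by (cases x) auto
    then show "(case x of (\<pi>, d) \<Rightarrow> real (num_fixed n (mono_act \<pi> d \<sigma>))) \<le> ?B"
      using num_fixed_semilinear_le[OF _ \<sigma> n, of \<pi> d] by simp
  qed
  also have "\<dots> = fact n * (?q - 1) ^ n * ?B"
    using coord.q_ge_2[where 'a = 'a] by (simp add: card_mono_params of_nat_diff)
  finally show ?thesis
    unfolding semilinear_error_def by (simp only: diff_conv_add_uminus powr_add mult_ac)
qed

lemma semilinear_error_tendsto_0:
  fixes q :: real
  assumes q: "2 \<le> q"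
  shows "semilinear_error q \<longlonglongrightarrow> 0"
proof (rule tendsto_sandwich[OF _ _ tendsto_const])
  have phi: "phi (1 / q) > 0" using phi_LIMSEQ(2)[of "1 / q"] q by simp
  show "\<forall>\<^sub>F n in sequentially. 0 \<le> semilinear_error q n"
    using phi q by (auto simp: semilinear_error_def)
  show "\<forall>\<^sub>F n in sequentially. semilinear_error q n \<le>
      (1 / phi (1 / q)) * (real n powr real n * (real n + 1) * 2 powr (real n - (real n)\<^sup>2 / 512))"
    \<comment> \<open>From n = 512 on the exponent n - n^2/512 is not positive, so replacing the
      base q by 2 does not decrease the bound.\<close>
    using eventually_ge_at_top[of 512]
  proof eventually_elim
    case (elim n)
    have "semilinear_error q n \<le> real n powr real n * q ^ n * ((real n + 1) * (1 / phi (1 / q)) * q powr (- ((real n)\<^sup>2 / 512)))"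
      unfolding semilinear_error_def
    proof (intro mult_right_mono mult_mono power_mono)
      have "(fact n :: real) \<le> of_nat (n ^ n)" by (rule fact_le_power)
      then show "fact n \<le> real n powr real n" using elim by (simp add: powr_realpow)
    qed (use q phi in auto)
    also have "\<dots> = (1 / phi (1 / q)) * (real n powr real n * (real n + 1) * q powr (real n - (real n)\<^sup>2 / 512))"
      unfolding diff_conv_add_uminus powr_add using q by (simp add: powr_realpow)
    also have "\<dots> \<le> (1 / phi (1 / q)) * (real n powr real n * (real n + 1) * 2 powr (real n - (real n)\<^sup>2 / 512))"
    proof (intro mult_left_mono powr_mono2')
      show "real n - (real n)\<^sup>2 / 512 \<le> 0"
        using elim mult_mono[of 512 "real n" "real n" "real n"] by (simp add: power2_eq_square)
    qed (use q phi in auto)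
    finally show ?case .
  qed
  have "(\<lambda>n. real n powr real n * (real n + 1) * 2 powr (real n - (real n)\<^sup>2 / 512)) \<longlonglongrightarrow> 0" by real_asymp
  then show "(\<lambda>n. (1 / phi (1 / q)) * (real n powr real n * (real n + 1) * 2 powr (real n - (real n)\<^sup>2 / 512))) \<longlonglongrightarrow> 0"
    by (rule tendsto_mult_right_zero)
qed

subsection \<open>Asymptotics of the number of subspaces\<close>

text \<open>Tannery's theorem, obtained as dominated convergence for the counting measure;
  \<open>infsetsum\<close> connects \<open>infsum\<close> with the integral.\<close>

lemma tannery_infsum:
  fixes f :: "nat \<Rightarrow> 'i \<Rightarrow> real"
  assumes w: "w summable_on UNIV" and le: "\<And>n i. norm (f n i) \<le> w i"
    and lim: "\<And>i. (\<lambda>n. f n i) \<longlonglongrightarrow> g i"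
  shows "(\<lambda>n. \<Sum>\<^sub>\<infinity>i. f n i) \<longlonglongrightarrow> (\<Sum>\<^sub>\<infinity>i. g i)" and "g summable_on UNIV"
proof -
  let ?M = "count_space (UNIV :: 'i set)"
  have w0: "w i = norm (w i)" for i using le[of 0 i] norm_ge_zero[of "f 0 i"] by simp
  have "Infinite_Set_Sum.abs_summable_on w UNIV"
    unfolding abs_summable_equivalent[symmetric] using w w0 by simp
  then have iw: "integrable ?M w" by (simp add: Infinite_Set_Sum.abs_summable_on_def)
  have bound: "AE x in ?M. norm (f n x) \<le> w x" for n using le by simp
  have lim': "AE x in ?M. (\<lambda>n. f n x) \<longlonglongrightarrow> g x" using lim by simp
  have dc: "(\<lambda>n. integral\<^sup>L ?M (f n)) \<longlonglongrightarrow> integral\<^sup>L ?M g"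
    by (rule integral_dominated_convergence[OF _ _ iw lim' bound]) auto
  have ig: "integrable ?M g"
    by (rule integrable_dominated_convergence[OF _ _ iw lim' bound]) auto
  have "integrable ?M (f n)" for n
    by (rule Bochner_Integration.integrable_bound[OF iw]) (use le w0 in \<open>auto intro: order_trans\<close>)
  then have eqf: "integral\<^sup>L ?M (f n) = infsum (f n) UNIV" for n
    using infsetsum_infsum[of "f n" UNIV] by (simp add: Infinite_Set_Sum.abs_summable_on_def infsetsum_def)
  have ag: "Infinite_Set_Sum.abs_summable_on g UNIV" using ig by (simp add: Infinite_Set_Sum.abs_summable_on_def)
  have "integral\<^sup>L ?M g = infsum g UNIV"
    using infsetsum_infsum[OF ag] by (simp add: infsetsum_def)
  then show "(\<lambda>n. \<Sum>\<^sub>\<infinity>i. f n i) \<longlonglongrightarrow> (\<Sum>\<^sub>\<infinity>i. g i)" using dc eqf by simp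
  show "g summable_on UNIV"
    using ag unfolding abs_summable_equivalent[symmetric] by (rule abs_summable_summable)
qed

lemma summable_on_power_abs_int:
  fixes x :: real
  assumes "0 < x" "x < 1"
  shows "(\<lambda>k::int. x ^ nat \<bar>k\<bar>) summable_on UNIV"
proof -
  have s: "(\<lambda>n. x ^ n) summable_on UNIV"
    by (rule norm_summable_imp_summable_on) (use assms in \<open>simp add: summable_geometric\<close>)
  have "(\<lambda>k::int. x ^ nat \<bar>k\<bar>) summable_on range int"
    by (subst summable_on_reindex) (use s in \<open>auto simp: o_def\<close>)
  moreover have "(\<lambda>k::int. x ^ nat \<bar>k\<bar>) summable_on range (\<lambda>n. - int n)"
    by (subst summable_on_reindex) (use s in \<open>auto simp: o_def inj_on_def\<close>)
  moreover have "range int \<union> range (\<lambda>n. - int n) = UNIV"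
  proof -
    have "k \<in> range int \<union> range (\<lambda>n. - int n)" for k by (cases k rule: int_cases2) auto
    then show ?thesis by blast
  qed
  ultimately show ?thesis by (metis summable_on_union)
qed

text \<open>A linear lower bound for the exponents lets a geometric series dominate the theta
  series.\<close>

lemma half_shift_square_ge:
  assumes "e \<le> (1::nat)"
  shows "real (nat \<bar>k\<bar>) - 1 \<le> (real_of_int k + real e / 2)\<^sup>2"
proof -
  have e: "e = 0 \<or> e = 1" using assms by linarith
  have "\<bar>real_of_int k\<bar> - 1 \<le> (real_of_int k + real e / 2)\<^sup>2"
    using e
  proof
    assume "e = 0"
    have "0 \<le> (\<bar>real_of_int k\<bar> - 1/2)\<^sup>2" by simp
    then show ?thesis using \<open>e = 0\<close> by (simp add: power2_eq_square algebra_simps)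
  next
    assume "e = 1"
    have "0 \<le> (\<bar>real_of_int k + 1/2\<bar> - 1/2)\<^sup>2" by simp
    then have "\<bar>real_of_int k + 1/2\<bar> - 1/4 \<le> (real_of_int k + 1/2)\<^sup>2"
      by (simp add: power2_eq_square algebra_simps)
    then show ?thesis using \<open>e = 1\<close> by simp
  qed
  then show ?thesis by simp
qed

lemma powr_half_shift_le:
  fixes x :: real
  assumes "0 < x" "x < 1" "e \<le> 1"
  shows "x powr ((real_of_int k + real e / 2)\<^sup>2) \<le> x ^ nat \<bar>k\<bar> / x"
proof -
  have "x powr ((real_of_int k + real e / 2)\<^sup>2) \<le> x powr (real (nat \<bar>k\<bar>) - 1)"
    by (rule powr_mono') (use half_shift_square_ge[OF assms(3), of k] assms in auto)
  also have "x powr (real m - 1) = x ^ m / x" for m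
    using assms by (simp add: powr_diff powr_realpow power2_eq_square)
  finally show ?thesis .
qed

text \<open>Treats both theta constants at once; e is the parity of the code length.\<close>

definition theta_half :: "nat \<Rightarrow> real \<Rightarrow> real" where
  "theta_half e x = (\<Sum>\<^sub>\<infinity>k::int. x powr ((real_of_int k + real e / 2)\<^sup>2))"

lemma theta_half_0: "theta_half 0 x = theta3 x" and theta_half_1: "theta_half 1 x = theta2 x"
  by (simp_all add: theta_half_def theta3_def theta2_def)

lemma summable_theta_half:
  fixes x :: real
  assumes "0 < x" "x < 1" "e \<le> 1"
  shows "(\<lambda>k::int. x powr ((real_of_int k + real e / 2)\<^sup>2)) summable_on UNIV"
proof (rule summable_on_comparison_test)
  show "(\<lambda>k::int. x ^ nat \<bar>k\<bar> * (1 / x)) summable_on UNIV"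
    by (rule summable_on_cmult_left[OF summable_on_power_abs_int]) (use assms in auto)
qed (use powr_half_shift_le[OF assms] in auto)

lemma theta_half_pos:
  assumes "0 < x" "x < 1" "e \<le> 1"
  shows "0 < theta_half e x"
proof -
  have "0 < x powr ((real_of_int 0 + real e / 2)\<^sup>2)" using assms by simp
  also have "\<dots> = (\<Sum>\<^sub>\<infinity>k::int\<in>{0}. x powr ((real_of_int k + real e / 2)\<^sup>2))" by simp
  also have "\<dots> \<le> theta_half e x"
    unfolding theta_half_def
    by (rule infsum_mono_neutral) (use summable_theta_half[OF assms] in auto)
  finally show ?thesis .
qed

definition num_subspaces :: "'a::{field,finite} itself \<Rightarrow> nat \<Rightarrow> nat" where
  "num_subspaces T n = card {U :: (nat \<Rightarrow> 'a) set. coord.subspace U \<and> U \<subseteq> supported {..<n}}"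

text \<open>The q-Pochhammer symbol (x; x)_k.\<close>

definition euler_partial :: "real \<Rightarrow> nat \<Rightarrow> real" where
  "euler_partial x k = (\<Prod>m<k. 1 - x ^ Suc m)"

lemma euler_partial_bounds:
  assumes "0 < x" "x < 1"
  shows "0 < phi x" "phi x \<le> euler_partial x k" "0 < euler_partial x k" "euler_partial x k \<le> 1"
proof -
  show 1: "0 < phi x" "phi x \<le> euler_partial x k"
    using phi_LIMSEQ(2)[OF assms] phi_le_prod[OF assms] by (auto simp: euler_partial_def)
  then show "0 < euler_partial x k" by linarith
  have "0 \<le> 1 - x ^ Suc m \<and> 1 - x ^ Suc m \<le> 1" for m
    using assms power_decreasing[of 0 "Suc m" x] by (auto simp del: power_Suc)
  then show "euler_partial x k \<le> 1" unfolding euler_partial_def by (intro prod_le_1) blast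
qed

text \<open>The product formula with its leading power split off. The remaining quotient is at most
  1/phi^2 and tends to 1/phi when d and n - d grow, which is what dominated convergence
  needs.\<close>

lemma card_between_euler:
  assumes "d \<le> n"
  shows "real (card (coord.between {0} (supported {..<n} :: (nat \<Rightarrow> 'a::{field,finite}) set) d)) =
    real CARD('a) ^ (d * (n - d)) * (euler_partial (1 / real CARD('a)) n /
      (euler_partial (1 / real CARD('a)) d * euler_partial (1 / real CARD('a)) (n - d)))"
proof -
  let ?q = "real CARD('a)"
  let ?x = "1 / ?q" and ?P = "euler_partial (1 / ?q)"
  have q2: "?q \<ge> 2" using coord.real_q_ge_2[where 'a = 'a] .
  have x: "0 < ?x" "?x < 1" using q2 by auto
  have fac: "?q ^ m - ?q ^ j = ?q ^ m * (1 - ?x ^ (m - j))" if "j \<le> m" for m j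
    using that q2 by (simp add: power_diff field_simps power_divide)
  \<comment> \<open>The factors with j < d are the last d factors of the partial Euler product of
    length m, in reverse order.\<close>
  have prod_P: "(\<Prod>j\<in>{0..<d}. 1 - ?x ^ (m - j)) * ?P (m - d) = ?P m" if "d \<le> m" for m
  proof -
    have "?P m = (\<Prod>i\<in>{..<m - d}. 1 - ?x ^ Suc i) * (\<Prod>i\<in>{m - d..<m}. 1 - ?x ^ Suc i)"
      unfolding euler_partial_def by (subst prod.union_disjoint[symmetric])
        (auto intro!: prod.cong simp del: power_Suc)
    also have "(\<Prod>i\<in>{m - d..<m}. 1 - ?x ^ Suc i) = (\<Prod>j\<in>{0..<d}. 1 - ?x ^ (m - j))"
      by (rule prod.reindex_bij_witness[of _ "\<lambda>j. m - Suc j" "\<lambda>i. m - Suc i"])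
         (use that in \<open>auto simp: Suc_diff_Suc simp del: power_Suc\<close>)
    finally show ?thesis by (simp add: euler_partial_def mult.commute)
  qed
  have P0: "?P k \<noteq> 0" for k using euler_partial_bounds(3)[OF x, of k] by simp
  have P00: "?P 0 = 1" by (simp add: euler_partial_def)
  have "real (card (coord.between {0} (supported {..<n} :: (nat \<Rightarrow> 'a) set) d)) =
      (\<Prod>j\<in>{0..<d}. (?q ^ n - ?q ^ j) / (?q ^ d - ?q ^ j))"
    by (rule coord.card_between) (use assms in \<open>auto simp: supported_card supported_subspace coord.subspace_0\<close>)
  also have "\<dots> = (\<Prod>j\<in>{0..<d}. ?q ^ (n - d) * ((1 - ?x ^ (n - j)) / (1 - ?x ^ (d - j))))"
  proof (rule prod.cong[OF refl])
    fix j assume "j \<in> {0..<d}"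
    then have "(?q ^ n - ?q ^ j) / (?q ^ d - ?q ^ j)
        = (?q ^ n * (1 - ?x ^ (n - j))) / (?q ^ d * (1 - ?x ^ (d - j)))"
      using assms by (simp only: fac[of j n] fac[of j d] atLeastLessThan_iff less_imp_le_nat order_trans[of j d n])
    then show "(?q ^ n - ?q ^ j) / (?q ^ d - ?q ^ j) = ?q ^ (n - d) * ((1 - ?x ^ (n - j)) / (1 - ?x ^ (d - j)))"
      using assms q2 by (simp add: power_diff)
  qed
  also have "\<dots> = ?q ^ (d * (n - d)) * ((\<Prod>j\<in>{0..<d}. 1 - ?x ^ (n - j)) / (\<Prod>j\<in>{0..<d}. 1 - ?x ^ (d - j)))"
    by (simp add: prod.distrib prod_dividef mult.commute flip: power_mult)
  also have "(\<Prod>j\<in>{0..<d}. 1 - ?x ^ (n - j)) = ?P n / ?P (n - d)"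
    using prod_P[OF assms] P0 by (simp add: field_simps)
  also have "(\<Prod>j\<in>{0..<d}. 1 - ?x ^ (d - j)) = ?P d"
    using prod_P[of d] P00 by simp
  finally show ?thesis by (simp only: divide_divide_eq_left mult.commute)
qed

lemma num_subspaces_sum:
  "num_subspaces TYPE('a::{field,finite}) n = (\<Sum>d\<le>n. card (coord.between {0} (supported {..<n} :: (nat \<Rightarrow> 'a) set) d))"
proof -
  let ?V = "supported {..<n} :: (nat \<Rightarrow> 'a) set"
  have V: "coord.subspace ?V" "finite ?V" "card ?V = CARD('a) ^ n"
    by (simp_all add: supported_subspace supported_card)
  have "{U. coord.subspace U \<and> U \<subseteq> ?V} = (\<Union>d\<in>{..n}. coord.between {0} ?V d)"
    using coord.invariant_subset_between[OF V, of id] by (auto simp: coord.between_def)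
  moreover have "card (\<Union>d\<in>{..n}. coord.between {0} ?V d) = (\<Sum>d\<le>n. card (coord.between {0} ?V d))"
  proof (rule card_UN_disjoint)
    show "\<forall>d\<in>{..n}. finite (coord.between {0} ?V d)" using coord.finite_between[OF V(2)] by blast
  qed (auto simp: coord.between_def coord.q_power_eq_iff)
  ultimately show ?thesis by (simp add: num_subspaces_def)
qed

text \<open>For n = 2 N + e write the dimension as d = N + e + k. Then d - n/2 = k + e/2, so d (n -
  d) = n^2/4 - (k + e/2)^2, and the normalised count becomes a theta series whose terms carry a
  factor tending to 1/phi. The partial Euler products lie between phi and 1, so theta terms divided
  by phi^2 dominate.\<close>

lemma num_subspaces_limit:
  assumes e: "e \<le> 1"
  shows "(\<lambda>N. real (num_subspaces TYPE('a::{field,finite}) (2 * N + e)) / real CARD('a) powr ((real (2 * N + e))\<^sup>2 / 4))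
    \<longlonglongrightarrow> theta_half e (1 / real CARD('a)) / phi (1 / real CARD('a))"
proof -
  let ?q = "real CARD('a)"
  let ?x = "1 / ?q" and ?P = "euler_partial (1 / ?q)"
  have q2: "?q \<ge> 2" using coord.real_q_ge_2[where 'a = 'a] .
  have x: "0 < ?x" "?x < 1" using q2 by auto
  note P = euler_partial_bounds[OF x]
  define t where "t = (\<lambda>k::int. ?x powr ((real_of_int k + real e / 2)\<^sup>2))"
  \<comment> \<open>Extension by 0 gives all N the same index set, the integers.\<close>
  define f where "f = (\<lambda>(N::nat) k. if - int (N + e) \<le> k \<and> k \<le> int N
    then t k * (?P (2 * N + e) / (?P (nat (int (N + e) + k)) * ?P (nat (int N - k)))) else 0)"
  have t0: "0 \<le> t k" for k by (simp add: t_def)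
  have "t summable_on UNIV" unfolding t_def by (rule summable_theta_half[OF x e])
  then have w: "(\<lambda>k. t k * (1 / (phi ?x * phi ?x))) summable_on UNIV" by (rule summable_on_cmult_left)
  have Plim: "?P \<longlonglongrightarrow> phi ?x" unfolding euler_partial_def[abs_def] by (rule phi_LIMSEQ(1)[OF x])
  have le: "norm (f N k) \<le> t k * (1 / (phi ?x * phi ?x))" for N k
  proof -
    have "0 \<le> ?P (2 * N + e) / (?P (nat (int (N + e) + k)) * ?P (nat (int N - k)))"
      using P(3) by (auto intro!: divide_nonneg_nonneg mult_nonneg_nonneg less_imp_le)
    moreover have "?P (2 * N + e) / (?P (nat (int (N + e) + k)) * ?P (nat (int N - k))) \<le> 1 / (phi ?x * phi ?x)"
      using P by (intro frac_le mult_mono mult_pos_pos) (auto intro: less_imp_le)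
    ultimately have "0 \<le> f N k \<and> f N k \<le> t k * (1 / (phi ?x * phi ?x))"
      using t0[of k] P(1) unfolding f_def by (auto intro!: mult_nonneg_nonneg mult_left_mono simp del: times_divide_eq_right)
    then show ?thesis by simp
  qed
  have lim: "(\<lambda>N. f N k) \<longlonglongrightarrow> t k * (1 / phi ?x)" for k
  proof -
    have l1: "(\<lambda>N. ?P (2 * N + e)) \<longlonglongrightarrow> phi ?x"
      by (rule filterlim_compose[OF Plim]) real_asymp
    have l2: "(\<lambda>N. ?P (nat (int (N + e) + k))) \<longlonglongrightarrow> phi ?x"
    proof (rule filterlim_compose[OF Plim])
      show "filterlim (\<lambda>N. nat (int (N + e) + k)) at_top sequentially"
        unfolding filterlim_at_top
      proof
        fix Z show "\<forall>\<^sub>F N in sequentially. Z \<le> nat (int (N + e) + k)"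
          using eventually_ge_at_top[of "Z + nat \<bar>k\<bar>"] by eventually_elim linarith
      qed
    qed
    have l3: "(\<lambda>N. ?P (nat (int N - k))) \<longlonglongrightarrow> phi ?x"
    proof (rule filterlim_compose[OF Plim])
      show "filterlim (\<lambda>N. nat (int N - k)) at_top sequentially"
        unfolding filterlim_at_top
      proof
        fix Z show "\<forall>\<^sub>F N in sequentially. Z \<le> nat (int N - k)"
          using eventually_ge_at_top[of "Z + nat \<bar>k\<bar>"] by eventually_elim linarith
      qed
    qed
    have "(\<lambda>N. t k * (?P (2 * N + e) / (?P (nat (int (N + e) + k)) * ?P (nat (int N - k)))))
        \<longlonglongrightarrow> t k * (phi ?x / (phi ?x * phi ?x))"
      by (intro tendsto_intros l1 l2 l3) (use P(1) in auto)
    moreover have "\<forall>\<^sub>F N in sequentially. f N k =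
        t k * (?P (2 * N + e) / (?P (nat (int (N + e) + k)) * ?P (nat (int N - k))))"
      using eventually_ge_at_top[of "nat \<bar>k\<bar>"] by eventually_elim (auto simp: f_def)
    ultimately show ?thesis using P(1) by (simp add: tendsto_cong)
  qed
  have eq: "(\<Sum>\<^sub>\<infinity>k. f N k) = real (num_subspaces TYPE('a) (2 * N + e)) / ?q powr ((real (2 * N + e))\<^sup>2 / 4)" for N
  proof -
    let ?n = "2 * N + e" and ?I = "{- int (N + e)..int N}"
    have "(\<Sum>\<^sub>\<infinity>k. f N k) = (\<Sum>\<^sub>\<infinity>k\<in>?I. f N k)"
      by (rule infsum_cong_neutral) (auto simp: f_def)
    also have "\<dots> = (\<Sum>k\<in>?I. f N k)" by simp
    also have "\<dots> = (\<Sum>d\<le>?n. real (card (coord.between {0} (supported {..<?n} :: (nat \<Rightarrow> 'a) set) d)) / ?q powr ((real ?n)\<^sup>2 / 4))"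
    proof (rule sum.reindex_bij_witness[of _ "\<lambda>d. int d - int (N + e)" "\<lambda>k. nat (int (N + e) + k)"])
      fix k assume k: "k \<in> ?I"
      define d where "d = nat (int (N + e) + k)"
      have d: "int d = int (N + e) + k" "d \<le> ?n" using k by (auto simp: d_def)
      have nd: "nat (int N - k) = ?n - d" using d by linarith
      have rd: "real d = real (N + e) + real_of_int k" using d(1) by linarith
      have "t k = ?q powr (real d * (real ?n - real d)) / ?q powr ((real ?n)\<^sup>2 / 4)"
        unfolding t_def powr_diff[symmetric] rd
        by (simp add: powr_divide powr_minus_divide[symmetric] power2_eq_square) (simp add: algebra_simps add_divide_distrib)
      also have "?q powr (real d * (real ?n - real d)) = ?q ^ (d * (?n - d))"
        using d(2) q2 by (simp add: of_nat_diff flip: powr_realpow)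
      finally have "t k = ?q ^ (d * (?n - d)) / ?q powr ((real ?n)\<^sup>2 / 4)" .
      then show "real (card (coord.between {0} (supported {..<?n} :: (nat \<Rightarrow> 'a) set) (nat (int (N + e) + k))))
          / ?q powr ((real ?n)\<^sup>2 / 4) = f N k"
        using k unfolding d_def[symmetric] card_between_euler[OF d(2)] f_def nd by auto
    qed auto
    also have "\<dots> = real (num_subspaces TYPE('a) ?n) / ?q powr ((real ?n)\<^sup>2 / 4)"
      by (simp add: num_subspaces_sum sum_divide_distrib)
    finally show ?thesis .
  qed
  have "(\<Sum>\<^sub>\<infinity>k. t k * (1 / phi ?x)) = theta_half e ?x / phi ?x"
    unfolding infsum_cmult_left' by (simp add: theta_half_def t_def)
  then show ?thesis using tannery_infsum(1)[OF w le lim] by (simp add: eq)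
qed

subsection \<open>Large fields\<close>

lemma phi_inverse_tendsto_1: "(\<lambda>r. phi (inverse (real r))) \<longlonglongrightarrow> 1"
proof (rule tendsto_sandwich)
  have x: "0 < inverse (real r)" "inverse (real r) < 1" if "r \<ge> 2" for r
    using that by (auto simp: field_simps)
  show "\<forall>\<^sub>F r in sequentially. 1 - inverse (real r) / (1 - inverse (real r)) \<le> phi (inverse (real r))"
    using eventually_ge_at_top[of 2] by eventually_elim (rule phi_ge[OF x])
  show "\<forall>\<^sub>F r in sequentially. phi (inverse (real r)) \<le> 1"
    using eventually_ge_at_top[of 2] by eventually_elim (use phi_le_prod[OF x, of _ 0] in simp)
  show "(\<lambda>r. 1 - inverse (real r) / (1 - inverse (real r))) \<longlonglongrightarrow> 1" by real_asymp
qed simp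

text \<open>The dominant terms of the series are \<open>k = 0\<close> and, when \<open>e = 1\<close>, also \<open>k = - 1\<close>.\<close>

lemma theta_half_inverse_tendsto:
  assumes e: "e \<le> 1"
  shows "(\<lambda>r. real r powr (real e / 4) * theta_half e (inverse (real r))) \<longlonglongrightarrow> real (Suc e)"
proof -
  \<comment> \<open>Since e^2 = e, this exponent is the integer k (k + e), which vanishes only for k
    = 0 and k = -e.\<close>
  let ?E = "\<lambda>k::int. (real_of_int k + real e / 2)\<^sup>2 - real e / 4"
  \<comment> \<open>The shift by 2 keeps the base at most 1/2, so that one series dominates for all
    r.\<close>
  let ?f = "\<lambda>r k. inverse (real (r + 2)) powr ?E k"
  have e01: "e = 0 \<or> e = 1" using e by linarith
  have E: "?E k = real_of_int (k * (k + int e))" for k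
    using e01 by (auto simp: power2_eq_square algebra_simps)
  have E0: "0 \<le> k * (k + int e)" for k
    using e01 by (cases "k \<ge> 0") (auto intro!: mult_nonneg_nonneg mult_nonpos_nonpos)
  have Ez: "k * (k + int e) = 0 \<longleftrightarrow> k \<in> {- int e, 0}" for k by auto
  have "(\<lambda>r. \<Sum>\<^sub>\<infinity>k. ?f r k) \<longlonglongrightarrow> (\<Sum>\<^sub>\<infinity>k. if k \<in> {- int e, 0} then 1 else 0)"
  proof (rule tannery_infsum(1))
    show "(\<lambda>k. (1 / 2) ^ nat \<bar>k\<bar> * (4::real)) summable_on UNIV"
      by (rule summable_on_cmult_left[OF summable_on_power_abs_int]) auto
    show "norm (?f r k) \<le> (1 / 2) ^ nat \<bar>k\<bar> * 4" for r k
    proof -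
      have "?f r k \<le> (1 / 2) powr ?E k"
      proof (rule powr_mono2)
        show "0 \<le> ?E k" unfolding E using E0[of k] by (simp only: of_int_0_le_iff)
      qed (auto simp: field_simps)
      \<comment> \<open>The 2 collects the loss of 1 in \<open>half_shift_square_ge\<close> and the
        subtracted e/4, which is at most 1.\<close>
      also have "\<dots> \<le> (1 / 2) powr (real (nat \<bar>k\<bar>) - 2)"
        by (rule powr_mono') (use half_shift_square_ge[OF e, of k] e in auto)
      also have "(1 / 2) powr (real m - 2) = (1 / 2) ^ m * (4::real)" for m
        by (simp add: powr_diff powr_realpow power2_eq_square)
      finally show ?thesis by simp
    qed
    show "(\<lambda>r. ?f r k) \<longlonglongrightarrow> (if k \<in> {- int e, 0} then 1 else 0)" for k
    proof (cases "k \<in> {- int e, 0}")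
      case True
      then have "k * (k + int e) = 0" using Ez by blast
      then have Ek: "?E k = 0" unfolding E by (simp only: of_int_0)
      have "?f r k = 1" for r unfolding Ek by simp
      then show ?thesis using True by (simp only: if_True tendsto_const)
    next
      case False
      then have pos: "0 < k * (k + int e)" using Ez[of k] E0[of k] by linarith
      define w where "w = real_of_int (k * (k + int e))"
      have "0 < w" unfolding w_def using pos by (simp only: of_int_0_less_iff)
      have "(\<lambda>r. inverse (real (r + 2)) powr w) \<longlonglongrightarrow> 0 powr w"
      proof (rule tendsto_powr')
        show "(\<lambda>r. inverse (real (r + 2))) \<longlonglongrightarrow> 0" by real_asymp
      qed (use \<open>0 < w\<close> in auto)
      then show ?thesis unfolding E w_def[symmetric] using False by simp
    qed
  qed
  also have "(\<Sum>\<^sub>\<infinity>k. if k \<in> {- int e, 0} then 1 else (0::real)) = (\<Sum>\<^sub>\<infinity>k\<in>{- int e, 0}. 1)"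
    by (rule infsum_cong_neutral) auto
  also have "\<dots> = real (Suc e)" using e01 by auto
  finally have "(\<lambda>r. \<Sum>\<^sub>\<infinity>k. ?f r k) \<longlonglongrightarrow> real (Suc e)" .
  moreover have "(\<Sum>\<^sub>\<infinity>k. ?f r k) = real (r + 2) powr (real e / 4) * theta_half e (inverse (real (r + 2)))" for r
  proof -
    have "?f r k = real (r + 2) powr (real e / 4) * inverse (real (r + 2)) powr ((real_of_int k + real e / 2)\<^sup>2)" for k
      by (simp add: powr_diff powr_divide inverse_eq_divide)
    then show ?thesis unfolding theta_half_def by (simp add: infsum_cmult_right')
  qed
  ultimately show ?thesis by (simp only: ) (rule LIMSEQ_offset[of _ 2])
qed

subsection \<open>Automorphisms of a finite field\<close>

lemma finite_field_generator:
  "\<exists>g :: 'a::{field,finite}. \<forall>x. x \<noteq> 0 \<longrightarrow> (\<exists>i::nat. x = g ^ i)"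
proof -
  have pow: "x [^]\<^bsub>class_ring :: 'a ring\<^esub> (i::nat) = x ^ i" for x i
    by (induction i) (simp_all add: class_ring_simps mult.commute)
  have car: "carrier (mult_of (class_ring :: 'a ring)) = UNIV - {0}"
    by (simp add: class_ring_simps)
  have "\<exists>g\<in>carrier (mult_of (class_ring :: 'a ring)). carrier (mult_of (class_ring :: 'a ring)) =
      {g [^]\<^bsub>class_ring :: 'a ring\<^esub> i | i :: nat. i \<in> UNIV}"
    by (rule field.finite_field_mult_group_has_gen[OF class_field]) (simp add: class_ring_simps)
  then obtain g :: 'a where "UNIV - {0} = {g ^ i | i :: nat. i \<in> UNIV}" unfolding car pow by blast
  then show ?thesis by blast
qed

lemma prime_CHAR_finite_field: "prime CHAR('a::{field,finite})"
  by (rule prime_CHAR_semidom) (rule finite_imp_CHAR_pos, simp)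

lemma field_hom_frobenius: "field_hom (\<lambda>x :: 'a::{field,finite}. x ^ (CHAR('a) ^ i))"
  using prime_gt_0_nat[OF prime_CHAR_finite_field[where 'a = 'a]]
  by unfold_locales
     (auto simp: power_mult_distrib freshmans_dream'[OF prime_CHAR_finite_field] power_0_left)

text \<open>X^p - X has at most p roots, and the images of the naturals below p are p distinct roots
  by the freshman's dream.\<close>

lemma frobenius_fixed_iff_of_nat:
  "(x :: 'a::{field,finite}) ^ CHAR('a) = x \<longleftrightarrow> x \<in> of_nat ` {..<CHAR('a)}"
proof -
  let ?p = "CHAR('a)"
  have p: "prime ?p" by (rule prime_CHAR_finite_field)
  have p1: "1 < ?p" using p prime_gt_1_nat by blast
  have fx: "(of_nat k :: 'a) ^ ?p = of_nat k" for k
    by (induction k) (use freshmans_dream[OF p refl, of 1] p1 in \<open>auto simp: power_0_left\<close>)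
  let ?P = "Polynomial.monom 1 ?p - Polynomial.monom 1 1 :: 'a poly"
  have cf: "Polynomial.coeff ?P ?p = 1" using p1 by simp
  then have P0: "?P \<noteq> 0" by (metis coeff_0 zero_neq_one)
  have deg: "degree ?P \<le> ?p" by (intro degree_diff_le) (use p1 in \<open>auto simp: degree_monom_eq\<close>)
  have roots: "{x. poly ?P x = 0} = {x. x ^ ?p = x}" by (auto simp: poly_monom)
  have "card {x :: 'a. x ^ ?p = x} \<le> ?p"
    using card_poly_roots_bound[OF P0] deg unfolding roots by linarith
  moreover have "card (of_nat ` {..<?p} :: 'a set) = ?p"
  proof -
    have "inj_on (of_nat :: nat \<Rightarrow> 'a) {..<?p}"
      by (rule inj_onI) (auto simp: of_nat_eq_iff_cong_CHAR cong_def)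
    then show ?thesis by (simp add: card_image)
  qed
  moreover have "of_nat ` {..<?p} \<subseteq> {x :: 'a. x ^ ?p = x}" using fx by auto
  ultimately have "of_nat ` {..<?p} = {x :: 'a. x ^ ?p = x}"
    by (intro card_seteq) auto
  then show ?thesis by blast
qed

text \<open>For a generator \<open>g\<close> of the multiplicative group, the conjugates of \<open>g\<close> under Frobenius are
  the roots of a polynomial over the prime field. Hence automorphisms permute them, and
  evaluation at \<open>g\<close> embeds the polynomials of degree less than \<open>m\<close> over the prime field.\<close>

lemma card_finite_field_auts:
  "CARD('a::{field,finite}) = CHAR('a) ^ card (field_auts :: ('a \<Rightarrow> 'a) set)"
proof -
  let ?p = "CHAR('a)"
  have p: "prime ?p" by (rule prime_CHAR_finite_field)
  have p1: "1 < ?p" using p prime_gt_1_nat by blast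
  obtain g :: 'a where g: "\<And>x. x \<noteq> 0 \<Longrightarrow> \<exists>i::nat. x = g ^ i"
    using finite_field_generator by blast
  define c where "c = (\<lambda>i::nat. g ^ (?p ^ i))"
  interpret frob: field_hom "\<lambda>x :: 'a. x ^ (?p ^ i)" for i by (rule field_hom_frobenius)
  have inj: "x = y" if "x ^ (?p ^ i) = y ^ (?p ^ i)" for x y :: 'a and i
    using that by (rule frob.injectivity)
  have c_Suc: "c (Suc i) = c i ^ ?p" for i by (simp add: c_def power_mult[symmetric] mult.commute)
  have c_add: "c (i + j) = c i ^ (?p ^ j)" for i j by (simp add: c_def power_mult[symmetric] power_add)
  \<comment> \<open>Two conjugates coincide because the field is finite; injectivity of the
    Frobenius powers then cancels the smaller index.\<close>
  have ex: "\<exists>m>0. c m = g"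
  proof -
    have "\<not> inj c" using finite_imageD[of c UNIV] by auto
    then obtain i j where ij: "i < j" "c i = c j" unfolding inj_def by (metis linorder_neqE_nat)
    have "c (j - i) ^ (?p ^ i) = g ^ (?p ^ i)"
      using ij c_add[of "j - i" i] by (simp add: c_def)
    then have "c (j - i) = g" by (rule inj)
    then show ?thesis using ij by (intro exI[of _ "j - i"]) simp
  qed
  define m where "m = (LEAST m. m > 0 \<and> c m = g)"
  have m: "0 < m" "c m = g" using LeastI_ex[OF ex] by (auto simp: m_def)
  have c_inj: "inj_on c {..<m}"
  proof -
    have "i = j" if "i \<le> j" "j < m" "c i = c j" for i j
    proof (rule ccontr)
      assume "i \<noteq> j"
      have "c (j - i) ^ (?p ^ i) = g ^ (?p ^ i)"
        using that c_add[of "j - i" i] by (simp add: c_def)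
      then have "c (j - i) = g" by (rule inj)
      then have "m \<le> j - i" unfolding m_def using that \<open>i \<noteq> j\<close> by (intro Least_le) auto
      then show False using that m by linarith
    qed
    then show ?thesis by (intro inj_onI) (metis lessThan_iff linorder_le_cases)
  qed
  have card_c: "card (c ` {..<m}) = m" using c_inj by (simp add: card_image)
  \<comment> \<open>Frobenius permutes the factors cyclically, since c m = c 0; hence it fixes the
    coefficients, which puts them in the prime field.\<close>
  define M where "M = (\<Prod>i<m. [:- c i, 1:])"
  have Mg: "poly M g = 0" and M_roots: "\<And>x. poly M x = 0 \<Longrightarrow> x \<in> c ` {..<m}"
  proof -
    have M: "poly M x = (\<Prod>i<m. x - c i)" for x by (simp add: M_def poly_prod)
    have "g = c 0" by (simp add: c_def)
    then have "\<exists>i\<in>{..<m}. g - c i = 0" using m(1) by (metis lessThan_iff right_minus_eq)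
    then show "poly M g = 0" unfolding M by (intro prod_zero) simp_all
    show "x \<in> c ` {..<m}" if x: "poly M x = 0" for x
    proof -
      from x obtain i where "i < m" "x - c i = 0" unfolding M by (auto simp: prod_zero_iff)
      then show ?thesis by simp
    qed
  qed
  have frobM: "map_poly (\<lambda>x. x ^ ?p) M = M"
  proof -
    interpret f1: field_hom "\<lambda>x :: 'a. x ^ ?p" using field_hom_frobenius[of 1] by simp
    interpret mp: map_poly_comm_ring_hom "\<lambda>x :: 'a. x ^ ?p" ..
    have "map_poly (\<lambda>x. x ^ ?p) M = (\<Prod>i<m. [:- c (Suc i), 1:])"
      unfolding M_def mp.hom_prod by (intro prod.cong refl) (simp add: c_Suc f1.hom_uminus map_poly_pCons)
    also have "\<dots> = (\<Prod>i\<in>Suc ` {..<m}. [:- c i, 1:])" by (simp add: prod.reindex)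
    also have "Suc ` {..<m} = insert m ({..<m} - {0})"
      unfolding image_Suc_lessThan using \<open>0 < m\<close> by auto
    also have "(\<Prod>i\<in>insert m ({..<m} - {0}). [:- c i, 1:]) = M"
    proof -
      have "c 0 = c m" using m by (simp add: c_def)
      then show ?thesis unfolding M_def using m(1) by (subst (2) prod.remove[of _ 0]) auto
    qed
    finally show ?thesis .
  qed
  have cfM: "Polynomial.coeff M i ^ ?p = Polynomial.coeff M i" for i
  proof -
    have "Polynomial.coeff (map_poly (\<lambda>x. x ^ ?p) M) i = Polynomial.coeff M i ^ ?p"
      using p1 by (subst coeff_map_poly) (auto simp: power_0_left)
    then show ?thesis using frobM by simp
  qed
  \<comment> \<open>A homomorphism fixes the images of the naturals, hence every coefficient of Q,
    and so commutes with evaluation of Q.\<close>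
  have root_image: "poly Q (h y) = h (poly Q y)" if "field_hom h" "\<And>i. Polynomial.coeff Q i ^ ?p = Polynomial.coeff Q i"
    for h :: "'a \<Rightarrow> 'a" and Q y
  proof -
    interpret h: field_hom h by fact
    have "h (of_nat k) = of_nat k" for k by (induction k) (simp_all add: h.hom_add)
    then have "h (Polynomial.coeff Q i) = Polynomial.coeff Q i" for i
      using that(2)[of i] unfolding frobenius_fixed_iff_of_nat by auto
    then show ?thesis by (simp add: poly_altdef h.hom_sum h.hom_mult h.hom_power)
  qed
  have zero_root: "h g \<in> c ` {..<m}" if "field_hom h" for h :: "'a \<Rightarrow> 'a"
  proof -
    interpret h: field_hom h by fact
    have "poly M (h g) = 0" using root_image[OF that cfM] Mg by simp
    then show ?thesis by (rule M_roots)
  qed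
  \<comment> \<open>An automorphism is determined by its value at the generator g. This value is one
    of the m conjugates, and powers of Frobenius attain all of them.\<close>
  have auts: "card (field_auts :: ('a \<Rightarrow> 'a) set) = m"
  proof -
    have "inj_on (\<lambda>h. h g) (field_auts :: ('a \<Rightarrow> 'a) set)"
    proof (rule inj_onI, rule ext)
      fix h h' :: "'a \<Rightarrow> 'a" and x assume h: "h \<in> field_auts" "h' \<in> field_auts" and eq: "h g = h' g"
      interpret h: field_hom h using h by (simp add: field_auts_def)
      interpret h': field_hom h' using h by (simp add: field_auts_def)
      show "h x = h' x"
      proof (cases "x = 0")
        case False
        then obtain i where "x = g ^ i" using g by blast
        then show ?thesis using eq by (simp add: h.hom_power h'.hom_power)
      qed simp
    qed
    moreover have "(\<lambda>h. h g) ` (field_auts :: ('a \<Rightarrow> 'a) set) = c ` {..<m}"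
    proof
      show "(\<lambda>h. h g) ` (field_auts :: ('a \<Rightarrow> 'a) set) \<subseteq> c ` {..<m}"
        using zero_root by (auto simp: field_auts_def)
      show "c ` {..<m} \<subseteq> (\<lambda>h. h g) ` (field_auts :: ('a \<Rightarrow> 'a) set)"
      proof clarify
        fix i
        have "bij (\<lambda>x :: 'a. x ^ (?p ^ i))"
          using inj by (intro finite_UNIV_inj_surj[THEN bijI[rotated]] injI) auto
        then have "(\<lambda>x :: 'a. x ^ (?p ^ i)) \<in> field_auts"
          using field_hom_frobenius[of i] by (simp add: field_auts_def)
        then show "c i \<in> (\<lambda>h. h g) ` (field_auts :: ('a \<Rightarrow> 'a) set)"
          by (auto simp: c_def image_iff)
      qed
    qed
    ultimately show ?thesis using card_c card_image by metis
  qed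
  \<comment> \<open>Since c m = g and the nonzero elements are powers of g, the polynomial X^(p^m) -
    X vanishes on the whole field; its degree bounds the size of the field.\<close>
  have "CARD('a) \<le> ?p ^ m"
  proof -
    have pm: "1 < ?p ^ m" by (rule one_less_power[OF p1 m(1)])
    have x: "x ^ (?p ^ m) = x" for x :: 'a
    proof (cases "x = 0")
      case True then show ?thesis using p1 pm by (simp add: power_0_left)
    next
      case False
      then obtain i where "x = g ^ i" using g by blast
      then have "x ^ (?p ^ m) = c m ^ i" by (simp add: c_def power_mult[symmetric] mult.commute)
      then show ?thesis using m \<open>x = g ^ i\<close> by simp
    qed
    let ?P = "Polynomial.monom 1 (?p ^ m) - Polynomial.monom 1 1 :: 'a poly"
    have "Polynomial.coeff ?P (?p ^ m) = 1" using pm by simp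
    then have P0: "?P \<noteq> 0" by (metis coeff_0 zero_neq_one)
    have "degree ?P \<le> ?p ^ m" by (intro degree_diff_le) (use pm in \<open>auto simp: degree_monom_eq\<close>)
    moreover have "{x. poly ?P x = 0} = UNIV" using x by (auto simp: poly_monom)
    ultimately show ?thesis using card_poly_roots_bound[OF P0] by simp
  qed
  moreover have "?p ^ m \<le> CARD('a)"
  proof -
    let ?K = "of_nat ` {..<?p} :: 'a set"
    define Q where "Q = (\<lambda>a :: nat \<Rightarrow> 'a. \<Sum>i<m. Polynomial.monom (a i) i)"
    have cQ: "Polynomial.coeff (Q a) i = (if i < m then a i else 0)" for a i
      by (simp add: Q_def coeff_sum)
    have "inj_on (\<lambda>a. poly (Q a) g) ({..<m} \<rightarrow>\<^sub>E ?K)"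
    proof (rule inj_onI)
      fix a b assume a: "a \<in> {..<m} \<rightarrow>\<^sub>E ?K" and b: "b \<in> {..<m} \<rightarrow>\<^sub>E ?K" and eq: "poly (Q a) g = poly (Q b) g"
      interpret f1: field_hom "\<lambda>x :: 'a. x ^ ?p" using field_hom_frobenius[of 1] by simp
      let ?D = "Q a - Q b"
      have "Polynomial.coeff ?D i ^ ?p = Polynomial.coeff ?D i" for i
      proof (cases "i < m")
        case True
        then have "a i ^ ?p = a i" "b i ^ ?p = b i"
          unfolding frobenius_fixed_iff_of_nat using a b by auto
        then show ?thesis using True by (simp add: cQ f1.hom_minus)
      qed (use p1 in \<open>simp add: cQ power_0_left\<close>)
      from root_image[OF field_hom_frobenius this, of g]
      have roots: "c ` {..<m} \<subseteq> {x. poly ?D x = 0}"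
        using eq p1 by (auto simp: c_def power_0_left)
      \<comment> \<open>The coefficients of \<open>?D\<close> lie in the prime field and g is a
        root, so all m conjugates of g are roots, too many for a degree below m.\<close>
      have "?D = 0"
      proof (rule ccontr)
        assume D: "?D \<noteq> 0"
        have "degree ?D \<le> m - 1" by (rule degree_le) (auto simp: cQ)
        moreover have "m \<le> card {x. poly ?D x = 0}"
          using card_mono[OF _ roots] card_c by simp
        ultimately show False using card_poly_roots_bound[OF D] m(1) by linarith
      qed
      then have "a i = b i" if "i < m" for i using cQ[of a i] cQ[of b i] that by simp
      then show "a = b" using a b by (intro PiE_ext[OF a b]) simp
    qed
    then have "card ({..<m} \<rightarrow>\<^sub>E ?K) \<le> CARD('a)" by (rule card_inj_on_le) auto
    moreover have "card ?K = ?p"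
      by (subst card_image) (auto intro!: inj_onI simp: of_nat_eq_iff_cong_CHAR cong_def)
    ultimately show ?thesis by (simp add: card_PiE)
  qed
  ultimately show ?thesis using auts by simp
qed

subsection \<open>Codes and their equivalences\<close>

abbreviation invp :: "(nat \<Rightarrow> nat) \<Rightarrow> nat \<Rightarrow> nat" where "invp \<equiv> inv_into UNIV"

lemma bij_betw_vec: "bij_betw (Matrix.vec n) (supported {..<n}) (carrier_vec n)"
  by (rule bij_betw_byWitness[where f' = "\<lambda>v i. if i < n then vec_index v i else 0"])
     (auto simp: supported_def fun_eq_iff)

lemma finite_carrier_vec: "finite (carrier_vec n :: 'a::{field,finite} Matrix.vec set)"
  using bij_betw_finite[OF bij_betw_vec[where 'a = 'a, of n]] by (simp add: supported_card)

lemma inj_on_vec_image: "inj_on ((`) (Matrix.vec n)) (Pow (supported {..<n}))"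
  using inj_on_image_Pow bij_betw_vec bij_betw_def by blast

lemma linear_codes_iff:
  fixes C :: "'a::{field,finite} Matrix.vec set"
  shows "C \<in> linear_codes TYPE('a) n \<longleftrightarrow> C \<subseteq> carrier_vec n \<and> 0\<^sub>v n \<in> C \<and>
    (\<forall>v\<in>C. \<forall>w\<in>C. v + w \<in> C) \<and> (\<forall>c. \<forall>v\<in>C. c \<cdot>\<^sub>v v \<in> C)"
  unfolding linear_codes_def VectorSpace.subspace_def submodule_def mem_Collect_eq
  using vec_vs[where 'a = 'a, of n] vec_module[where 'a = 'a, of n]
  by (auto simp: module_vec_simps class_ring_simps)

lemma linear_codes_eq:
  "linear_codes TYPE('a::{field,finite}) n =
     (`) (Matrix.vec n) ` {U. coord.subspace U \<and> U \<subseteq> supported {..<n}}"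
proof
  show "linear_codes TYPE('a) n \<subseteq> (`) (Matrix.vec n) ` {U. coord.subspace U \<and> U \<subseteq> supported {..<n}}"
  proof
    fix C assume "C \<in> linear_codes TYPE('a) n"
    note C = this[unfolded linear_codes_iff]
    let ?U = "{f \<in> supported {..<n}. Matrix.vec n f \<in> C}"
    have "Matrix.vec n ` ?U = C"
    proof
      show "C \<subseteq> Matrix.vec n ` ?U"
      proof
        fix v assume "v \<in> C"
        moreover from this obtain f where "v = Matrix.vec n f" "f \<in> supported {..<n}"
          using C bij_betw_vec[of n] unfolding bij_betw_def by blast
        ultimately show "v \<in> Matrix.vec n ` ?U" by blast
      qed
    qed auto
    moreover have "coord.subspace ?U"
      unfolding coord.subspace_def
    proof (intro conjI ballI allI)
      have "Matrix.vec n (0 :: nat \<Rightarrow> 'a) = 0\<^sub>v n" by auto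
      then show "0 \<in> ?U" using C coord.subspace_0[OF supported_subspace] by auto
    next
      fix f g assume f: "f \<in> ?U" "g \<in> ?U"
      have "Matrix.vec n (f + g) = Matrix.vec n f + Matrix.vec n g" by auto
      then show "f + g \<in> ?U" using C f coord.subspace_add[OF supported_subspace] by auto
    next
      fix c f assume f: "f \<in> ?U"
      have "Matrix.vec n (fscale c f) = c \<cdot>\<^sub>v Matrix.vec n f" by (auto simp: fscale_def)
      then show "fscale c f \<in> ?U" using C f coord.subspace_scale[OF supported_subspace] by auto
    qed
    ultimately show "C \<in> (`) (Matrix.vec n) ` {U. coord.subspace U \<and> U \<subseteq> supported {..<n}}" by blast
  qed
  show "(`) (Matrix.vec n) ` {U. coord.subspace U \<and> U \<subseteq> supported {..<n}} \<subseteq> linear_codes TYPE('a) n"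
  proof clarify
    fix U :: "(nat \<Rightarrow> 'a) set" assume U: "coord.subspace U" "U \<subseteq> supported {..<n}"
    show "Matrix.vec n ` U \<in> linear_codes TYPE('a) n"
      unfolding linear_codes_iff
    proof (intro conjI ballI allI)
      have "0\<^sub>v n = Matrix.vec n (0 :: nat \<Rightarrow> 'a)" by auto
      then show "0\<^sub>v n \<in> Matrix.vec n ` U" using coord.subspace_0[OF U(1)] by blast
    next
      fix v w assume "v \<in> Matrix.vec n ` U" "w \<in> Matrix.vec n ` U"
      then obtain f g where f: "f \<in> U" "g \<in> U" "v = Matrix.vec n f" "w = Matrix.vec n g" by blast
      then have "v + w = Matrix.vec n (f + g)" by auto
      then show "v + w \<in> Matrix.vec n ` U" using coord.subspace_add[OF U(1) f(1,2)] by blast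
    next
      fix c v assume "v \<in> Matrix.vec n ` U"
      then obtain f where f: "f \<in> U" "v = Matrix.vec n f" by blast
      then have "c \<cdot>\<^sub>v v = Matrix.vec n (fscale c f)" by (auto simp: fscale_def)
      then show "c \<cdot>\<^sub>v v \<in> Matrix.vec n ` U" using coord.subspace_scale[OF U(1) f(1)] by blast
    qed auto
  qed
qed

definition code_act :: "nat \<Rightarrow> (nat \<Rightarrow> nat) \<Rightarrow> (nat \<Rightarrow> 'a) \<Rightarrow> ('a \<Rightarrow> 'a) \<Rightarrow> 'a::field Matrix.vec \<Rightarrow> 'a Matrix.vec" where
  "code_act n \<pi> d \<sigma> = (\<lambda>v\<in>carrier_vec n. Matrix.vec n (\<lambda>i. d i * \<sigma> (vec_index v (\<pi> i))))"

lemma mono_paramsD: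
  assumes "(\<pi>, d) \<in> mono_params n"
  shows "\<pi> permutes {..<n}" "d i \<noteq> 0" "i \<ge> n \<Longrightarrow> d i = 1" "i < n \<Longrightarrow> \<pi> i < n"
  using assms permutes_in_image[of \<pi> "{..<n}" i] by (auto simp: mono_params_def)

lemma field_autsD:
  assumes "\<sigma> \<in> field_auts"
  shows "field_hom \<sigma>" "bij \<sigma>" "\<sigma> 0 = 0" "\<sigma> 1 = 1" "\<sigma> (x + y) = \<sigma> x + \<sigma> y" "\<sigma> (x * y) = \<sigma> x * \<sigma> y"
    "\<sigma> x = 0 \<longleftrightarrow> x = 0" "\<sigma> x = \<sigma> y \<longleftrightarrow> x = y"
proof -
  show "field_hom \<sigma>" "bij \<sigma>" using assms by (auto simp: field_auts_def)
  interpret field_hom \<sigma> by fact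
  show "\<sigma> 0 = 0" "\<sigma> 1 = 1" "\<sigma> (x + y) = \<sigma> x + \<sigma> y" "\<sigma> (x * y) = \<sigma> x * \<sigma> y" "\<sigma> x = 0 \<longleftrightarrow> x = 0"
    by (simp_all add: hom_add hom_mult)
  show "\<sigma> x = \<sigma> y \<longleftrightarrow> x = y" using \<open>bij \<sigma>\<close> by (simp add: bij_is_inj inj_eq)
qed

lemma id_field_aut: "id \<in> field_auts"
  unfolding field_auts_def by (auto intro!: field_hom.intro idom_hom.intro comm_ring_hom.intro ring_hom.intro
      semiring_hom.intro comm_monoid_add_hom.intro monoid_add_hom.intro monoid_mult_hom.intro; unfold_locales; simp)

lemma field_auts_comp:
  assumes "\<sigma> \<in> field_auts" "\<tau> \<in> field_auts"
  shows "\<sigma> \<circ> \<tau> \<in> field_auts"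
proof -
  have "field_hom (\<sigma> \<circ> \<tau>)"
    by unfold_locales (simp_all add: field_autsD[OF assms(1)] field_autsD[OF assms(2)])
  then show ?thesis using assms bij_comp by (auto simp: field_auts_def)
qed

lemma code_act_vec:
  assumes "(\<pi>, d) \<in> mono_params n"
  shows "code_act n \<pi> d \<sigma> (Matrix.vec n f) = Matrix.vec n (mono_act \<pi> d \<sigma> f)"
  using mono_paramsD(4)[OF assms] by (auto simp: code_act_def mono_act_def)

lemma code_act_image:
  assumes "(\<pi>, d) \<in> mono_params n"
  shows "code_act n \<pi> d \<sigma> ` Matrix.vec n ` U = Matrix.vec n ` mono_act \<pi> d \<sigma> ` U"
  unfolding image_image using code_act_vec[OF assms] by simp

lemma mono_act_supported:
  assumes "(\<pi>, d) \<in> mono_params n" "\<sigma> \<in> field_auts" "f \<in> supported {..<n}"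
  shows "mono_act \<pi> d \<sigma> f \<in> supported {..<n}"
  using assms mono_paramsD(1)[OF assms(1)] field_autsD(3)[OF assms(2)]
  by (auto simp: supported_def mono_act_def permutes_def)

lemma inj_mono_act:
  assumes "(\<pi>, d) \<in> mono_params n" "\<sigma> \<in> field_auts"
  shows "inj (mono_act \<pi> d \<sigma>)"
proof (rule injI, rule ext)
  fix f g i assume eq: "mono_act \<pi> d \<sigma> f = mono_act \<pi> d \<sigma> g"
  have "d (invp \<pi> i) * \<sigma> (f (\<pi> (invp \<pi> i))) = d (invp \<pi> i) * \<sigma> (g (\<pi> (invp \<pi> i)))"
    using fun_cong[OF eq, of "invp \<pi> i"] by (simp add: mono_act_def)
  then show "f i = g i"
    using mono_paramsD(2)[OF assms(1)] permutes_inverses(1)[OF mono_paramsD(1)[OF assms(1)]]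
      field_autsD(8)[OF assms(2)] by simp
qed

lemma mono_act_subspace:
  assumes P: "(\<pi>, d) \<in> mono_params n" "\<sigma> \<in> field_auts" and U: "coord.subspace U"
  shows "coord.subspace (mono_act \<pi> d \<sigma> ` U)"
  unfolding coord.subspace_def
proof (intro conjI ballI allI)
  have "0 = mono_act \<pi> d \<sigma> 0" by (simp add: mono_act_def fun_eq_iff field_autsD[OF P(2)])
  then show "0 \<in> mono_act \<pi> d \<sigma> ` U" using coord.subspace_0[OF U] by blast
next
  fix f g assume "f \<in> mono_act \<pi> d \<sigma> ` U" "g \<in> mono_act \<pi> d \<sigma> ` U"
  then obtain f' g' where f: "f' \<in> U" "g' \<in> U" "f = mono_act \<pi> d \<sigma> f'" "g = mono_act \<pi> d \<sigma> g'" by blast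
  then have "f + g = mono_act \<pi> d \<sigma> (f' + g')"
    by (simp add: mono_act_def fun_eq_iff field_autsD[OF P(2)] distrib_left)
  then show "f + g \<in> mono_act \<pi> d \<sigma> ` U" using coord.subspace_add[OF U f(1,2)] by blast
next
  fix c f assume "f \<in> mono_act \<pi> d \<sigma> ` U"
  then obtain f' where f: "f' \<in> U" "f = mono_act \<pi> d \<sigma> f'" by blast
  \<comment> \<open>Closure under scalars of a semilinear image rests on the surjectivity of
    \<open>\<sigma>\<close>.\<close>
  obtain c' where "c = \<sigma> c'" using field_autsD(2)[OF P(2)] by (metis bij_pointE)
  then have "fscale c f = mono_act \<pi> d \<sigma> (fscale c' f')"
    using f by (simp add: mono_act_def fscale_def fun_eq_iff field_autsD[OF P(2)])
  then show "fscale c f \<in> mono_act \<pi> d \<sigma> ` U" using coord.subspace_scale[OF U f(1)] by blast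
qed

lemma code_act_linear_codes:
  fixes d :: "nat \<Rightarrow> 'a::{field,finite}"
  assumes P: "(\<pi>, d) \<in> mono_params n" "\<sigma> \<in> field_auts" and C: "C \<in> linear_codes TYPE('a) n"
  shows "code_act n \<pi> d \<sigma> ` C \<in> linear_codes TYPE('a) n"
proof -
  obtain U where U: "coord.subspace U" "U \<subseteq> supported {..<n}" "C = Matrix.vec n ` U"
    using C unfolding linear_codes_eq by blast
  have "mono_act \<pi> d \<sigma> ` U \<subseteq> supported {..<n}" using U(2) mono_act_supported[OF P] by blast
  then show ?thesis
    unfolding U(3) code_act_image[OF P(1)] linear_codes_eq using mono_act_subspace[OF P U(1)] by blast
qed

lemma card_fixed_codes:
  fixes d :: "nat \<Rightarrow> 'a::{field,finite}"
  assumes P: "(\<pi>, d) \<in> mono_params n" "\<sigma> \<in> field_auts"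
  shows "card {C \<in> linear_codes TYPE('a) n. code_act n \<pi> d \<sigma> ` C = C} = num_fixed n (mono_act \<pi> d \<sigma>)"
proof -
  let ?g = "mono_act \<pi> d \<sigma>"
  let ?S = "{U. coord.subspace U \<and> U \<subseteq> supported {..<n} \<and> ?g ` U \<subseteq> U}"
  have fin: "finite U" if "U \<subseteq> supported {..<n}" for U :: "(nat \<Rightarrow> 'a) set"
    using that finite_subset supported_card(1)[of "{..<n}"] by blast
  have "{C \<in> linear_codes TYPE('a) n. code_act n \<pi> d \<sigma> ` C = C} = (`) (Matrix.vec n) ` ?S"
  proof -
    have iff: "code_act n \<pi> d \<sigma> ` Matrix.vec n ` U = Matrix.vec n ` U \<longleftrightarrow> ?g ` U \<subseteq> U"
      if U: "U \<subseteq> supported {..<n}" for U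
    proof -
      have "?g ` U \<in> Pow (supported {..<n})" using U mono_act_supported[OF P] by blast
      then have "code_act n \<pi> d \<sigma> ` Matrix.vec n ` U = Matrix.vec n ` U \<longleftrightarrow> ?g ` U = U"
        unfolding code_act_image[OF P(1)]
        by (intro inj_on_eq_iff[OF inj_on_vec_image]) (use U in auto)
      moreover have "?g ` U = U" if "?g ` U \<subseteq> U"
        using that card_image[OF inj_on_subset[OF inj_mono_act[OF P]], of U] fin[OF U]
        by (intro card_subset_eq) auto
      ultimately show ?thesis by auto
    qed
    have filter_image: "{C \<in> (`) (Matrix.vec n) ` A. Q C} = (`) (Matrix.vec n) ` {U \<in> A. Q (Matrix.vec n ` U)}"
      for A :: "(nat \<Rightarrow> 'a) set set" and Q by blast
    have "{U \<in> {U. coord.subspace U \<and> U \<subseteq> supported {..<n}}.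
        code_act n \<pi> d \<sigma> ` Matrix.vec n ` U = Matrix.vec n ` U} = ?S"
      by (simp add: iff conj_assoc cong: conj_cong)
    then show ?thesis unfolding linear_codes_eq filter_image by simp
  qed
  moreover have "inj_on ((`) (Matrix.vec n)) ?S"
    by (rule inj_on_subset[OF inj_on_vec_image]) blast
  ultimately show ?thesis by (simp add: card_image num_fixed_def)
qed

lemma code_act_Bij:
  fixes d :: "nat \<Rightarrow> 'a::{field,finite}"
  assumes P: "(\<pi>, d) \<in> mono_params n" "\<sigma> \<in> field_auts"
  shows "code_act n \<pi> d \<sigma> \<in> Bij (carrier_vec n)"
proof -
  let ?h = "code_act n \<pi> d \<sigma>"
  have sub: "?h ` carrier_vec n \<subseteq> carrier_vec n" by (auto simp: code_act_def)
  have "inj_on ?h (carrier_vec n)"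
  proof (rule inj_onI)
    fix v w assume v: "v \<in> carrier_vec n" "w \<in> carrier_vec n" and eq: "?h v = ?h w"
    obtain f g where f: "v = Matrix.vec n f" "f \<in> supported {..<n}" "w = Matrix.vec n g" "g \<in> supported {..<n}"
      using v bij_betw_vec[of n] unfolding bij_betw_def by blast
    have "Matrix.vec n (mono_act \<pi> d \<sigma> f) = Matrix.vec n (mono_act \<pi> d \<sigma> g)"
      using eq f code_act_vec[OF P(1)] by simp
    then have "mono_act \<pi> d \<sigma> f = mono_act \<pi> d \<sigma> g"
      using bij_betw_vec[of n] f mono_act_supported[OF P] unfolding bij_betw_def by (meson inj_onD)
    then show "v = w" using injD[OF inj_mono_act[OF P]] f by blast
  qed
  then have "bij_betw ?h (carrier_vec n) (carrier_vec n)"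
    using endo_inj_surj[OF finite_carrier_vec sub] by (simp add: bij_betw_def)
  then show ?thesis by (simp add: Bij_def code_act_def)
qed

section \<open>Groups of code maps and Burnside's lemma\<close>

lemma code_act_compose:
  assumes "(\<pi>, d) \<in> mono_params n" "(\<pi>', d') \<in> mono_params n" "\<sigma> \<in> field_auts"
  shows "compose (carrier_vec n) (code_act n \<pi> d \<sigma>) (code_act n \<pi>' d' \<sigma>') =
    code_act n (\<pi>' \<circ> \<pi>) (\<lambda>i. d i * \<sigma> (d' (\<pi> i))) (\<sigma> \<circ> \<sigma>')"
  using mono_paramsD(4)[OF assms(1)]
  by (auto simp: compose_def code_act_def fun_eq_iff field_autsD[OF assms(3)] mult.assoc)

text \<open>The parameters are read off by evaluation: the all-ones vector gives d, constant vectors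
  at coordinate 0 give \<open>\<sigma>\<close>, and a unit vector gives \<open>\<pi>\<close>. For n
  = 0 all automorphisms induce the same map, hence \<open>n \<ge> 1\<close>.\<close>

lemma inj_on_code_act:
  assumes "n \<ge> 1"
  shows "inj_on (\<lambda>((\<pi>, d), \<sigma>). code_act n \<pi> d \<sigma>)
    (mono_params n \<times> (field_auts :: ('a::field \<Rightarrow> 'a) set))"
proof (rule inj_onI)
  fix x y :: "((nat \<Rightarrow> nat) \<times> (nat \<Rightarrow> 'a)) \<times> ('a \<Rightarrow> 'a)"
  assume x: "x \<in> mono_params n \<times> field_auts" and y: "y \<in> mono_params n \<times> field_auts"
    and xy: "(\<lambda>((\<pi>, d), \<sigma>). code_act n \<pi> d \<sigma>) x = (\<lambda>((\<pi>, d), \<sigma>). code_act n \<pi> d \<sigma>) y"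
  obtain \<pi> d \<sigma> \<pi>' d' \<sigma>' where x': "x = ((\<pi>, d), \<sigma>)" and y': "y = ((\<pi>', d'), \<sigma>')" by (metis surj_pair)
  have P: "(\<pi>, d) \<in> mono_params n" "\<sigma> \<in> field_auts"
    and P': "(\<pi>', d') \<in> mono_params n" "\<sigma>' \<in> field_auts" and eq: "code_act n \<pi> d \<sigma> = code_act n \<pi>' d' \<sigma>'"
    using x y xy by (auto simp: x' y')
  have ev: "d i * \<sigma> (f (\<pi> i)) = d' i * \<sigma>' (f (\<pi>' i))" if "i < n" for i f
  proof -
    have "Matrix.vec n (mono_act \<pi> d \<sigma> f) = Matrix.vec n (mono_act \<pi>' d' \<sigma>' f)"
      using code_act_vec[OF P(1), of \<sigma> f] code_act_vec[OF P'(1), of \<sigma>' f] eq by simp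
    then have "vec_index (Matrix.vec n (mono_act \<pi> d \<sigma> f)) i = vec_index (Matrix.vec n (mono_act \<pi>' d' \<sigma>' f)) i" by simp
    then show ?thesis using that by (simp add: mono_act_def)
  qed
  have d: "d i = d' i" for i
    using ev[of i "\<lambda>_. 1"] field_autsD(4)[OF P(2)] field_autsD(4)[OF P'(2)]
      mono_paramsD(3)[OF P(1), of i] mono_paramsD(3)[OF P'(1), of i] by (cases "i < n") auto
  have \<sigma>: "\<sigma> x = \<sigma>' x" for x
    using ev[of 0 "\<lambda>_. x"] d[of 0] mono_paramsD(2)[OF P'(1)] assms by simp
  have "\<pi> i = \<pi>' i" for i
  proof (cases "i < n")
    case True
    show ?thesis
      using ev[OF True, of "\<lambda>j. if j = \<pi> i then 1 else 0"] mono_paramsD(2)[OF P(1), of i]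
        field_autsD(3,4)[OF P(2)] field_autsD(3,4)[OF P'(2)] by (auto split: if_splits)
  next
    case False
    then show ?thesis using mono_paramsD(1)[OF P(1)] mono_paramsD(1)[OF P'(1)] by (simp add: permutes_def)
  qed
  then show "x = y" using d \<sigma> by (auto simp: x' y' fun_eq_iff)
qed

text \<open>Left translation by an element of H is injective on the finite set H, hence onto. This
  yields the unit and the inverses, so closure under composition is all that needs checking for the
  code maps.\<close>

lemma finite_closed_subgroup:
  assumes "Group.group G" and H: "H \<subseteq> carrier G" "finite H" "H \<noteq> {}"
    and cl: "\<And>x y. x \<in> H \<Longrightarrow> y \<in> H \<Longrightarrow> x \<otimes>\<^bsub>G\<^esub> y \<in> H"
  shows "subgroup H G"
proof -
  interpret G: Group.group G by fact
  have surj: "\<exists>y\<in>H. a \<otimes>\<^bsub>G\<^esub> y = b" if "a \<in> H" "b \<in> H" for a b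
  proof -
    have "inj_on (\<lambda>y. a \<otimes>\<^bsub>G\<^esub> y) H"
      by (rule inj_onI) (metis G.Units_eq G.Units_l_cancel H(1) subsetD that(1))
    moreover have "(\<lambda>y. a \<otimes>\<^bsub>G\<^esub> y) ` H \<subseteq> H" using cl that by blast
    ultimately have "(\<lambda>y. a \<otimes>\<^bsub>G\<^esub> y) ` H = H" using endo_inj_surj[OF H(2)] by blast
    then show ?thesis using that by (metis imageE)
  qed
  have one: "\<one>\<^bsub>G\<^esub> \<in> H"
  proof -
    obtain a where a: "a \<in> H" using H(3) by blast
    then obtain y where y: "y \<in> H" "a \<otimes>\<^bsub>G\<^esub> y = a" using surj by blast
    then have "y = \<one>\<^bsub>G\<^esub>" using G.l_cancel_one[of a y] a H(1) by auto
    then show ?thesis using y by simp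
  qed
  show ?thesis
  proof (rule subgroup.intro)
    fix a assume a: "a \<in> H"
    then obtain y where y: "y \<in> H" "a \<otimes>\<^bsub>G\<^esub> y = \<one>\<^bsub>G\<^esub>" using surj[OF a one] by blast
    moreover from this have "y \<otimes>\<^bsub>G\<^esub> a = \<one>\<^bsub>G\<^esub>" using G.inv_comm a H(1) by blast
    ultimately have "inv\<^bsub>G\<^esub> a = y" using G.inv_equality a H(1) by blast
    then show "inv\<^bsub>G\<^esub> a \<in> H" using y by simp
  qed (use H one cl in auto)
qed

definition code_maps :: "nat \<Rightarrow> ((nat \<Rightarrow> nat) \<times> (nat \<Rightarrow> 'a)) set \<Rightarrow> ('a \<Rightarrow> 'a) set \<Rightarrow>
    ('a::field Matrix.vec \<Rightarrow> 'a Matrix.vec) set" where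
  "code_maps n P S = (\<lambda>((\<pi>, d), \<sigma>). code_act n \<pi> d \<sigma>) ` (P \<times> S)"

definition perm_params :: "nat \<Rightarrow> ((nat \<Rightarrow> nat) \<times> (nat \<Rightarrow> 'a::field)) set" where
  "perm_params n = {\<pi>. \<pi> permutes {..<n}} \<times> {\<lambda>_. 1}"

text \<open>Permutations act by precomposition, so they compose in reverse order.\<close>

definition composable :: "((nat \<Rightarrow> nat) \<times> (nat \<Rightarrow> 'a)) set \<Rightarrow> ('a::field \<Rightarrow> 'a) set \<Rightarrow> bool" where
  "composable P S \<longleftrightarrow> (\<forall>(\<pi>, d)\<in>P. \<forall>(\<pi>', d')\<in>P. \<forall>\<sigma>\<in>S. (\<pi>' \<circ> \<pi>, \<lambda>i. d i * \<sigma> (d' (\<pi> i))) \<in> P) \<and>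
     (\<forall>\<sigma>\<in>S. \<forall>\<tau>\<in>S. \<sigma> \<circ> \<tau> \<in> S)"

lemma perm_params_subset: "perm_params n \<subseteq> mono_params n"
  by (auto simp: perm_params_def mono_params_def)

lemma composable_perm: "composable (perm_params n) {id}"
  by (auto simp: composable_def perm_params_def intro: permutes_compose)

lemma composable_mono:
  assumes "S \<subseteq> (field_auts :: ('a::field \<Rightarrow> 'a) set)" "\<And>\<sigma> \<tau>. \<sigma> \<in> S \<Longrightarrow> \<tau> \<in> S \<Longrightarrow> \<sigma> \<circ> \<tau> \<in> S"
  shows "composable (mono_params n) S"
  unfolding composable_def
proof (intro conjI ballI, clarify)
  fix \<pi> \<pi>' :: "nat \<Rightarrow> nat" and d d' :: "nat \<Rightarrow> 'a" and \<sigma>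
  assume P: "(\<pi>, d) \<in> mono_params n" "(\<pi>', d') \<in> mono_params n" and "\<sigma> \<in> S"
  then have \<sigma>: "\<sigma> \<in> field_auts" using assms(1) by blast
  have "\<pi> i = i" if "i \<ge> n" for i using mono_paramsD(1)[OF P(1)] that by (simp add: permutes_def)
  then show "(\<pi>' \<circ> \<pi>, \<lambda>i. d i * \<sigma> (d' (\<pi> i))) \<in> mono_params n"
    using P permutes_compose[of \<pi> "{..<n}" \<pi>'] field_autsD(4,7)[OF \<sigma>] by (auto simp: mono_params_def)
qed (use assms(2) in blast)

lemma BijGroup_simps:
  "carrier (BijGroup X) = Bij X"
  "g \<in> Bij X \<Longrightarrow> h \<in> Bij X \<Longrightarrow> g \<otimes>\<^bsub>BijGroup X\<^esub> h = compose X g h"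
  by (simp_all add: BijGroup_def)

lemma code_maps_subset_Bij:
  assumes "P \<subseteq> (mono_params n :: (_ \<times> (nat \<Rightarrow> 'a::{field,finite})) set)" "S \<subseteq> field_auts"
  shows "code_maps n P S \<subseteq> Bij (carrier_vec n)"
proof
  fix h assume "h \<in> code_maps n P S"
  then obtain \<pi> d \<sigma> where "h = code_act n \<pi> d \<sigma>" "(\<pi>, d) \<in> P" "\<sigma> \<in> S"
    by (auto simp: code_maps_def)
  then show "h \<in> Bij (carrier_vec n)" using code_act_Bij[of \<pi> d n \<sigma>] assms by blast
qed

lemma finite_code_maps:
  assumes "P \<subseteq> (mono_params n :: (_ \<times> (nat \<Rightarrow> 'a::{field,finite})) set)"
  shows "finite P" "finite (code_maps n P S)"
proof -
  show "finite P" using finite_subset[OF assms card_mono_params(1)] .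
  then show "finite (code_maps n P S)" by (simp add: code_maps_def)
qed

lemma subgroup_code_maps:
  assumes P: "P \<subseteq> (mono_params n :: (_ \<times> (nat \<Rightarrow> 'a::{field,finite})) set)" "P \<noteq> {}"
    and S: "S \<subseteq> field_auts" "S \<noteq> {}" and c: "composable P S"
  shows "subgroup (code_maps n P S) (BijGroup (carrier_vec n))"
proof (rule finite_closed_subgroup)
  show "code_maps n P S \<subseteq> carrier (BijGroup (carrier_vec n))"
    unfolding BijGroup_simps by (rule code_maps_subset_Bij[OF P(1) S(1)])
  show "code_maps n P S \<noteq> {}" using P S by (auto simp: code_maps_def)
  fix x y assume xy: "x \<in> code_maps n P S" "y \<in> code_maps n P S"
  then obtain \<pi> d \<sigma> \<pi>' d' \<sigma>' where x: "x = code_act n \<pi> d \<sigma>" "(\<pi>, d) \<in> P" "\<sigma> \<in> S"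
    and y: "y = code_act n \<pi>' d' \<sigma>'" "(\<pi>', d') \<in> P" "\<sigma>' \<in> S"
    unfolding code_maps_def by auto
  have B: "x \<in> Bij (carrier_vec n)" "y \<in> Bij (carrier_vec n)"
    using xy code_maps_subset_Bij[OF P(1) S(1)] by blast+
  have eq: "x \<otimes>\<^bsub>BijGroup (carrier_vec n)\<^esub> y = code_act n (\<pi>' \<circ> \<pi>) (\<lambda>i. d i * \<sigma> (d' (\<pi> i))) (\<sigma> \<circ> \<sigma>')"
    unfolding BijGroup_simps(2)[OF B] unfolding x(1) y(1)
    by (rule code_act_compose) (use x(2,3) y(2,3) P S in auto)
  have "(\<pi>' \<circ> \<pi>, \<lambda>i. d i * \<sigma> (d' (\<pi> i))) \<in> P" "\<sigma> \<circ> \<sigma>' \<in> S"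
    using c x(2,3) y(2,3) unfolding composable_def by fast+
  then show "x \<otimes>\<^bsub>BijGroup (carrier_vec n)\<^esub> y \<in> code_maps n P S"
    unfolding code_maps_def eq
    by (intro image_eqI[of _ _ "((\<pi>' \<circ> \<pi>, \<lambda>i. d i * \<sigma> (d' (\<pi> i))), \<sigma> \<circ> \<sigma>')"]) simp_all
qed (use finite_code_maps[OF P(1)] group_BijGroup in auto)

lemma finite_linear_codes: "finite (linear_codes TYPE('a::{field,finite}) n)"
  by (rule finite_subset[of _ "Pow (carrier_vec n)"]) (auto simp: linear_codes_iff finite_carrier_vec)

text \<open>Burnside's lemma, summed over parameters in place of group elements;
  \<open>inj_on_code_act\<close> permits this. The multiplied-out form avoids division of
  naturals.\<close>

lemma num_code_orbits_burnside:
  fixes P :: "((nat \<Rightarrow> nat) \<times> (nat \<Rightarrow> 'a::{field,finite})) set"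
  assumes n: "n \<ge> 1" and P: "P \<subseteq> mono_params n" "P \<noteq> {}"
    and S: "S \<subseteq> field_auts" "S \<noteq> {}" and c: "composable P S"
  shows "num_code_orbits n (code_maps n P S) * (card P * card S) =
    (\<Sum>\<sigma>\<in>S. \<Sum>(\<pi>, d)\<in>P. num_fixed n (mono_act \<pi> d \<sigma>))"
proof -
  let ?X = "carrier_vec n :: 'a Matrix.vec set" and ?H = "code_maps n P S"
  let ?G = "BijGroup ?X\<lparr>carrier := ?H\<rparr>" and ?E = "linear_codes TYPE('a) n"
  \<comment> \<open>A \<open>group_action\<close> maps into \<open>BijGroup\<close>, whose elements
    are extensional; \<open>orb\<close> shows that the restriction leaves the orbits
    unchanged.\<close>
  let ?\<phi> = "\<lambda>g. restrict (\<lambda>C. g ` C) ?E"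
  have fin: "finite ?H" "finite P" using finite_code_maps[OF P(1)] by auto
  have grp: "Group.group ?G"
    using subgroup.subgroup_is_group[OF subgroup_code_maps[OF P S c] group_BijGroup] .
  have HB: "?H \<subseteq> Bij ?X" by (rule code_maps_subset_Bij[OF P(1) S(1)])
  have HE: "g ` C \<in> ?E" if g: "g \<in> ?H" and C: "C \<in> ?E" for g C
  proof -
    obtain \<pi> d \<sigma> where "g = code_act n \<pi> d \<sigma>" "(\<pi>, d) \<in> P" "\<sigma> \<in> S"
      using g by (auto simp: code_maps_def)
    then show ?thesis using code_act_linear_codes[of \<pi> d n \<sigma> C] P S C by blast
  qed
  have EX: "C \<subseteq> ?X" if "C \<in> ?E" for C using that by (simp add: linear_codes_iff)
  have Bij: "?\<phi> g \<in> Bij ?E" if g: "g \<in> ?H" for g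
  proof -
    have "inj_on g ?X" using g HB by (auto simp: Bij_def bij_betw_def)
    then have "inj_on ((`) g) ?E"
      by (intro inj_on_subset[OF inj_on_image_Pow]) (use EX in auto)
    moreover have "(`) g ` ?E \<subseteq> ?E" using HE g by blast
    ultimately have "bij_betw ((`) g) ?E ?E"
      using endo_inj_surj[OF finite_linear_codes] by (simp add: bij_betw_def)
    then show ?thesis by (auto simp: Bij_def bij_betw_def inj_on_def)
  qed
  have hom: "?\<phi> (g \<otimes>\<^bsub>?G\<^esub> h) = ?\<phi> g \<otimes>\<^bsub>BijGroup ?E\<^esub> ?\<phi> h" if g: "g \<in> ?H" and h: "h \<in> ?H" for g h
  proof -
    have "g \<otimes>\<^bsub>?G\<^esub> h = compose ?X g h" using BijGroup_simps(2)[of g ?X h] g h HB by auto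
    moreover have "compose ?X g h ` C = g ` h ` C" if "C \<in> ?E" for C
      using EX[OF that] by (auto simp: compose_def image_iff subset_iff)
    ultimately show ?thesis
      unfolding BijGroup_simps(2)[OF Bij[OF g] Bij[OF h]] using HE h
      by (auto simp: compose_def fun_eq_iff)
  qed
  interpret act: group_action ?G ?E ?\<phi>
    unfolding group_action_def group_hom_def group_hom_axioms_def hom_def
    using grp group_BijGroup Bij hom by (auto simp: BijGroup_simps(1))
  have orb: "orbits ?G ?E (\<lambda>g C. g ` C) = orbits ?G ?E ?\<phi>"
    unfolding orbits_def orbit_def by (intro Collect_cong ex_cong1) auto
  have inj: "inj_on (\<lambda>((\<pi>, d), \<sigma>). code_act n \<pi> d \<sigma>) (P \<times> S)"
    by (rule inj_on_subset[OF inj_on_code_act[OF n]]) (use P S in auto)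
  have "num_code_orbits n ?H * card ?H = (\<Sum>g\<in>?H. card (invariants ?E ?\<phi> g))"
    using act.burnside[OF _ finite_linear_codes] fin unfolding num_code_orbits_def orb by (simp add: Coset.order_def)
  also have "\<dots> = (\<Sum>g\<in>?H. card {C \<in> ?E. g ` C = C})"
    by (intro sum.cong refl arg_cong[where f = card]) (auto simp: invariants_def)
  also have "\<dots> = (\<Sum>((\<pi>, d), \<sigma>)\<in>P \<times> S. card {C \<in> ?E. code_act n \<pi> d \<sigma> ` C = C})"
    unfolding code_maps_def by (subst sum.reindex[OF inj]) (auto intro!: sum.cong)
  also have "\<dots> = (\<Sum>((\<pi>, d), \<sigma>)\<in>P \<times> S. num_fixed n (mono_act \<pi> d \<sigma>))"
  proof (rule sum.cong[OF refl], clarify)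
    fix \<pi> d \<sigma> assume "(\<pi>, d) \<in> P" "\<sigma> \<in> S"
    then show "card {C \<in> ?E. code_act n \<pi> d \<sigma> ` C = C} = num_fixed n (mono_act \<pi> d \<sigma>)"
      using card_fixed_codes[of \<pi> d n \<sigma>] P S by blast
  qed
  also have "\<dots> = (\<Sum>x\<in>P. \<Sum>\<sigma>\<in>S. num_fixed n (mono_act (fst x) (snd x) \<sigma>))"
    by (simp add: sum.cartesian_product case_prod_unfold)
  also have "\<dots> = (\<Sum>\<sigma>\<in>S. \<Sum>x\<in>P. num_fixed n (mono_act (fst x) (snd x) \<sigma>))" by (rule sum.swap)
  also have "card ?H = card P * card S"
    unfolding code_maps_def using card_image[OF inj] by (simp add: card_cartesian_product)
  finally show ?thesis by (simp add: case_prod_unfold)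
qed

subsection \<open>The three groups\<close>

lemma coord_perm_maps_eq: "coord_perm_maps n = code_maps n (perm_params n) {id}"
  by (auto simp: coord_perm_maps_def code_maps_def perm_params_def code_act_def image_iff)

text \<open>Column j has its 1 in row \<open>\<pi> j\<close>, so entry j moves to position
  \<open>\<pi> j\<close> and position i is read through the inverse.\<close>

lemma perm_mat_mult_vec:
  assumes \<pi>: "\<pi> permutes {..<n}" and v: "v \<in> carrier_vec n"
  shows "perm_mat n \<pi> *\<^sub>v v = Matrix.vec n (\<lambda>i. vec_index v (invp \<pi> i))"
proof (rule eq_vecI)
  fix i assume "i < dim_vec (Matrix.vec n (\<lambda>i. vec_index v (invp \<pi> i)))"
  then have i: "i < n" by simp
  have inv: "invp \<pi> i < n" using permutes_in_image[OF permutes_inv[OF \<pi>], of i] i by simp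
  have eq: "i = \<pi> j \<longleftrightarrow> j = invp \<pi> i" for j using permutes_inverses[OF \<pi>] by metis
  have "vec_index (perm_mat n \<pi> *\<^sub>v v) i = (\<Sum>j\<in>{0..<n}. (if i = \<pi> j then 1 else 0) * vec_index v j)"
    using i v by (simp add: perm_mat_def scalar_prod_def)
  also have "\<dots> = (\<Sum>j\<in>{0..<n}. if j = invp \<pi> i then vec_index v j else 0)"
    by (rule sum.cong) (auto simp: eq)
  also have "\<dots> = vec_index v (invp \<pi> i)" using inv by simp
  finally show "vec_index (perm_mat n \<pi> *\<^sub>v v) i = vec_index (Matrix.vec n (\<lambda>i. vec_index v (invp \<pi> i))) i"
    using i by simp
qed (simp add: perm_mat_def)

lemma diagonal_mult_vec:
  assumes D: "D \<in> carrier_mat n n" "diagonal_mat D" and v: "v \<in> carrier_vec n"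
  shows "D *\<^sub>v v = Matrix.vec n (\<lambda>i. D $$ (i, i) * vec_index v i)"
proof (rule eq_vecI)
  fix i assume "i < dim_vec (Matrix.vec n (\<lambda>i. D $$ (i, i) * vec_index v i))"
  then have i: "i < n" by simp
  have "vec_index (D *\<^sub>v v) i = (\<Sum>j\<in>{0..<n}. D $$ (i, j) * vec_index v j)"
    using i v D by (simp add: scalar_prod_def)
  also have "\<dots> = (\<Sum>j\<in>{0..<n}. if j = i then D $$ (i, i) * vec_index v i else 0)"
    by (rule sum.cong) (use i D in \<open>auto simp: diagonal_mat_def\<close>)
  finally show "vec_index (D *\<^sub>v v) i = vec_index (Matrix.vec n (\<lambda>i. D $$ (i, i) * vec_index v i)) i"
    using i by simp
qed (use D in simp)

lemma invertible_diagonal_iff: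
  fixes D :: "'a::field Matrix.mat"
  assumes D: "D \<in> carrier_mat n n" "diagonal_mat D"
  shows "invertible_mat D \<longleftrightarrow> (\<forall>i<n. D $$ (i, i) \<noteq> 0)"
proof -
  have mult: "(D * B) $$ (i, j) = D $$ (i, i) * B $$ (i, j)" if "B \<in> carrier_mat n n" "i < n" "j < n" for B i j
  proof -
    have "(D * B) $$ (i, j) = (\<Sum>k\<in>{0..<n}. D $$ (i, k) * B $$ (k, j))"
      using that D by (simp add: scalar_prod_def)
    also have "\<dots> = (\<Sum>k\<in>{0..<n}. if k = i then D $$ (i, i) * B $$ (i, j) else 0)"
      by (rule sum.cong) (use that D in \<open>auto simp: diagonal_mat_def\<close>)
    finally show ?thesis using that by simp
  qed
  show ?thesis
  proof
    assume "invertible_mat D"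
    then obtain B where B: "D * B = 1\<^sub>m n" "B * D = 1\<^sub>m (dim_row B)"
      using D by (auto simp: invertible_mat_def inverts_mat_def)
    \<comment> \<open>\<open>invertible_mat\<close> does not record the shape of B; it follows from
      the dimensions of the two products.\<close>
    have "dim_col (D * B) = n" "dim_col (B * D) = dim_row B" using B by auto
    then have Bc: "B \<in> carrier_mat n n" using D by auto
    show "\<forall>i<n. D $$ (i, i) \<noteq> 0"
    proof (intro allI impI)
      fix i assume i: "i < n"
      have "D $$ (i, i) * B $$ (i, i) = 1" using mult[OF Bc i i] B i by simp
      then show "D $$ (i, i) \<noteq> 0" by auto
    qed
  next
    assume nz: "\<forall>i<n. D $$ (i, i) \<noteq> 0"
    let ?B = "Matrix.mat n n (\<lambda>(i, j). if i = j then inverse (D $$ (i, i)) else 0)"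
    have Bc: "?B \<in> carrier_mat n n" by simp
    have "D * ?B = 1\<^sub>m n"
      by (rule eq_matI) (use mult[OF Bc] nz D in auto)
    moreover from this have "?B * D = 1\<^sub>m n"
      using mat_mult_left_right_inverse[OF D(1) Bc] by simp
    ultimately show "invertible_mat D"
      unfolding invertible_mat_def inverts_mat_def using D by (auto intro!: exI[of _ ?B])
  qed
qed

lemma monomial_maps_eq:
  "(monomial_maps n :: ('a::field Matrix.vec \<Rightarrow> 'a Matrix.vec) set) = code_maps n (mono_params n) {id}"
proof -
  have act: "(perm_mat n \<pi> * D) *\<^sub>v v = Matrix.vec n (\<lambda>i. D $$ (invp \<pi> i, invp \<pi> i) * vec_index v (invp \<pi> i))"
    if \<pi>: "\<pi> permutes {..<n}" and D: "D \<in> carrier_mat n n" "diagonal_mat D" and v: "v \<in> carrier_vec n"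
    for \<pi> and D :: "'a Matrix.mat" and v
  proof -
    have inv: "invp \<pi> i < n" if "i < n" for i
      using permutes_in_image[OF permutes_inv[OF \<pi>], of i] that by simp
    have "(perm_mat n \<pi> * D) *\<^sub>v v = perm_mat n \<pi> *\<^sub>v (D *\<^sub>v v)"
      by (rule assoc_mult_mat_vec[of _ n n _ n]) (use D v in \<open>auto simp: perm_mat_def\<close>)
    then show ?thesis
      using inv by (auto simp: diagonal_mult_vec[OF D v] perm_mat_mult_vec[OF \<pi>])
  qed
  show ?thesis
  proof
    show "(monomial_maps n :: ('a Matrix.vec \<Rightarrow> _) set) \<subseteq> code_maps n (mono_params n) {id}"
    proof
      fix h :: "'a Matrix.vec \<Rightarrow> _" assume "h \<in> monomial_maps n"
      then obtain \<pi> and D :: "'a Matrix.mat" where \<pi>: "\<pi> permutes {..<n}"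
        and D: "D \<in> carrier_mat n n" "diagonal_mat D" "invertible_mat D"
        and h: "h = restrict (\<lambda>v. (perm_mat n \<pi> * D) *\<^sub>v v) (carrier_vec n)"
        by (auto simp: monomial_maps_def monomial_mats_def)
      let ?d = "\<lambda>i. if i < n then D $$ (invp \<pi> i, invp \<pi> i) else 1"
      have inv: "invp \<pi> i < n" if "i < n" for i
        using permutes_in_image[OF permutes_inv[OF \<pi>], of i] that by simp
      have "(invp \<pi>, ?d) \<in> mono_params n"
        using permutes_inv[OF \<pi>] D(3)[unfolded invertible_diagonal_iff[OF D(1,2)]] inv
        by (auto simp: mono_params_def)
      moreover have "h = code_act n (invp \<pi>) ?d id"
        unfolding h code_act_def by (rule restrict_ext) (auto simp: act[OF \<pi> D(1,2)])
      ultimately show "h \<in> code_maps n (mono_params n) {id}" by (force simp: code_maps_def)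
    qed
    show "code_maps n (mono_params n) {id} \<subseteq> (monomial_maps n :: ('a Matrix.vec \<Rightarrow> _) set)"
    proof
      fix h :: "'a Matrix.vec \<Rightarrow> _" assume "h \<in> code_maps n (mono_params n) {id}"
      then obtain \<pi> d where P: "(\<pi>, d) \<in> mono_params n" and h: "h = code_act n \<pi> d id"
        by (auto simp: code_maps_def)
      note \<pi> = mono_paramsD(1)[OF P]
      \<comment> \<open>The matrix product scales by the old position of an entry,
        \<open>code_act\<close> by the new one; hence the relabelling of d by the inverse.\<close>
      let ?D = "Matrix.mat n n (\<lambda>(i, j). if i = j then d (invp \<pi> i) else 0)"
      have D: "?D \<in> carrier_mat n n" "diagonal_mat ?D" by (auto simp: diagonal_mat_def)
      have "invertible_mat ?D"
        unfolding invertible_diagonal_iff[OF D] using mono_paramsD(2)[OF P] by simp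
      then have "perm_mat n (invp \<pi>) * ?D \<in> monomial_mats n"
        using permutes_inv[OF \<pi>] D unfolding monomial_mats_def by blast
      moreover have "h = restrict (\<lambda>v. (perm_mat n (invp \<pi>) * ?D) *\<^sub>v v) (carrier_vec n)"
        unfolding h code_act_def using mono_paramsD(4)[OF P]
        by (intro restrict_ext) (auto simp: act[OF permutes_inv[OF \<pi>] D] permutes_inv_inv[OF \<pi>] permutes_inverses[OF \<pi>])
      ultimately show "h \<in> monomial_maps n" unfolding monomial_maps_def by blast
    qed
  qed
qed

lemma id_one_mono_params: "(id, \<lambda>_. 1) \<in> mono_params n"
  by (auto simp: mono_params_def permutes_id)

text \<open>One inclusion holds because the right side is a subgroup containing the generators, the
  other because each of its elements is an entrywise automorphism followed by a monomial
  map.\<close>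

lemma generate_semilinear_maps:
  "generate (BijGroup (carrier_vec n)) (monomial_maps n \<union> field_aut_maps n :: ('a::{field,finite} Matrix.vec \<Rightarrow> _) set)
    = code_maps n (mono_params n) field_auts"
proof
  let ?G = "BijGroup (carrier_vec n) :: ('a Matrix.vec \<Rightarrow> 'a Matrix.vec) monoid"
  have fa: "(field_aut_maps n :: ('a Matrix.vec \<Rightarrow> _) set) = code_maps n {(id, \<lambda>_. 1)} field_auts"
  proof -
    have "restrict (map_vec \<sigma>) (carrier_vec n) = code_act n id (\<lambda>_. 1) \<sigma>" for \<sigma> :: "'a \<Rightarrow> 'a"
      unfolding code_act_def by (rule restrict_ext) auto
    moreover have "code_maps n {(id, \<lambda>_. 1)} field_auts = code_act n id (\<lambda>_. 1) ` (field_auts :: ('a \<Rightarrow> 'a) set)"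
      unfolding code_maps_def by force
    ultimately show ?thesis unfolding field_aut_maps_def by auto
  qed
  have sub: "subgroup (code_maps n (mono_params n) field_auts) ?G"
    by (rule subgroup_code_maps)
       (use id_one_mono_params[of n] id_field_aut field_auts_comp composable_mono[of field_auts] in auto)
  have "monomial_maps n \<union> field_aut_maps n \<subseteq> code_maps n (mono_params n) (field_auts :: ('a \<Rightarrow> 'a) set)"
    unfolding monomial_maps_eq fa code_maps_def
    using id_one_mono_params[of n] id_field_aut by (intro Un_least image_mono Sigma_mono) auto
  then show "generate ?G (monomial_maps n \<union> field_aut_maps n) \<subseteq> code_maps n (mono_params n) field_auts"
    by (rule group.generate_subgroup_incl[OF group_BijGroup _ sub])
  show "code_maps n (mono_params n) field_auts \<subseteq> generate ?G (monomial_maps n \<union> field_aut_maps n)"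
  proof
    fix h :: "'a Matrix.vec \<Rightarrow> _" assume "h \<in> code_maps n (mono_params n) field_auts"
    then obtain \<pi> d \<sigma> where P: "(\<pi>, d) \<in> mono_params n" "\<sigma> \<in> field_auts" and h: "h = code_act n \<pi> d \<sigma>"
      by (auto simp: code_maps_def)
    let ?x = "code_act n \<pi> d id" and ?y = "code_act n id (\<lambda>_. 1) \<sigma>"
    have "?x \<in> monomial_maps n" "?y \<in> field_aut_maps n"
      using P by (force simp: monomial_maps_eq fa code_maps_def)+
    then have "?x \<otimes>\<^bsub>?G\<^esub> ?y \<in> generate ?G (monomial_maps n \<union> field_aut_maps n)"
      by (intro generate.eng generate.incl) auto
    also have "?x \<otimes>\<^bsub>?G\<^esub> ?y = h"
      unfolding BijGroup_simps(2)[OF code_act_Bij[OF P(1) id_field_aut] code_act_Bij[OF id_one_mono_params P(2)]]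
        code_act_compose[OF P(1) id_one_mono_params id_field_aut] h by simp
    finally show "h \<in> generate ?G (monomial_maps n \<union> field_aut_maps n)" .
  qed
qed

subsection \<open>Orbit counts\<close>

lemma min_mismatch_eq_0:
  fixes d :: "nat \<Rightarrow> 'a::finite"
  assumes "min_mismatch n \<pi> d = 0"
  obtains c where "\<And>i. i < n \<Longrightarrow> \<pi> i = i \<and> d i = c"
proof -
  obtain c where "mismatch n \<pi> d c = 0" using assms ex_min_mismatch[of n \<pi> d] by auto
  then have "{i. i < n \<and> \<not> (\<pi> i = i \<and> d i = c)} = {}" by (simp add: mismatch_def)
  then show ?thesis using that by blast
qed

lemma min_mismatch_scalar:
  fixes d :: "nat \<Rightarrow> 'a::finite"
  assumes "\<And>i. i < n \<Longrightarrow> \<pi> i = i \<and> d i = c"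
  shows "min_mismatch n \<pi> d = 0"
proof -
  have "mismatch n \<pi> d c = 0" using assms by (simp add: mismatch_def)
  then show ?thesis using min_mismatch_le[of n \<pi> d c] by simp
qed

lemma num_fixed_scalar:
  fixes d :: "nat \<Rightarrow> 'a::{field,finite}"
  assumes P: "(\<pi>, d) \<in> mono_params n" and m: "min_mismatch n \<pi> d = 0"
  shows "num_fixed n (mono_act \<pi> d id) = num_subspaces TYPE('a) n"
proof -
  obtain c where c: "\<And>i. i < n \<Longrightarrow> \<pi> i = i \<and> d i = c" using min_mismatch_eq_0[OF m] by blast
  have act: "mono_act \<pi> d id f = fscale c f" if "f \<in> supported {..<n}" for f
  proof
    fix i
    show "mono_act \<pi> d id f i = fscale c f i"
    proof (cases "i < n")
      case False
      then have "\<pi> i = i" using mono_paramsD(1)[OF P] by (simp add: permutes_def)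
      then show ?thesis using False that by (simp add: mono_act_def fscale_def supported_def)
    qed (use c in \<open>simp add: mono_act_def fscale_def\<close>)
  qed
  have "mono_act \<pi> d id ` U \<subseteq> U" if "coord.subspace U" "U \<subseteq> supported {..<n}" for U
    using act that coord.subspace_scale by (metis image_subsetI subsetD)
  then show ?thesis unfolding num_fixed_def num_subspaces_def by metis
qed

lemma card_scalar_perm: "card {(\<pi>, d :: nat \<Rightarrow> 'a::{field,finite}) \<in> perm_params n. min_mismatch n \<pi> d = 0} = 1"
proof -
  have "{(\<pi>, d :: nat \<Rightarrow> 'a) \<in> perm_params n. min_mismatch n \<pi> d = 0} = {(id, \<lambda>_. 1)}"
  proof (intro equalityI subsetI)
    fix x assume "x \<in> {(\<pi>, d :: nat \<Rightarrow> 'a) \<in> perm_params n. min_mismatch n \<pi> d = 0}"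
    then obtain \<pi> where x: "x = (\<pi>, \<lambda>_. 1)" "\<pi> permutes {..<n}" "min_mismatch n \<pi> (\<lambda>_. 1 :: 'a) = 0"
      by (auto simp: perm_params_def)
    obtain c where "\<And>i. i < n \<Longrightarrow> \<pi> i = i \<and> (1 :: 'a) = c" using min_mismatch_eq_0[OF x(3)] by blast
    then have "\<pi> i = i" for i using x(2) by (cases "i < n") (auto simp: permutes_def)
    then show "x \<in> {(id, \<lambda>_. 1)}" using x(1) by (auto simp: fun_eq_iff)
  qed (auto simp: perm_params_def permutes_id intro: min_mismatch_scalar)
  then show ?thesis by simp
qed

text \<open>For n = 0 there is only one parameter pair; \<open>n \<ge> 1\<close> keeps the q - 1
  scalars distinct.\<close>

lemma card_scalar_mono:
  assumes n: "n \<ge> 1"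
  shows "card {(\<pi>, d :: nat \<Rightarrow> 'a::{field,finite}) \<in> mono_params n. min_mismatch n \<pi> d = 0} = CARD('a) - 1"
proof -
  let ?f = "\<lambda>c :: 'a. (id :: nat \<Rightarrow> nat, \<lambda>i. if i < n then c else 1)"
  have "{(\<pi>, d :: nat \<Rightarrow> 'a) \<in> mono_params n. min_mismatch n \<pi> d = 0} = ?f ` (UNIV - {0})"
  proof (intro equalityI subsetI)
    fix x assume "x \<in> {(\<pi>, d :: nat \<Rightarrow> 'a) \<in> mono_params n. min_mismatch n \<pi> d = 0}"
    then obtain \<pi> and d :: "nat \<Rightarrow> 'a" where x: "x = (\<pi>, d)" and P: "(\<pi>, d) \<in> mono_params n"
      and m: "min_mismatch n \<pi> d = 0" by auto
    obtain c where c: "\<And>i. i < n \<Longrightarrow> \<pi> i = i \<and> d i = c" using min_mismatch_eq_0[OF m] by blast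
    have "\<pi> = id"
    proof
      fix i show "\<pi> i = id i" using c mono_paramsD(1)[OF P] by (cases "i < n") (auto simp: permutes_def)
    qed
    moreover have "d = (\<lambda>i. if i < n then c else 1)" using c mono_paramsD(3)[OF P] by (auto simp: fun_eq_iff)
    moreover have "c \<noteq> 0" using c[of 0] mono_paramsD(2)[OF P, of 0] n by auto
    ultimately show "x \<in> ?f ` (UNIV - {0})" unfolding x by blast
  next
    fix x assume "x \<in> ?f ` (UNIV - {0})"
    then obtain c where c: "c \<noteq> 0" "x = ?f c" by blast
    have "min_mismatch n id (\<lambda>i. if i < n then c else 1) = 0" by (rule min_mismatch_scalar) auto
    then show "x \<in> {(\<pi>, d :: nat \<Rightarrow> 'a) \<in> mono_params n. min_mismatch n \<pi> d = 0}"
      using c by (auto simp: mono_params_def permutes_id)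
  qed
  moreover have "inj_on ?f (UNIV - {0})"
  proof (rule inj_onI)
    fix a b assume "?f a = ?f b"
    then have "snd (?f a) 0 = snd (?f b) 0" by (rule arg_cong)
    then show "a = b" using n by simp
  qed
  ultimately show ?thesis by (simp add: card_image card_Diff_subset)
qed

lemma card_perm_params: "card (perm_params n :: (_ \<times> (nat \<Rightarrow> 'a::field)) set) = fact n"
  by (simp add: perm_params_def card_cartesian_product card_permutations)

text \<open>The sum splits into the scalar maps, which form the lower bound, the other linear maps,
  and the maps with a nontrivial automorphism. Both error terms are those of the full semilinear
  group, so one estimate serves all three groups.\<close>

lemma sum_num_fixed_bounds:
  fixes P :: "((nat \<Rightarrow> nat) \<times> (nat \<Rightarrow> 'a::{field,finite})) set"
  assumes P: "P \<subseteq> mono_params n" and S: "S \<subseteq> field_auts" "id \<in> S" and n: "n \<ge> 80"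
  defines "Z \<equiv> {(\<pi>, d) \<in> P. min_mismatch n \<pi> d = 0}"
  defines "T \<equiv> (\<Sum>\<sigma>\<in>S. \<Sum>(\<pi>, d)\<in>P. real (num_fixed n (mono_act \<pi> d \<sigma>)))"
  shows "real (card Z) * real (num_subspaces TYPE('a) n) \<le> T"
    and "T \<le> real (card Z) * real (num_subspaces TYPE('a) n) +
      (linear_error (real CARD('a)) n + real (card (field_auts :: ('a \<Rightarrow> 'a) set)) * semilinear_error (real CARD('a)) n) *
      real CARD('a) powr ((real n)\<^sup>2 / 4)"
proof -
  let ?F = "\<lambda>\<sigma> x. real (num_fixed n (mono_act (fst x) (snd x) \<sigma>))"
  let ?Q = "real CARD('a) powr ((real n)\<^sup>2 / 4)" and ?q = "real CARD('a)"
  have fin: "finite P" "finite S" using finite_subset[OF P card_mono_params(1)] by auto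
  have q2: "2 \<le> ?q" using coord.real_q_ge_2[where 'a = 'a] .
  have phi: "phi (1 / ?q) > 0" using phi_LIMSEQ(2)[of "1 / ?q"] q2 by simp
  have sl0: "0 \<le> semilinear_error ?q n" unfolding semilinear_error_def using phi q2 by simp
  have T: "T = (\<Sum>x\<in>P. ?F id x) + (\<Sum>\<sigma>\<in>S - {id}. \<Sum>x\<in>P. ?F \<sigma> x)"
    unfolding T_def by (subst sum.remove[OF fin(2) S(2)]) (simp add: case_prod_unfold)
  have ZP: "Z \<subseteq> P" "P - Z = {(\<pi>, d) \<in> P. min_mismatch n \<pi> d \<noteq> 0}" by (auto simp: Z_def)
  have "(\<Sum>x\<in>Z. ?F id x) = (\<Sum>x\<in>Z. real (num_subspaces TYPE('a) n))"
  proof (rule sum.cong[OF refl])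
    fix x assume "x \<in> Z"
    then have "(fst x, snd x) \<in> mono_params n" "min_mismatch n (fst x) (snd x) = 0"
      using P by (auto simp: Z_def)
    then show "?F id x = real (num_subspaces TYPE('a) n)" using num_fixed_scalar by metis
  qed
  then have id: "(\<Sum>x\<in>P. ?F id x) = real (card Z) * real (num_subspaces TYPE('a) n) + (\<Sum>x\<in>P - Z. ?F id x)"
    using sum.subset_diff[OF ZP(1) fin(1), of "?F id"] by simp
  have "0 \<le> (\<Sum>x\<in>P - Z. ?F id x)" "0 \<le> (\<Sum>\<sigma>\<in>S - {id}. \<Sum>x\<in>P. ?F \<sigma> x)"
    by (intro sum_nonneg; simp)+
  then show "real (card Z) * real (num_subspaces TYPE('a) n) \<le> T" unfolding T id by linarith
  have 1: "(\<Sum>x\<in>P - Z. ?F id x) \<le> linear_error ?q n * ?Q"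
    using sum_num_fixed_linear_le[OF P n] unfolding ZP(2) by (simp add: case_prod_unfold)
  have "(\<Sum>\<sigma>\<in>S - {id}. \<Sum>x\<in>P. ?F \<sigma> x) \<le> (\<Sum>\<sigma>\<in>S - {id}. semilinear_error ?q n * ?Q)"
  proof (rule sum_mono)
    fix \<sigma> assume "\<sigma> \<in> S - {id}"
    then have \<sigma>: "\<sigma> \<in> field_auts" "\<sigma> \<noteq> id" using S by auto
    have "(\<Sum>x\<in>P. ?F \<sigma> x) \<le> (\<Sum>x\<in>mono_params n. ?F \<sigma> x)"
      by (rule sum_mono2) (use P card_mono_params(1) in auto)
    also have "\<dots> \<le> semilinear_error ?q n * ?Q"
      using sum_num_fixed_semilinear_le[OF \<sigma> n] by (simp add: case_prod_unfold)
    finally show "(\<Sum>x\<in>P. ?F \<sigma> x) \<le> semilinear_error ?q n * ?Q" .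
  qed
  also have "\<dots> = real (card (S - {id})) * (semilinear_error ?q n * ?Q)" by simp
  also have "\<dots> \<le> real (card (field_auts :: ('a \<Rightarrow> 'a) set)) * (semilinear_error ?q n * ?Q)"
  proof (rule mult_right_mono)
    show "real (card (S - {id})) \<le> real (card (field_auts :: ('a \<Rightarrow> 'a) set))"
      unfolding of_nat_le_iff by (rule card_mono) (use S in auto)
  qed (use sl0 in simp)
  finally have 2: "(\<Sum>\<sigma>\<in>S - {id}. \<Sum>x\<in>P. ?F \<sigma> x) \<le> real (card (field_auts :: ('a \<Rightarrow> 'a) set)) * (semilinear_error ?q n * ?Q)" .
  show "T \<le> real (card Z) * real (num_subspaces TYPE('a) n) +
      (linear_error ?q n + real (card (field_auts :: ('a \<Rightarrow> 'a) set)) * semilinear_error ?q n) * ?Q"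
    unfolding T id using 1 2 by (simp add: algebra_simps)
qed

text \<open>Covers all three groups and both parities; z is the number of scalars in the group. The
  orbit count times the group order, divided by q^(n^2/4), is squeezed between z times the
  normalised number of subspaces and the same plus a null sequence. Prescribing h only eventually
  leaves room for truncated exponents at small k.\<close>

lemma num_code_orbits_asymp:
  fixes P :: "nat \<Rightarrow> ((nat \<Rightarrow> nat) \<times> (nat \<Rightarrow> 'a::{field,finite})) set"
  assumes P: "\<And>n. P n \<subseteq> mono_params n" "\<And>n. card (P n) > 0"
    and S: "S \<subseteq> field_auts" "id \<in> S" and c: "\<And>n. composable (P n) S"
    and z: "\<And>n. n \<ge> 1 \<Longrightarrow> card {(\<pi>, d) \<in> P n. min_mismatch n \<pi> d = 0} = z" "z > 0" and e: "e \<le> 1"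
    and h: "\<forall>\<^sub>F k in sequentially. h k =
      real z * real CARD('a) powr ((real (2 * k + e))\<^sup>2 / 4) / (real (card (P (2 * k + e))) * real (card S))"
  shows "(\<lambda>k. real (num_code_orbits (2 * k + e) (code_maps (2 * k + e) (P (2 * k + e)) S))) \<sim>[at_top]
    (\<lambda>k. theta_half e (inverse (real CARD('a))) / phi (inverse (real CARD('a))) * h k)"
proof -
  let ?q = "real CARD('a)" and ?n = "\<lambda>k. 2 * k + e"
  let ?Q = "\<lambda>n. ?q powr ((real n)\<^sup>2 / 4)"
  let ?N = "\<lambda>n. real (num_code_orbits n (code_maps n (P n) S))"
  let ?w = "\<lambda>n. real (card (P n)) * real (card S)"
  let ?err = "\<lambda>n. linear_error ?q n + real (card (field_auts :: ('a \<Rightarrow> 'a) set)) * semilinear_error ?q n"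
  let ?L = "theta_half e (inverse ?q) / phi (inverse ?q)"
  have q2: "2 \<le> ?q" using coord.real_q_ge_2[where 'a = 'a] .
  have x: "0 < inverse ?q" "inverse ?q < 1" using q2 by (auto simp: field_simps)
  have L: "0 < ?L" using theta_half_pos[OF x e] phi_LIMSEQ(2)[OF x] by simp
  have "0 < card S" using S(2) by (auto simp: card_gt_0_iff)
  then have w0: "0 < ?w n" for n using P(2)[of n] by simp
  have zL: "0 < real z * ?L" using L z(2) by (intro mult_pos_pos) simp_all
  have Q0: "0 < ?Q n" for n using q2 by simp
  have err: "?err \<longlonglongrightarrow> 0"
    using tendsto_add[OF linear_error_tendsto_0[OF q2] tendsto_mult_right_zero[OF semilinear_error_tendsto_0[OF q2]]] by simp
  have bounds: "real z * (real (num_subspaces TYPE('a) n) / ?Q n) \<le> ?N n * ?w n / ?Q n"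
    "?N n * ?w n / ?Q n \<le> real z * (real (num_subspaces TYPE('a) n) / ?Q n) + ?err n" if n: "n \<ge> 80" for n
  proof -
    have n1: "n \<ge> 1" using n by simp
    have ne: "P n \<noteq> {}" "S \<noteq> {}" using P(2)[of n] S by auto
    have "?N n * ?w n = real (num_code_orbits n (code_maps n (P n) S) * (card (P n) * card S))" by simp
    also have "\<dots> = (\<Sum>\<sigma>\<in>S. \<Sum>(\<pi>, d)\<in>P n. real (num_fixed n (mono_act \<pi> d \<sigma>)))"
      unfolding num_code_orbits_burnside[OF n1 P(1) ne(1) S(1) ne(2) c] by (simp add: case_prod_unfold)
    finally have N: "?N n * ?w n = (\<Sum>\<sigma>\<in>S. \<Sum>(\<pi>, d)\<in>P n. real (num_fixed n (mono_act \<pi> d \<sigma>)))" .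
    note b = sum_num_fixed_bounds[OF P(1) S n, unfolded z(1)[OF n1], folded N]
    show "real z * (real (num_subspaces TYPE('a) n) / ?Q n) \<le> ?N n * ?w n / ?Q n"
      using divide_right_mono[OF b(1), of "?Q n"] Q0[of n] by simp
    have "?N n * ?w n / ?Q n \<le> (real z * real (num_subspaces TYPE('a) n) + ?err n * ?Q n) / ?Q n"
      using divide_right_mono[OF b(2), of "?Q n"] Q0[of n] by simp
    also have "\<dots> = real z * (real (num_subspaces TYPE('a) n) / ?Q n) + ?err n"
      using Q0[of n] by (simp add: add_divide_distrib)
    finally show "?N n * ?w n / ?Q n \<le> real z * (real (num_subspaces TYPE('a) n) / ?Q n) + ?err n" .
  qed
  have sub: "filterlim ?n at_top sequentially" by real_asymp
  have G: "(\<lambda>k. real z * (real (num_subspaces TYPE('a) (?n k)) / ?Q (?n k))) \<longlonglongrightarrow> real z * ?L"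
    using num_subspaces_limit[OF e, where 'a = 'a] by (intro tendsto_mult_left) (simp add: inverse_eq_divide)
  have ge: "\<forall>\<^sub>F k in sequentially. ?n k \<ge> 80" using eventually_ge_at_top[of 80] by eventually_elim simp
  have "(\<lambda>k. ?N (?n k) * ?w (?n k) / ?Q (?n k)) \<longlonglongrightarrow> real z * ?L"
  proof (rule tendsto_sandwich[OF _ _ G])
    show "(\<lambda>k. real z * (real (num_subspaces TYPE('a) (?n k)) / ?Q (?n k)) + ?err (?n k)) \<longlonglongrightarrow> real z * ?L"
      using tendsto_add[OF G filterlim_compose[OF err sub]] by simp
    show "\<forall>\<^sub>F k in sequentially. real z * (real (num_subspaces TYPE('a) (?n k)) / ?Q (?n k))
        \<le> ?N (?n k) * ?w (?n k) / ?Q (?n k)"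
      using ge by eventually_elim (rule bounds(1))
    show "\<forall>\<^sub>F k in sequentially. ?N (?n k) * ?w (?n k) / ?Q (?n k)
        \<le> real z * (real (num_subspaces TYPE('a) (?n k)) / ?Q (?n k)) + ?err (?n k)"
      using ge by eventually_elim (rule bounds(2))
  qed
  then have "(\<lambda>k. (?N (?n k) * ?w (?n k) / ?Q (?n k)) / (real z * ?L)) \<longlonglongrightarrow> (real z * ?L) / (real z * ?L)"
    by (rule tendsto_divide[OF _ tendsto_const less_imp_neq[OF zL, THEN not_sym]])
  then have lim: "(\<lambda>k. (?N (?n k) * ?w (?n k) / ?Q (?n k)) / (real z * ?L)) \<longlonglongrightarrow> 1"
    using zL by (simp only: divide_self[OF less_imp_neq[THEN not_sym]])
  have "\<forall>\<^sub>F k in sequentially. (?N (?n k) * ?w (?n k) / ?Q (?n k)) / (real z * ?L) = ?N (?n k) / (?L * h k)"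
    using h
  proof eventually_elim
    case (elim k)
    show ?case unfolding elim using Q0[of "?n k"] w0[of "?n k"] L z by (simp add: field_simps)
  qed
  then have "(\<lambda>k. ?N (?n k) / (?L * h k)) \<longlonglongrightarrow> 1" using lim by (rule Lim_transform_eventually[rotated])
  then show ?thesis by (rule asymp_equivI')
qed

section \<open>The three code counts and the limit of large fields\<close>

lemma N_perm_eq: "N_perm TYPE('a::{field,finite}) n = num_code_orbits n (code_maps n (perm_params n) {id :: 'a \<Rightarrow> 'a})"
  by (simp add: N_perm_def coord_perm_maps_eq)

lemma N_mon_eq: "N_mon TYPE('a::{field,finite}) n = num_code_orbits n (code_maps n (mono_params n) {id :: 'a \<Rightarrow> 'a})"
  by (simp add: N_mon_def monomial_maps_eq)

lemma N_semilin_eq: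
  "N_semilin TYPE('a::{field,finite}) n = num_code_orbits n (code_maps n (mono_params n) (field_auts :: ('a \<Rightarrow> 'a) set))"
  by (simp add: N_semilin_def generate_semilinear_maps)

lemma powr_square_even: "0 < q \<Longrightarrow> q powr ((real (2 * k))\<^sup>2 / 4) = q ^ k\<^sup>2"
  by (simp add: power2_eq_square flip: powr_realpow)

theorem corollary4p1:
  fixes q p a :: nat
  assumes q: "q = CARD('a::{field,finite})"
    and p: "p = CHAR('a)"
    and a: "a = card (field_auts :: ('a \<Rightarrow> 'a) set)"
  shows "real a = log (real p) (real q) \<and>
    (\<lambda>n. real (N_perm TYPE('a) (2*n+1))) \<sim>[at_top]
      (\<lambda>n. theta2 (inverse (real q)) / phi (inverse (real q)) *
        (real q powr (real ((2*n+1)^2) / 4) / fact (2*n+1))) \<and>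
    (\<lambda>n. real (N_perm TYPE('a) (2*n))) \<sim>[at_top]
      (\<lambda>n. theta3 (inverse (real q)) / phi (inverse (real q)) *
        (real q ^ (n^2) / fact (2*n))) \<and>
    (\<lambda>n. real (N_mon TYPE('a) (2*n+1))) \<sim>[at_top]
      (\<lambda>n. theta2 (inverse (real q)) / phi (inverse (real q)) *
        (real q powr (real ((2*n+1)^2) / 4) / (fact (2*n+1) * (real q - 1) ^ (2*n)))) \<and>
    (\<lambda>n. real (N_mon TYPE('a) (2*n))) \<sim>[at_top]
      (\<lambda>n. theta3 (inverse (real q)) / phi (inverse (real q)) *
        (real q ^ (n^2) / (fact (2*n) * (real q - 1) ^ (2*n-1)))) \<and>
    (\<lambda>n. real (N_semilin TYPE('a) (2*n+1))) \<sim>[at_top]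
      (\<lambda>n. theta2 (inverse (real q)) / phi (inverse (real q)) *
        (real q powr (real ((2*n+1)^2) / 4) /
          (fact (2*n+1) * (real q - 1) ^ (2*n) * real a))) \<and>
    (\<lambda>n. real (N_semilin TYPE('a) (2*n))) \<sim>[at_top]
      (\<lambda>n. theta3 (inverse (real q)) / phi (inverse (real q)) *
        (real q ^ (n^2) / (fact (2*n) * (real q - 1) ^ (2*n-1) * real a))) \<and>
    (\<forall>n::nat.
      (\<lambda>r::nat. theta2 (inverse (real r)) / phi (inverse (real r)) *
          real r powr (real ((2*n+1)^2) / 4))
        \<sim>[inf at_top (principal {r. primepow r})] (\<lambda>r. 2 * real r ^ (n*(n+1))) \<and>
      (\<lambda>r::nat. theta3 (inverse (real r)) / phi (inverse (real r)) * real r ^ (n^2))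
        \<sim>[inf at_top (principal {r. primepow r})] (\<lambda>r. real r ^ (n^2)))"
proof -
  have q2: "2 \<le> real q" unfolding q using coord.real_q_ge_2[where 'a = 'a] .
  have rq1: "real (q - 1) = real q - 1" using q2 by (simp add: of_nat_diff)
  have z: "0 < q - 1" using q2 by simp
  have Mc: "card (mono_params n :: (_ \<times> (nat \<Rightarrow> 'a)) set) = fact n * (q - 1) ^ n" for n
    by (simp add: card_mono_params q)
  let ?c = "\<lambda>e. theta_half e (inverse (real q)) / phi (inverse (real q))"
  \<comment> \<open>The identity is the only scalar among the permutations, so z = 1.\<close>
  have perm: "(\<lambda>k. real (N_perm TYPE('a) (2 * k + e))) \<sim>[at_top] (\<lambda>k. ?c e * h k)"
    if "e \<le> 1" and h: "\<forall>\<^sub>F k in sequentially. h k = real q powr ((real (2 * k + e))\<^sup>2 / 4) / fact (2 * k + e)" for e h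
    unfolding N_perm_eq q
  proof (rule num_code_orbits_asymp[where z = 1])
    show "perm_params n \<subseteq> (mono_params n :: (_ \<times> (nat \<Rightarrow> 'a)) set)" for n by (rule perm_params_subset)
    show "composable (perm_params n) {id :: 'a \<Rightarrow> 'a}" for n by (rule composable_perm)
    show "card {(\<pi>, d :: nat \<Rightarrow> 'a) \<in> perm_params n. min_mismatch n \<pi> d = 0} = 1" for n
      by (rule card_scalar_perm)
    show "{id} \<subseteq> (field_auts :: ('a \<Rightarrow> 'a) set)" using id_field_aut by blast
    show "id \<in> {id :: 'a \<Rightarrow> 'a}" by (rule singletonI)
  qed (use that in \<open>simp_all add: card_perm_params q\<close>)
  \<comment> \<open>The q - 1 scalars cancel one of the factors q - 1 in the group order; hence the
    exponent one below the length in the theorem.\<close>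
  have mon: "(\<lambda>k. real (N_mon TYPE('a) (2 * k + e))) \<sim>[at_top] (\<lambda>k. ?c e * h k)"
    if "e \<le> 1" and h: "\<forall>\<^sub>F k in sequentially. h k =
      (real q - 1) * real q powr ((real (2 * k + e))\<^sup>2 / 4) / (fact (2 * k + e) * (real q - 1) ^ (2 * k + e))" for e h
    unfolding N_mon_eq q
  proof (rule num_code_orbits_asymp[where z = "q - 1"])
    show "card {(\<pi>, d :: nat \<Rightarrow> 'a) \<in> mono_params n. min_mismatch n \<pi> d = 0} = q - 1" if "n \<ge> 1" for n
      unfolding q using that by (rule card_scalar_mono)
    show "composable (mono_params n) {id :: 'a \<Rightarrow> 'a}" for n
      by (rule composable_mono) (use id_field_aut in auto)
    show "\<forall>\<^sub>F k in sequentially. h k = real (q - 1) * real CARD('a) powr ((real (2 * k + e))\<^sup>2 / 4) /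
        (real (card (mono_params (2 * k + e) :: (_ \<times> (nat \<Rightarrow> 'a)) set)) * real (card {id :: 'a \<Rightarrow> 'a}))"
      using h by (simp add: Mc rq1[unfolded One_nat_def] flip: q)
    show "{id} \<subseteq> (field_auts :: ('a \<Rightarrow> 'a) set)" using id_field_aut by blast
    show "id \<in> {id :: 'a \<Rightarrow> 'a}" by (rule singletonI)
  qed (use that(1) z in \<open>simp_all add: Mc\<close>)
  have semi: "(\<lambda>k. real (N_semilin TYPE('a) (2 * k + e))) \<sim>[at_top] (\<lambda>k. ?c e * h k)"
    if "e \<le> 1" and h: "\<forall>\<^sub>F k in sequentially. h k =
      (real q - 1) * real q powr ((real (2 * k + e))\<^sup>2 / 4) / (fact (2 * k + e) * (real q - 1) ^ (2 * k + e) * real a)" for e h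
    unfolding N_semilin_eq q
  proof (rule num_code_orbits_asymp[where z = "q - 1"])
    show "card {(\<pi>, d :: nat \<Rightarrow> 'a) \<in> mono_params n. min_mismatch n \<pi> d = 0} = q - 1" if "n \<ge> 1" for n
      unfolding q using that by (rule card_scalar_mono)
    show "composable (mono_params n) (field_auts :: ('a \<Rightarrow> 'a) set)" for n
      by (rule composable_mono) (use field_auts_comp in auto)
    show "\<forall>\<^sub>F k in sequentially. h k = real (q - 1) * real CARD('a) powr ((real (2 * k + e))\<^sup>2 / 4) /
        (real (card (mono_params (2 * k + e) :: (_ \<times> (nat \<Rightarrow> 'a)) set)) * real (card (field_auts :: ('a \<Rightarrow> 'a) set)))"
      using h by (simp add: Mc rq1[unfolded One_nat_def] flip: q a)
    show "(id :: 'a \<Rightarrow> 'a) \<in> field_auts" by (rule id_field_aut)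
  qed (use that(1) z in \<open>simp_all add: Mc\<close>)
  have log: "real a = log (real p) (real q)"
  proof -
    have "real q = real p ^ a" unfolding q p a by (subst card_finite_field_auts) simp
    moreover have "1 < real p" unfolding p using prime_gt_1_nat[OF prime_CHAR_finite_field[where 'a = 'a]] by simp
    ultimately show ?thesis by (simp add: log_nat_power)
  qed
  \<comment> \<open>At k = 0 the exponent 2 k - 1 is truncated to 0 and the identity fails unless q
    = 2, so it is stated eventually.\<close>
  have ev1: "\<forall>\<^sub>F k in sequentially. (real q - 1) ^ (2 * k) = (real q - 1) * (real q - 1) ^ (2 * k - 1)"
    using eventually_ge_at_top[of 1]
  proof eventually_elim
    case (elim k)
    then have "2 * k = Suc (2 * k - 1)" by simp
    then show ?case by (metis power_Suc)
  qed
  have q1: "real q - 1 \<noteq> 0" using q2 by simp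
  have perm_odd: "(\<lambda>n. real (N_perm TYPE('a) (2*n+1))) \<sim>[at_top]
      (\<lambda>n. theta2 (inverse (real q)) / phi (inverse (real q)) *
        (real q powr (real ((2*n+1)^2) / 4) / fact (2*n+1)))"
    unfolding theta_half_1[symmetric] by (rule perm) simp_all
  have perm_even: "(\<lambda>n. real (N_perm TYPE('a) (2*n))) \<sim>[at_top]
      (\<lambda>n. theta3 (inverse (real q)) / phi (inverse (real q)) * (real q ^ (n^2) / fact (2*n)))"
    unfolding theta_half_0[symmetric]
    by (rule perm[where e = 0, unfolded add_0_right]) (use q2 in \<open>simp_all add: powr_square_even del: of_nat_mult\<close>)
  have mon_odd: "(\<lambda>n. real (N_mon TYPE('a) (2*n+1))) \<sim>[at_top]
      (\<lambda>n. theta2 (inverse (real q)) / phi (inverse (real q)) *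
        (real q powr (real ((2*n+1)^2) / 4) / (fact (2*n+1) * (real q - 1) ^ (2*n))))"
    unfolding theta_half_1[symmetric] by (rule mon) (use q1 in simp_all)
  have mon_even: "(\<lambda>n. real (N_mon TYPE('a) (2*n))) \<sim>[at_top]
      (\<lambda>n. theta3 (inverse (real q)) / phi (inverse (real q)) *
        (real q ^ (n^2) / (fact (2*n) * (real q - 1) ^ (2*n-1))))"
    unfolding theta_half_0[symmetric]
  proof (rule mon[where e = 0, unfolded add_0_right])
    show "\<forall>\<^sub>F k in sequentially. real q ^ (k^2) / (fact (2*k) * (real q - 1) ^ (2*k-1)) =
        (real q - 1) * real q powr ((real (2 * k))\<^sup>2 / 4) / (fact (2 * k) * (real q - 1) ^ (2 * k))"
      using ev1
    proof eventually_elim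
      case (elim k)
      have "real q powr ((real (2 * k))\<^sup>2 / 4) = real q ^ k\<^sup>2" by (rule powr_square_even) (use q2 in simp)
      then show ?case using q1 by (simp only: elim) simp
    qed
  qed simp
  have semi_odd: "(\<lambda>n. real (N_semilin TYPE('a) (2*n+1))) \<sim>[at_top]
      (\<lambda>n. theta2 (inverse (real q)) / phi (inverse (real q)) *
        (real q powr (real ((2*n+1)^2) / 4) / (fact (2*n+1) * (real q - 1) ^ (2*n) * real a)))"
    unfolding theta_half_1[symmetric] by (rule semi) (use q1 in simp_all)
  have semi_even: "(\<lambda>n. real (N_semilin TYPE('a) (2*n))) \<sim>[at_top]
      (\<lambda>n. theta3 (inverse (real q)) / phi (inverse (real q)) *
        (real q ^ (n^2) / (fact (2*n) * (real q - 1) ^ (2*n-1) * real a)))"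
    unfolding theta_half_0[symmetric]
  proof (rule semi[where e = 0, unfolded add_0_right])
    show "\<forall>\<^sub>F k in sequentially. real q ^ (k^2) / (fact (2*k) * (real q - 1) ^ (2*k-1) * real a) =
        (real q - 1) * real q powr ((real (2 * k))\<^sup>2 / 4) / (fact (2 * k) * (real q - 1) ^ (2 * k) * real a)"
      using ev1
    proof eventually_elim
      case (elim k)
      have "real q powr ((real (2 * k))\<^sup>2 / 4) = real q ^ k\<^sup>2" by (rule powr_square_even) (use q2 in simp)
      then show ?case using q1 by (simp only: elim) simp
    qed
  qed simp
  have large: "(\<lambda>r::nat. theta2 (inverse (real r)) / phi (inverse (real r)) *
          real r powr (real ((2*n+1)^2) / 4)) \<sim>[inf at_top (principal {r. primepow r})] (\<lambda>r. 2 * real r ^ (n*(n+1))) \<and>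
      (\<lambda>r::nat. theta3 (inverse (real r)) / phi (inverse (real r)) * real r ^ (n^2))
        \<sim>[inf at_top (principal {r. primepow r})] (\<lambda>r. real r ^ (n^2))" for n
  proof
    have pos: "\<forall>\<^sub>F r::nat in sequentially. 0 < real r" using eventually_gt_at_top[of 0] by eventually_elim simp
    have l2: "(\<lambda>r. real r powr (1 / 4) * theta2 (inverse (real r)) / phi (inverse (real r)) / 2) \<longlonglongrightarrow> 1"
      using tendsto_divide[OF tendsto_divide[OF theta_half_inverse_tendsto[of 1] phi_inverse_tendsto_1] tendsto_const[of 2]]
      by (simp add: theta_half_1[unfolded One_nat_def])
    have l3: "(\<lambda>r. theta3 (inverse (real r)) / phi (inverse (real r))) \<longlonglongrightarrow> 1"
    proof -
      have "(\<lambda>r. real r powr (real 0 / 4) * theta_half 0 (inverse (real r)) / phi (inverse (real r))) \<longlonglongrightarrow> 1"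
        using tendsto_divide[OF theta_half_inverse_tendsto[of 0] phi_inverse_tendsto_1] by simp
      then show ?thesis
      proof (rule Lim_transform_eventually)
        show "\<forall>\<^sub>F r in sequentially. real r powr (real 0 / 4) * theta_half 0 (inverse (real r)) / phi (inverse (real r)) =
            theta3 (inverse (real r)) / phi (inverse (real r))"
          using pos by eventually_elim (simp add: theta_half_0)
      qed
    qed
    have "(\<lambda>r::nat. theta2 (inverse (real r)) / phi (inverse (real r)) * real r powr (real ((2*n+1)^2) / 4) /
        (2 * real r ^ (n*(n+1)))) \<longlonglongrightarrow> 1"
    proof (rule Lim_transform_eventually[OF l2])
      show "\<forall>\<^sub>F r in sequentially. real r powr (1 / 4) * theta2 (inverse (real r)) / phi (inverse (real r)) / 2 =
          theta2 (inverse (real r)) / phi (inverse (real r)) * real r powr (real ((2*n+1)^2) / 4) / (2 * real r ^ (n*(n+1)))"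
        using pos
      proof eventually_elim
        case (elim r)
        \<comment> \<open>The surplus 1/4 balances the two largest terms of theta2, both equal to
          r^(-1/4).\<close>
        have "real ((2*n+1)^2) / 4 = 1 / 4 + real (n*(n+1))" by (simp add: power2_eq_square algebra_simps add_divide_distrib)
        then have "real r powr (real ((2*n+1)^2) / 4) = real r powr (1 / 4) * real r ^ (n*(n+1))"
          using elim by (simp only: powr_add powr_realpow)
        then show ?case using elim by simp
      qed
    qed
    \<comment> \<open>A limit along all naturals holds in particular along the prime powers.\<close>
    then show "(\<lambda>r::nat. theta2 (inverse (real r)) / phi (inverse (real r)) * real r powr (real ((2*n+1)^2) / 4))
        \<sim>[inf at_top (principal {r. primepow r})] (\<lambda>r. 2 * real r ^ (n*(n+1)))"
      by (intro asymp_equivI') (rule tendsto_mono[OF inf_le1])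
    have "(\<lambda>r::nat. theta3 (inverse (real r)) / phi (inverse (real r)) * real r ^ (n^2) / real r ^ (n^2)) \<longlonglongrightarrow> 1"
    proof (rule Lim_transform_eventually[OF l3])
      show "\<forall>\<^sub>F r in sequentially. theta3 (inverse (real r)) / phi (inverse (real r)) =
          theta3 (inverse (real r)) / phi (inverse (real r)) * real r ^ (n^2) / real r ^ (n^2)"
        using pos by eventually_elim simp
    qed
    then show "(\<lambda>r::nat. theta3 (inverse (real r)) / phi (inverse (real r)) * real r ^ (n^2))
        \<sim>[inf at_top (principal {r. primepow r})] (\<lambda>r. real r ^ (n^2))"
      by (intro asymp_equivI') (rule tendsto_mono[OF inf_le1])
  qed
  show ?thesis
    using log perm_odd perm_even mon_odd mon_even semi_odd semi_even large by blast
qed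

end
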